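(* Let $\Omega\subset\mathbb{R}^n$ be a bounded domain with smooth boundary, $p\in(1,\infty)$ and $\mathbf{g}\in W^{1,p}_0(\Omega;\mathbb{R}^m)$. Assume that $\mathbf{v}$ is a weak solution of $$\begin{cases}|\mathbf{v}_t|^{p-2}\mathbf{v}_t=\operatorname{div}(|D\mathbf{v}|^{p-2}D\mathbf{v}), & \Omega\times(0,\infty)\\ \mathbf{v}=\mathbf{0}, & \partial\Omega\times[0,\infty)\\ \mathbf{v}=\mathbf{g}, & \Omega\times\{0\}\end{cases}$$ such that $\mathbf{v}(\cdot,t)\ne\mathbf{0}$ for each $t\ge0$. Then the $p$-Rayleigh quotient $$[0,\infty)\ni t\mapsto\frac{\int_\Omega|D\mathbf{v}(x,t)|^p\,dx}{\int_\Omega|\mathbf{v}(x,t)|^p\,dx}$$ is nonincreasing.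
   Context: For matrices, $M\cdot N=\operatorname{tr}(M^tN)$ and $|M|=\sqrt{M\cdot M}$; $D\mathbf v=(v^i_{x_j})$ is the spatial gradient matrix. A weak solution of the initial value problem is a mapping $\mathbf v$ such that for every $T>0$: $\mathbf v_t\in L^p(\Omega\times(0,T);\mathbb R^m)$, $\mathbf v\in L^\infty([0,T];W^{1,p}_0(\Omega;\mathbb R^m))$, $$\int_\Omega|\mathbf v_t(x,t)|^{p-2}\mathbf v_t(x,t)\cdot\mathbf w(x)\,dx+\int_\Omega|D\mathbf v(x,t)|^{p-2}D\mathbf v(x,t)\cdot D\mathbf w(x)\,dx=0$$ for each $\mathbf w\in W^{1,p}_0(\Omega;\mathbb R^m)$ and a.e. $t\in[0,T]$; and $\mathbf v(\cdot,0)=\mathbf g$. Here $\mathbf v$ is identified with its representative in $C([0,\infty);L^p(\Omega;\mathbb R^m))$, and $|z|^{p-2}z:=0$ for $z=0$. *)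

theory Defs
  imports "HOL-Analysis.Analysis"
begin

section \<open>Smooth functions, test functions, smooth boundaries\<close>

primrec C_k :: "nat \<Rightarrow> ('a::euclidean_space \<Rightarrow> 'b::real_normed_vector) \<Rightarrow> bool" where
  "C_k 0 f \<longleftrightarrow> continuous_on UNIV f"
| "C_k (Suc k) f \<longleftrightarrow> (\<forall>x. f differentiable (at x)) \<and>
     (\<forall>h. C_k k (\<lambda>x. frechet_derivative f (at x) h))"

definition C_infty :: "('a::euclidean_space \<Rightarrow> 'b::real_normed_vector) \<Rightarrow> bool" where
  "C_infty f \<longleftrightarrow> (\<forall>k. C_k k f)"

definition test_function :: "'a::euclidean_space set \<Rightarrow> ('a \<Rightarrow> 'b::real_normed_vector) \<Rightarrow> bool" where
  "test_function U \<phi> \<longleftrightarrow> C_infty \<phi> \<and> (\<exists>K. compact K \<and> K \<subseteq> U \<and> (\<forall>x. x \<notin> K \<longrightarrow> \<phi> x = 0))"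

text \<open>
  Locally at the boundary, \<open>\<Omega>\<close> is the strict epigraph of a smooth function: with \<open>e\<close> the
  direction of the last axis of the rotated coordinates, a function of the remaining \<open>n - 1\<close>
  coordinates is a function on the whole space that is constant along \<open>e\<close>.
\<close>

definition smooth_boundary :: "'a::euclidean_space set \<Rightarrow> bool" where
  "smooth_boundary \<Omega> \<longleftrightarrow> (\<forall>x0 \<in> frontier \<Omega>. \<exists>r > 0. \<exists>e. \<exists>\<gamma> :: 'a \<Rightarrow> real.
     norm e = 1 \<and> C_infty \<gamma> \<and> (\<forall>x s. \<gamma> (x + s *\<^sub>R e) = \<gamma> x) \<and>
     \<Omega> \<inter> ball x0 r = {x \<in> ball x0 r. \<gamma> x < x \<bullet> e})"

definition bounded_smooth_domain :: "'a::euclidean_space set \<Rightarrow> bool" where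
  "bounded_smooth_domain \<Omega> \<longleftrightarrow>
     open \<Omega> \<and> connected \<Omega> \<and> \<Omega> \<noteq> {} \<and> bounded \<Omega> \<and> smooth_boundary \<Omega>"

section \<open>Lebesgue and Sobolev spaces\<close>

text \<open>
  Functions are total; only their values almost everywhere on the given set matter.
\<close>

definition Lp :: "real \<Rightarrow> 'a::euclidean_space set \<Rightarrow> ('a \<Rightarrow> 'b::euclidean_space) \<Rightarrow> bool" where
  "Lp p S f \<longleftrightarrow> f \<in> borel_measurable (lebesgue_on S) \<and>
     integrable (lebesgue_on S) (\<lambda>x. norm (f x) powr p)"

definition locally_integrable ::
    "'a::euclidean_space set \<Rightarrow> ('a \<Rightarrow> 'b::euclidean_space) \<Rightarrow> bool" where
  "locally_integrable U f \<longleftrightarrow> (\<forall>K. compact K \<and> K \<subseteq> U \<longrightarrow> integrable (lebesgue_on K) f)"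

definition has_weak_deriv :: "'a::euclidean_space set \<Rightarrow> 'a \<Rightarrow>
    ('a \<Rightarrow> 'b::euclidean_space) \<Rightarrow> ('a \<Rightarrow> 'b) \<Rightarrow> bool" where
  "has_weak_deriv U h f g \<longleftrightarrow> locally_integrable U f \<and> locally_integrable U g \<and>
     (\<forall>\<phi> :: 'a \<Rightarrow> real. test_function U \<phi> \<longrightarrow>
        (\<integral>x. frechet_derivative \<phi> (at x) h *\<^sub>R f x \<partial>lebesgue_on U) =
        - (\<integral>x. \<phi> x *\<^sub>R g x \<partial>lebesgue_on U))"

text \<open>Row \<open>i\<close> and column \<open>j\<close> of the gradient matrix hold the derivative of \<open>u\<^sup>i\<close> along \<open>x\<^sub>j\<close>.\<close>

definition has_weak_grad :: "(real^'n) set \<Rightarrow> (real^'n \<Rightarrow> real^'m) \<Rightarrow>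
    (real^'n \<Rightarrow> real^'n^'m) \<Rightarrow> bool" where
  "has_weak_grad U u G \<longleftrightarrow> (\<forall>j. has_weak_deriv U (axis j 1) u (\<lambda>x. column j (G x)))"

text \<open>Unique almost everywhere on \<open>U\<close> if it exists, unspecified otherwise.\<close>

definition weak_grad :: "(real^'n) set \<Rightarrow> (real^'n \<Rightarrow> real^'m) \<Rightarrow> real^'n \<Rightarrow> real^'n^'m" where
  "weak_grad U u = (SOME G. has_weak_grad U u G)"

text \<open>
  The library's inner product on matrices, and hence its norm, are those of the trace pairing.
\<close>

lemma matrix_inner_eq_trace:
  fixes A B :: "real^'n^'m"
  shows "A \<bullet> B = trace (transpose A ** B)" and "norm A = sqrt (trace (transpose A ** A))"
proof -
  show *: "A \<bullet> B = trace (transpose A ** B)" for A B :: "real^'n^'m"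
    unfolding inner_vec_def trace_def matrix_matrix_mult_def transpose_def
    by (simp, rule sum.swap)
  show "norm A = sqrt (trace (transpose A ** A))"
    by (simp add: norm_eq_sqrt_inner *)
qed

definition W1p :: "real \<Rightarrow> (real^'n) set \<Rightarrow> (real^'n \<Rightarrow> real^'m) \<Rightarrow> bool" where
  "W1p p U u \<longleftrightarrow> Lp p U u \<and> (\<exists>G. has_weak_grad U u G \<and> Lp p U G)"

definition W1p_norm :: "real \<Rightarrow> (real^'n) set \<Rightarrow> (real^'n \<Rightarrow> real^'m) \<Rightarrow> real" where
  "W1p_norm p U u = ((\<integral>x. norm (u x) powr p \<partial>lebesgue_on U) +
     (\<integral>x. norm (weak_grad U u x) powr p \<partial>lebesgue_on U)) powr (1 / p)"

definition W1p0 :: "real \<Rightarrow> (real^'n) set \<Rightarrow> (real^'n \<Rightarrow> real^'m) \<Rightarrow> bool" where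
  "W1p0 p U u \<longleftrightarrow> W1p p U u \<and>
     (\<exists>\<phi> :: nat \<Rightarrow> real^'n \<Rightarrow> real^'m. (\<forall>k. test_function U (\<phi> k)) \<and>
        (\<lambda>k. W1p_norm p U (\<lambda>x. u x - \<phi> k x)) \<longlonglongrightarrow> 0)"

section \<open>Time-dependent functions\<close>

text \<open>
  Membership of \<open>t \<mapsto> v(\<cdot>,t)\<close> in \<open>C([0,\<infty>); L\<^sup>p(\<Omega>; \<real>\<^sup>m))\<close>, for all times rather than almost all.
\<close>

definition continuous_Lp :: "real \<Rightarrow> (real^'n) set \<Rightarrow> ((real^'n) \<times> real \<Rightarrow> real^'m) \<Rightarrow> bool" where
  "continuous_Lp p \<Omega> v \<longleftrightarrow> (\<forall>t \<ge> 0. Lp p \<Omega> (\<lambda>x. v (x, t)) \<and>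
     ((\<lambda>s. \<integral>x. norm (v (x, s) - v (x, t)) powr p \<partial>lebesgue_on \<Omega>) \<longlongrightarrow> 0) (at t within {0..}))"

text \<open>
  Membership in \<open>L\<^sup>\<infinity>([0,T]; W\<^sub>0\<^sup>1\<^sup>,\<^sup>p(\<Omega>; \<real>\<^sup>m))\<close>: strongly measurable (an almost everywhere limit of
  simple functions with values in the Sobolev space) and essentially bounded.
\<close>

definition Linf_W1p0 :: "real \<Rightarrow> (real^'n) set \<Rightarrow> real \<Rightarrow> ((real^'n) \<times> real \<Rightarrow> real^'m) \<Rightarrow> bool" where
  "Linf_W1p0 p \<Omega> T v \<longleftrightarrow>
     (\<exists>C. AE t in lebesgue_on {0..T}.
        W1p0 p \<Omega> (\<lambda>x. v (x, t)) \<and> W1p_norm p \<Omega> (\<lambda>x. v (x, t)) \<le> C) \<and>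
     (\<exists>s :: nat \<Rightarrow> real \<Rightarrow> real^'n \<Rightarrow> real^'m.
        (\<forall>k. finite (s k ` {0..T}) \<and>
           (\<forall>u \<in> s k ` {0..T}. W1p0 p \<Omega> u \<and> {t \<in> {0..T}. s k t = u} \<in> sets lebesgue)) \<and>
        (AE t in lebesgue_on {0..T}.
           (\<lambda>k. W1p_norm p \<Omega> (\<lambda>x. s k t x - v (x, t))) \<longlonglongrightarrow> 0))"

text \<open>
  For \<open>z = 0\<close> the flux \<open>norm z powr (p - 2) *\<^sub>R z\<close> is \<open>0\<close>, as required also when \<open>p < 2\<close>.
\<close>

definition weak_solution :: "real \<Rightarrow> (real^'n) set \<Rightarrow> (real^'n \<Rightarrow> real^'m) \<Rightarrow>
    ((real^'n) \<times> real \<Rightarrow> real^'m) \<Rightarrow> bool" where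
  "weak_solution p \<Omega> g v \<longleftrightarrow>
     continuous_Lp p \<Omega> v \<and>
     (\<exists>vt. has_weak_deriv (\<Omega> \<times> {0<..}) (0, 1) v vt \<and>
       (\<forall>T > 0.
          Lp p (\<Omega> \<times> {0<..<T}) vt \<and>
          Linf_W1p0 p \<Omega> T v \<and>
          (\<forall>w. W1p0 p \<Omega> w \<longrightarrow> (AE t in lebesgue_on {0..T}.
             (\<integral>x. (norm (vt (x, t)) powr (p - 2) *\<^sub>R vt (x, t)) \<bullet> w x \<partial>lebesgue_on \<Omega>) +
             (\<integral>x. (norm (weak_grad \<Omega> (\<lambda>y. v (y, t)) x) powr (p - 2)
                      *\<^sub>R weak_grad \<Omega> (\<lambda>y. v (y, t)) x) \<bullet> weak_grad \<Omega> w x \<partial>lebesgue_on \<Omega>) = 0)))) \<and>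
     (AE x in lebesgue_on \<Omega>. v (x, 0) = g x)"

definition rayleigh_quotient :: "real \<Rightarrow> (real^'n) set \<Rightarrow> (real^'n \<Rightarrow> real^'m) \<Rightarrow> real" where
  "rayleigh_quotient p \<Omega> u =
     (\<integral>x. norm (weak_grad \<Omega> u x) powr p \<partial>lebesgue_on \<Omega>) /
     (\<integral>x. norm (u x) powr p \<partial>lebesgue_on \<Omega>)"

end

theory Submission
  imports Defs "HOL-Computational_Algebra.Polynomial"
begin

text \<open>
  Write \<open>J(z) = |z|\<^sup>p\<^sup>-\<^sup>2 z\<close> for the flux, \<open>E(t)\<close> for the integral of \<open>|Dv(t)|\<^sup>p\<close>, \<open>N(t)\<close> for that of
  \<open>|v(t)|\<^sup>p\<close> and \<open>A(t)\<close> for that of \<open>|v\<^sub>t(t)|\<^sup>p\<close>. Formally, testing the equation with \<open>v\<^sub>t\<close> gives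
  \<open>E' = - p A\<close>, testing with \<open>v\<close> and Hoelder's inequality give \<open>E \<le> A\<^sup>1\<^sup>-\<^sup>1\<^sup>/\<^sup>p N\<^sup>1\<^sup>/\<^sup>p\<close>, and Hoelder's inequality
  again bounds \<open>- N'\<close> by \<open>p N\<^sup>1\<^sup>-\<^sup>1\<^sup>/\<^sup>p A\<^sup>1\<^sup>/\<^sup>p\<close>. The last two combine to \<open>- N' \<le> p N A / E\<close>, that is
  \<open>(log E)' = - p A / E \<le> (log N)'\<close>, so the quotient \<open>E / N\<close> does not increase.

  A weak solution need not have a spatial derivative of \<open>v\<^sub>t\<close>, so \<open>E\<close> cannot be differentiated. What replaces the
  chain rule is convexity. For good times \<open>s\<close> and \<open>t\<close>, the equation at \<open>s\<close> with the test function
  \<open>v(t) - v(s)\<close> turns the subgradient inequality for \<open>|\<cdot>|\<^sup>p\<close> into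
  \<open>E(t) - E(s) \<ge> p \<integral> J(v\<^sub>t(s)) \<cdot> (v(s) - v(t))\<close>. With \<open>t = s - h\<close>, integrated over \<open>s\<close> and divided by \<open>h\<close>,
  the left side telescopes, while on the right the backward averages of \<open>v\<^sub>t\<close> converge to \<open>v\<^sub>t\<close>. The
  outcome is \<open>E(a) - E(b) \<ge> p \<integral>\<^sub>a\<^sup>b A\<close> (\<open>energy_dissipation\<close>), one half of the energy identity, which suffices.

  The quotient has to be controlled at every time, also where neither the equation nor the Sobolev bound
  is known. Near any time \<open>a\<close> there are good times \<open>s > a\<close> at which \<open>(s - a) A(s)\<close> is small. There the
  subgradient inequality at \<open>s\<close> bounds from below the energy of the midpoint of two gradients, and uniform
  convexity of \<open>L\<^sup>p\<close> makes the gradients a Cauchy sequence (\<open>gradient_right_limit\<close>). Hence \<open>v(a)\<close> has a weak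
  gradient, \<open>E(a)\<close> is the limit of \<open>E\<close> from the right, and the dissipation inequality holds for all times.

  It remains to conclude without differentiating \<open>E\<close>, which may jump downwards. For every \<open>\<eta> > 0\<close> the
  function \<open>(1 + \<eta>)\<^sup>3 log E - log N\<close> does not increase just to the right of each point, by right continuity
  of \<open>E\<close>, and it cannot jump upwards; so it is nonincreasing (\<open>log_quotient\<close>), and \<open>\<eta>\<close> may tend to \<open>0\<close>.

  Two further ingredients connect this with the definitions. Smooth bumps that approximate indicators of
  boxes show that weak derivatives are unique and that the increments of \<open>v\<close> are integrals of \<open>v\<^sub>t\<close>
  (\<open>increment_eq_integral_weak_derivative\<close>). The equation is given for each test function up to a null
  set of times; strong measurability supplies countably many test functions whose limits include \<open>v(t)\<close>
  for almost every \<open>t\<close>, so that one null set serves for all of them (\<open>weak_solution_Lp_flow\<close>).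
\<close>

section \<open>The flux and the strict convexity of the p-th power of the norm\<close>

definition flux :: "real \<Rightarrow> 'b::euclidean_space \<Rightarrow> 'b" where
  "flux p z = norm z powr (p - 2) *\<^sub>R z"

lemma norm_flux: "norm (flux p z) = norm z powr (p - 1)"
proof (cases "z = 0")
  case False
  then show ?thesis
    using powr_mult_base[of "norm z" "p - 2"] by (simp add: flux_def mult.commute)
qed (simp add: flux_def)

lemma inner_flux_self: "flux p z \<bullet> z = norm z powr p"
proof (cases "z = 0")
  case False
  have "norm z powr p = norm z powr (p - 2) * norm z powr 2"
    by (metis diff_add_cancel powr_add)
  then show ?thesis
    using False by (simp add: flux_def powr_numeral power2_norm_eq_inner)
qed (simp add: flux_def)

lemma inner_flux_le: "\<bar>flux p z \<bullet> y\<bar> \<le> norm z powr (p - 1) * norm y"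
  using Cauchy_Schwarz_ineq2[of "flux p z" y] by (simp add: norm_flux)

lemma powr_split_minus_1:
  fixes a :: real assumes "a \<ge> 0"
  shows "a powr p = a powr (p - 1) * a"
  using powr_mult_base[OF assms, of "p - 1"] by (simp add: mult.commute)

lemma powr_strict_tangent:
  fixes t p :: real
  assumes p: "1 < p" and t: "0 \<le> t" "t \<noteq> 1"
  shows "1 + p * (t - 1) < t powr p"
proof -
  have der: "((\<lambda>x. x powr p) has_real_derivative p * x powr (p - 1)) (at x)" if "0 < x" for x
    using that by (auto intro!: derivative_eq_intros)
  consider "t = 0" | "0 < t" "t < 1" | "1 < t" using t by linarith
  then show ?thesis
  proof cases
    case 2
    obtain x where x: "t < x" "x < 1" "1 powr p - t powr p = (1 - t) * (p * x powr (p - 1))"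
      using MVT2[of t 1 "\<lambda>x. x powr p" "\<lambda>x. p * x powr (p - 1)"] 2 der by force
    have "x powr (p - 1) < 1 powr (p - 1)" using x 2 p by (intro powr_less_mono2) auto
    then have "(1 - t) * (p * x powr (p - 1)) < (1 - t) * p" using 2 p by simp
    then show ?thesis using x by (simp add: algebra_simps)
  next
    case 3
    obtain x where x: "1 < x" "x < t" "t powr p - 1 powr p = (t - 1) * (p * x powr (p - 1))"
      using MVT2[of 1 t "\<lambda>x. x powr p" "\<lambda>x. p * x powr (p - 1)"] 3 der by force
    have "1 powr (p - 1) < x powr (p - 1)" using x 3 p by (intro powr_less_mono2) auto
    then have "(t - 1) * p < (t - 1) * (p * x powr (p - 1))" using 3 p by simp
    then show ?thesis using x by (simp add: algebra_simps)
  qed (use p in auto)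
qed

text \<open>
  Young's inequality is the tangent inequality \<open>1 + p (t - 1) \<le> t\<^sup>p\<close> at \<open>t = b / a\<close>, scaled by \<open>a\<^sup>p\<close>.
\<close>

lemma Young_powr:
  fixes a b :: real
  assumes p: "1 < p" and "0 \<le> a" "0 \<le> b"
  shows "p * (a powr (p - 1) * b) \<le> (p - 1) * a powr p + b powr p"
proof (cases "a = 0")
  case False
  then have a: "a > 0" using assms by simp
  have "1 + p * (b / a - 1) \<le> (b / a) powr p"
    using powr_strict_tangent[OF p, of "b / a"] assms by (cases "b / a = 1") auto
  then have "a powr p * (1 + p * (b / a - 1)) \<le> a powr p * (b / a) powr p"
    by (intro mult_left_mono) auto
  also have "\<dots> = b powr p" using a assms by (simp add: powr_divide)
  finally have "a powr (p - 1) * a * (1 + p * (b / a - 1)) \<le> b powr p"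
    using a powr_split_minus_1[of a p] by simp
  moreover have "a powr (p - 1) * a * (1 + p * (b / a - 1)) =
      a powr (p - 1) * a + p * (a powr (p - 1) * b) - p * (a powr (p - 1) * a)"
    using a by (simp add: field_simps)
  ultimately show ?thesis
    using a powr_split_minus_1[of a p] by (simp add: algebra_simps)
qed (use assms in auto)

lemma powr_mult_le_sum:
  fixes a b :: real
  assumes p: "1 < p" and "0 \<le> a" "0 \<le> b"
  shows "a powr (p - 1) * b \<le> a powr p + b powr p"
proof -
  have "p * (a powr (p - 1) * b) \<le> p * a powr p + p * b powr p"
    using Young_powr[OF assms] p by (smt (verit) mult_right_mono mult_cancel_right1 powr_ge_zero mult_le_cancel_right1)
  then show ?thesis using p by (simp flip: distrib_left)
qed

text \<open>
  For a typical velocity \<open>a\<close> and an increment \<open>b\<close> over a time interval of length \<open>h\<close>, both terms are of the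
  order of the integral of the p-th power of the velocity over that interval.
\<close>

lemma powr_mult_le_weighted:
  fixes a b h :: real
  assumes p: "1 < p" and "0 \<le> a" "0 \<le> b" "0 < h"
  shows "a powr (p - 1) * b \<le> h * a powr p + h powr (1 - p) * b powr p"
proof -
  have "a powr (p - 1) * (b / h) \<le> a powr p + (b / h) powr p"
    using assms by (intro powr_mult_le_sum) auto
  then have "h * (a powr (p - 1) * (b / h)) \<le> h * (a powr p + (b / h) powr p)"
    using assms by (intro mult_left_mono) auto
  moreover have "h * (b / h) powr p = h powr (1 - p) * b powr p"
    using assms by (simp add: powr_divide powr_diff)
  ultimately show ?thesis using assms by (simp add: algebra_simps)
qed

lemma powr_sum_le:
  fixes a b :: real
  assumes p: "0 < p" and "0 \<le> a" "0 \<le> b"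
  shows "(a + b) powr p \<le> 2 powr p * (a powr p + b powr p)"
proof -
  have "(a + b) powr p \<le> (2 * max a b) powr p"
    using assms by (intro powr_mono2) auto
  also have "\<dots> = 2 powr p * max a b powr p" using assms by (simp add: powr_mult)
  also have "\<dots> \<le> 2 powr p * (a powr p + b powr p)"
    by (intro mult_left_mono) (auto simp: max_def)
  finally show ?thesis .
qed

lemma norm_powr_subgradient:
  fixes y z :: "'b::euclidean_space"
  assumes "1 < p"
  shows "norm z powr p + p * (flux p z \<bullet> (y - z)) \<le> norm y powr p"
proof -
  have "p * (flux p z \<bullet> y) \<le> p * (norm z powr (p - 1) * norm y)"
    using inner_flux_le[of p z y] assms by (intro mult_left_mono) auto
  also have "\<dots> \<le> (p - 1) * norm z powr p + norm y powr p"
    using assms by (intro Young_powr) auto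
  finally show ?thesis by (simp add: inner_diff_right inner_flux_self algebra_simps)
qed

text \<open>
  How far the p-th power of the norm is from being affine on the segment between two points.
\<close>

definition midpoint_gap :: "real \<Rightarrow> 'b::euclidean_space \<Rightarrow> 'b \<Rightarrow> real" where
  "midpoint_gap p z w = (norm z powr p + norm w powr p) / 2 - norm ((1/2) *\<^sub>R (z + w)) powr p"

lemma midpoint_gap_nonneg:
  fixes z w :: "'b::euclidean_space"
  assumes p: "1 < p" shows "0 \<le> midpoint_gap p z w"
proof -
  define c where "c = (1/2) *\<^sub>R (z + w)"
  have "c + c = z + w" unfolding c_def by (simp flip: scaleR_left_distrib)
  then have "(z - c) + (w - c) = 0" by (simp add: algebra_simps)
  then have "flux p c \<bullet> (z - c) + flux p c \<bullet> (w - c) = 0"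
    by (metis inner_add_right inner_zero_right)
  then have "p * (flux p c \<bullet> (z - c)) + p * (flux p c \<bullet> (w - c)) = 0"
    by (metis distrib_left mult_zero_right)
  then show ?thesis
    using norm_powr_subgradient[OF p, of c z] norm_powr_subgradient[OF p, of c w]
    unfolding midpoint_gap_def c_def by argo
qed

lemma midpoint_gap_pos:
  fixes z w :: "'b::euclidean_space"
  assumes p: "1 < p" and "z \<noteq> w" shows "0 < midpoint_gap p z w"
proof -
  define a b m where "a = norm z" and "b = norm w" and "m = (a + b) / 2"
  have nn: "a \<ge> 0" "b \<ge> 0" by (auto simp: a_def b_def)
  have m: "m > 0" using assms(2) unfolding m_def a_def b_def
    by (smt (verit, best) divide_pos_pos norm_eq_zero norm_ge_zero)
  have c: "norm ((1/2) *\<^sub>R (z + w)) \<le> m"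
    using norm_triangle_ineq[of z w] by (simp add: m_def a_def b_def)
  then have c': "norm ((1/2) *\<^sub>R (z + w)) powr p \<le> m powr p"
    using p by (intro powr_mono2) auto
  show ?thesis
  proof (cases "a = b")
    case False
    then have "a / m \<noteq> 1" "b / m \<noteq> 1" using m by (auto simp: m_def)
    then have "1 + p * (a / m - 1) < (a / m) powr p" "1 + p * (b / m - 1) < (b / m) powr p"
      using nn m p by (auto intro!: powr_strict_tangent)
    moreover have "a + b = 2 * m" by (simp add: m_def)
    then have "a / m + b / m = 2" using m by (simp flip: add_divide_distrib)
    then have "p * (a / m - 1) + p * (b / m - 1) = 0" by (simp flip: distrib_left)
    ultimately have "2 < (a / m) powr p + (b / m) powr p" by linarith
    also have "\<dots> = (a powr p + b powr p) / m powr p"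
      using nn m by (simp add: powr_divide add_divide_distrib)
    finally have "2 * m powr p < a powr p + b powr p"
      using m by (simp add: pos_less_divide_eq)
    then show ?thesis using c' unfolding midpoint_gap_def a_def b_def by argo
  next
    case True
    have "norm (z + w) ^ 2 + norm (z - w) ^ 2 = 2 * norm z ^ 2 + 2 * norm w ^ 2"
      by (simp add: power2_norm_eq_inner inner_add inner_diff inner_commute)
    moreover have "norm (z - w) ^ 2 > 0" using assms by simp
    ultimately have "norm (z + w) ^ 2 < (2 * a) ^ 2" using True
      by (simp add: a_def b_def power2_eq_square)
    then have "norm (z + w) < 2 * a" by (rule power2_less_imp_less) (use nn in auto)
    then have "norm ((1/2) *\<^sub>R (z + w)) < a" by simp
    then have "norm ((1/2) *\<^sub>R (z + w)) powr p < a powr p"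
      using p by (intro powr_less_mono2) auto
    then show ?thesis using True unfolding midpoint_gap_def a_def b_def by simp
  qed
qed

lemma midpoint_gap_scaleR:
  assumes "0 \<le> r"
  shows "midpoint_gap p (r *\<^sub>R z) (r *\<^sub>R w) = r powr p * midpoint_gap p z w"
proof -
  have "norm ((1/2) *\<^sub>R (r *\<^sub>R z + r *\<^sub>R w)) = r * norm ((1/2) *\<^sub>R (z + w))"
    using assms by (simp flip: scaleR_add_right)
  then show ?thesis
    using assms unfolding midpoint_gap_def by (simp add: powr_mult algebra_simps)
qed

lemma continuous_on_norm_powr:
  assumes "continuous_on S f" "0 < p"
  shows "continuous_on S (\<lambda>x. norm (f x) powr p)"
  using assms by (intro continuous_on_powr' continuous_on_norm continuous_on_const) auto

text \<open>
  A form of uniform convexity that covers all exponents at once, in place of Clarkson's inequalities,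
  which differ for \<open>p < 2\<close> and \<open>p > 2\<close>. All terms are homogeneous of degree \<open>p\<close>, so it is enough to argue
  on the unit sphere of pairs. On the compact part where the estimate fails without the gap, the two
  points differ, hence the gap is bounded away from \<open>0\<close> by strict convexity.
\<close>

lemma norm_diff_powr_le_midpoint_gap:
  fixes p \<epsilon> :: real
  assumes p: "1 < p" and e: "0 < \<epsilon>"
  obtains C where "0 < C"
    "\<And>z w :: 'b::euclidean_space.
       norm (z - w) powr p \<le> \<epsilon> * (norm z powr p + norm w powr p) + C * midpoint_gap p z w"
proof -
  let ?S = "sphere (0 :: 'b \<times> 'b) 1"
  let ?F = "\<lambda>x :: 'b \<times> 'b. midpoint_gap p (fst x) (snd x)"
  define K where "K = ?S \<inter> {x. \<epsilon> * (norm (fst x) powr p + norm (snd x) powr p) \<le> norm (fst x - snd x) powr p}"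
  have "closed {x :: 'b \<times> 'b. \<epsilon> * (norm (fst x) powr p + norm (snd x) powr p) \<le> norm (fst x - snd x) powr p}"
    using p by (intro closed_Collect_le continuous_on_mult continuous_on_add continuous_on_norm_powr
        continuous_on_diff continuous_on_fst continuous_on_snd continuous_on_const continuous_on_id) auto
  then have K: "compact K" unfolding K_def by (intro compact_Int_closed) auto
  have cF: "continuous_on K ?F" unfolding midpoint_gap_def
    using p by (intro continuous_on_divide continuous_on_add continuous_on_norm_powr continuous_on_scaleR
        continuous_on_diff continuous_on_fst continuous_on_snd continuous_on_const continuous_on_id) auto
  have "\<exists>c>0. \<forall>x\<in>K. c \<le> ?F x"
  proof (cases "K = {}")
    case False
    obtain x where x: "x \<in> K" "\<And>y. y \<in> K \<Longrightarrow> ?F x \<le> ?F y"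
      using continuous_attains_inf[OF K False cF] by blast
    have "fst x \<noteq> snd x"
    proof
      assume *: "fst x = snd x"
      then have "\<epsilon> * (norm (fst x) powr p + norm (snd x) powr p) \<le> 0"
        using x(1) p by (simp add: K_def)
      then have "norm (fst x) powr p + norm (snd x) powr p \<le> 0"
        using e by (metis mult_le_cancel_left_pos mult_zero_right)
      then have "fst x = 0" "snd x = 0"
        using powr_ge_zero[of "norm (fst x)" p] by (auto simp: * )
      then have "x = 0" by (simp add: prod_eq_iff)
      then show False using x(1) by (simp add: K_def)
    qed
    then show ?thesis using x midpoint_gap_pos[OF p] by blast
  qed (auto intro: exI[of _ 1])
  then obtain c where c: "c > 0" "\<And>x. x \<in> K \<Longrightarrow> c \<le> ?F x" by blast
  \<comment> \<open>On the unit sphere \<open>|z - w| \<le> 2\<close>, so this multiple of the gap is large enough on \<open>K\<close>.\<close>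
  have unit: "norm (fst x - snd x) powr p \<le>
      \<epsilon> * (norm (fst x) powr p + norm (snd x) powr p) + 2 powr p / c * ?F x" if "x \<in> ?S" for x
  proof (cases "x \<in> K")
    case True
    have "norm (fst x - snd x) \<le> 2"
      using norm_triangle_ineq4[of "fst x" "snd x"] norm_fst_le[of "fst x" "snd x"]
        norm_snd_le[of "snd x" "fst x"] that by simp
    then have "norm (fst x - snd x) powr p \<le> 2 powr p"
      using p by (intro powr_mono2) auto
    also have "\<dots> \<le> 2 powr p / c * ?F x" using c(2)[OF True] c(1) by (simp add: field_simps)
    also have "\<dots> \<le> \<epsilon> * (norm (fst x) powr p + norm (snd x) powr p) + 2 powr p / c * ?F x"
      using e by simp
    finally show ?thesis .
  next
    case False
    then have "norm (fst x - snd x) powr p < \<epsilon> * (norm (fst x) powr p + norm (snd x) powr p)"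
      using that by (simp add: K_def not_le)
    moreover have "0 \<le> 2 powr p / c * ?F x" 
      using c(1) midpoint_gap_nonneg[OF p] by (intro mult_nonneg_nonneg divide_nonneg_nonneg) auto
    ultimately show ?thesis by linarith
  qed
  have "norm (z - w) powr p \<le> \<epsilon> * (norm z powr p + norm w powr p) + 2 powr p / c * midpoint_gap p z w"
    for z w :: 'b
  proof (cases "(z, w) = 0")
    case True
    then show ?thesis using p by (auto simp: zero_prod_def midpoint_gap_def)
  next
    case False
    define r where "r = norm (z, w)"
    have r: "r > 0" using False by (simp add: r_def)
    define x where "x = (inverse r *\<^sub>R z, inverse r *\<^sub>R w)"
    have "x = inverse r *\<^sub>R (z, w)" by (simp add: x_def)
    then have xS: "x \<in> ?S" using r by (simp add: r_def del: scaleR_Pair)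
    have zw: "z = r *\<^sub>R fst x" "w = r *\<^sub>R snd x" using r by (auto simp: x_def)
    have "norm (z - w) powr p = r powr p * norm (fst x - snd x) powr p"
      using r by (simp add: zw powr_mult flip: scaleR_diff_right)
    also have "\<dots> \<le> r powr p * (\<epsilon> * (norm (fst x) powr p + norm (snd x) powr p) + 2 powr p / c * ?F x)"
      by (intro mult_left_mono unit[OF xS]) auto
    also have "\<dots> = \<epsilon> * (norm z powr p + norm w powr p) + 2 powr p / c * midpoint_gap p z w"
      using r by (simp add: zw midpoint_gap_scaleR powr_mult algebra_simps)
    finally show ?thesis .
  qed
  then show thesis using that[of "2 powr p / c"] c(1) by simp
qed

section \<open>Functions with integrable p-th power\<close>

definition Lp_on :: "real \<Rightarrow> 'a measure \<Rightarrow> ('a \<Rightarrow> 'b::euclidean_space) \<Rightarrow> bool" where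
  "Lp_on p M f \<longleftrightarrow> f \<in> borel_measurable M \<and> integrable M (\<lambda>x. norm (f x) powr p)"

definition Lp_int :: "real \<Rightarrow> 'a measure \<Rightarrow> ('a \<Rightarrow> 'b::euclidean_space) \<Rightarrow> real" where
  "Lp_int p M f = (\<integral>x. norm (f x) powr p \<partial>M)"

lemma Lp_onI [intro]:
  "f \<in> borel_measurable M \<Longrightarrow> integrable M (\<lambda>x. norm (f x) powr p) \<Longrightarrow> Lp_on p M f"
  by (simp add: Lp_on_def)

lemma Lp_on_measurable [measurable_dest]: "Lp_on p M f \<Longrightarrow> f \<in> borel_measurable M"
  by (simp add: Lp_on_def)

lemma Lp_on_integrable: "Lp_on p M f \<Longrightarrow> integrable M (\<lambda>x. norm (f x) powr p)"
  by (simp add: Lp_on_def)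

lemma Lp_int_nonneg [simp]: "0 \<le> Lp_int p M f"
  by (simp add: Lp_int_def)

lemma Lp_int_minus_commute: "Lp_int p M (\<lambda>x. f x - g x) = Lp_int p M (\<lambda>x. g x - f x)"
  by (simp add: Lp_int_def norm_minus_commute)

lemma Lp_int_cong_AE:
  assumes "AE x in M. f x = g x" and "f \<in> borel_measurable M" "g \<in> borel_measurable M"
  shows "Lp_int p M f = Lp_int p M g"
  unfolding Lp_int_def using assms by (intro integral_cong_AE) auto

lemma Lp_on_add:
  assumes "0 < p" "Lp_on p M f" "Lp_on p M g"
  shows "Lp_on p M (\<lambda>x. f x + g x)"
proof
  note [measurable] = assms(2,3)[THEN Lp_on_measurable]
  show "(\<lambda>x. f x + g x) \<in> borel_measurable M" by measurable
  show "integrable M (\<lambda>x. norm (f x + g x) powr p)"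
  proof (rule Bochner_Integration.integrable_bound)
    show "integrable M (\<lambda>x. 2 powr p * (norm (f x) powr p + norm (g x) powr p))"
      using assms by (auto simp: Lp_on_def)
    have "norm (f x + g x) powr p \<le> 2 powr p * (norm (f x) powr p + norm (g x) powr p)" for x
      using powr_sum_le[OF assms(1), of "norm (f x)" "norm (g x)"]
        powr_mono2[of p "norm (f x + g x)" "norm (f x) + norm (g x)"] assms(1)
      by (simp add: norm_triangle_ineq)
    then show "AE x in M. norm (norm (f x + g x) powr p)
        \<le> norm (2 powr p * (norm (f x) powr p + norm (g x) powr p))" by simp
  qed measurable
qed

lemma Lp_on_scaleR:
  assumes "Lp_on p M f" shows "Lp_on p M (\<lambda>x. c *\<^sub>R f x)"
  using assms by (auto simp: Lp_on_def powr_mult)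

lemma Lp_on_diff:
  assumes "0 < p" "Lp_on p M f" "Lp_on p M g"
  shows "Lp_on p M (\<lambda>x. f x - g x)"
  using Lp_on_add[OF assms(1,2) Lp_on_scaleR[OF assms(3), of "-1"]] by simp

lemma flux_measurable [measurable]:
  "f \<in> borel_measurable M \<Longrightarrow> (\<lambda>x. flux p (f x)) \<in> borel_measurable M"
  unfolding flux_def by measurable

context
  fixes p :: real assumes p: "1 < p"
begin

lemma integrable_powr_mult:
  assumes "Lp_on p M f" "Lp_on p M g"
  shows "integrable M (\<lambda>x. norm (f x) powr (p - 1) * norm (g x))"
proof (rule Bochner_Integration.integrable_bound)
  note [measurable] = assms[THEN Lp_on_measurable]
  show "integrable M (\<lambda>x. norm (f x) powr p + norm (g x) powr p)"
    using assms by (auto simp: Lp_on_def)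
  show "AE x in M. norm (norm (f x) powr (p - 1) * norm (g x))
      \<le> norm (norm (f x) powr p + norm (g x) powr p)"
    using powr_mult_le_sum[OF p] by simp
qed (use assms[THEN Lp_on_measurable] in measurable)

lemma integrable_flux_inner:
  assumes "Lp_on p M f" "Lp_on p M g"
  shows "integrable M (\<lambda>x. flux p (f x) \<bullet> g x)"
proof (rule Bochner_Integration.integrable_bound[OF integrable_powr_mult[OF assms]])
  note [measurable] = assms[THEN Lp_on_measurable]
  show "(\<lambda>x. flux p (f x) \<bullet> g x) \<in> borel_measurable M" by measurable
  show "AE x in M. norm (flux p (f x) \<bullet> g x) \<le> norm (norm (f x) powr (p - 1) * norm (g x))"
    by (simp add: inner_flux_le)
qed

text \<open>
  Integrate Young's inequality with the weight \<open>\<parallel>g\<parallel> / \<parallel>f\<parallel>\<close>, which makes both terms multiples of the product of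
  the norms.
\<close>

lemma Lp_Holder:
  assumes f: "Lp_on p M f" and g: "Lp_on p M g"
  shows "(\<integral>x. norm (f x) powr (p - 1) * norm (g x) \<partial>M)
    \<le> Lp_int p M f powr (1 - 1 / p) * Lp_int p M g powr (1 / p)"
proof -
  note [measurable] = assms[THEN Lp_on_measurable]
  note int = assms[THEN Lp_on_integrable]
  let ?X = "Lp_int p M f" and ?Y = "Lp_int p M g"
  let ?I = "\<integral>x. norm (f x) powr (p - 1) * norm (g x) \<partial>M"
  have zero: "?I = 0" if "?X = 0 \<or> ?Y = 0"
  proof -
    have "AE x in M. norm (f x) powr (p - 1) * norm (g x) = 0"
      using that int p unfolding Lp_int_def
      by (auto simp: integral_nonneg_eq_0_iff_AE elim!: AE_mp)
    then show ?thesis by (subst integral_cong_AE[of _ _ "\<lambda>_. 0"]) auto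
  qed
  show ?thesis
  proof (cases "?X = 0 \<or> ?Y = 0")
    case True then show ?thesis using zero by simp
  next
    case False
    then have X: "?X > 0" and Y: "?Y > 0"
      using Lp_int_nonneg[of p M f] Lp_int_nonneg[of p M g] by linarith+
    define l where "l = (?Y / ?X) powr (1 / p)"
    have l: "l > 0" using X Y by (simp add: l_def)
    have pt: "p * (norm (f x) powr (p - 1) * norm (g x))
        \<le> (p - 1) * l * norm (f x) powr p + l powr (1 - p) * norm (g x) powr p" for x
    proof -
      have "p * (norm (f x) powr (p - 1) * (norm (g x) / l)) \<le> (p - 1) * norm (f x) powr p + (norm (g x) / l) powr p"
        using p l by (intro Young_powr) auto
      then have "l * (p * (norm (f x) powr (p - 1) * (norm (g x) / l)))
          \<le> l * ((p - 1) * norm (f x) powr p + (norm (g x) / l) powr p)"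
        using l by (intro mult_left_mono) auto
      moreover have "l * (norm (g x) / l) powr p = l powr (1 - p) * norm (g x) powr p"
        using l by (simp add: powr_divide powr_diff)
      ultimately show ?thesis using l by (simp add: algebra_simps)
    qed
    have "p * ?I = (\<integral>x. p * (norm (f x) powr (p - 1) * norm (g x)) \<partial>M)" by simp
    also have "\<dots> \<le> (\<integral>x. (p - 1) * l * norm (f x) powr p + l powr (1 - p) * norm (g x) powr p \<partial>M)"
      using int integrable_powr_mult[OF assms] pt by (intro integral_mono) auto
    also have "\<dots> = (p - 1) * l * ?X + l powr (1 - p) * ?Y"
      using int by (simp add: Lp_int_def)
    also have "l * ?X = ?X powr (1 - 1 / p) * ?Y powr (1 / p)"
      using X Y by (simp add: l_def powr_divide powr_diff)
    then have "(p - 1) * l * ?X = (p - 1) * (?X powr (1 - 1 / p) * ?Y powr (1 / p))" by simp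
    also have "l powr (1 - p) * ?Y = ?X powr (1 - 1 / p) * ?Y powr (1 / p)"
    proof -
      have "l powr (1 - p) = (?Y / ?X) powr (1 / p - 1)"
        using p by (simp add: l_def powr_powr field_simps)
      also have "\<dots> * ?Y = ?X powr (1 - 1 / p) * ?Y powr (1 / p)"
        using X Y by (simp add: powr_divide powr_diff)
      finally show ?thesis by simp
    qed
    finally show ?thesis using p by (simp add: algebra_simps)
  qed
qed

lemma Lp_Holder_flux:
  assumes "Lp_on p M f" "Lp_on p M g"
  shows "\<bar>\<integral>x. flux p (f x) \<bullet> g x \<partial>M\<bar> \<le> Lp_int p M f powr (1 - 1 / p) * Lp_int p M g powr (1 / p)"
proof -
  have "\<bar>\<integral>x. flux p (f x) \<bullet> g x \<partial>M\<bar> \<le> (\<integral>x. norm (f x) powr (p - 1) * norm (g x) \<partial>M)"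
    by (rule order_trans[OF integral_abs_bound integral_mono])
       (auto simp: inner_flux_le intro!: integrable_flux_inner integrable_powr_mult assms)
  then show ?thesis using Lp_Holder[OF assms] by linarith
qed

lemma integral_flux_self: "(\<integral>x. flux p (f x) \<bullet> f x \<partial>M) = Lp_int p M f"
  by (simp add: Lp_int_def inner_flux_self)

text \<open>
  Split \<open>|f + g|\<^sup>p = J(f + g) \<cdot> f + J(f + g) \<cdot> g\<close> and apply Hoelder's inequality to both parts.
\<close>

lemma Lp_Minkowski:
  assumes f: "Lp_on p M f" and g: "Lp_on p M g"
  shows "Lp_int p M (\<lambda>x. f x + g x) powr (1 / p) \<le> Lp_int p M f powr (1 / p) + Lp_int p M g powr (1 / p)"
proof -
  let ?s = "\<lambda>x. f x + g x"
  have s: "Lp_on p M ?s" using p assms by (intro Lp_on_add) auto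
  define X where "X = Lp_int p M ?s"
  show ?thesis
  proof (cases "X = 0")
    case False
    then have X: "X > 0" by (simp add: X_def less_le)
    have "X = (\<integral>x. flux p (?s x) \<bullet> f x \<partial>M) + (\<integral>x. flux p (?s x) \<bullet> g x \<partial>M)"
      unfolding X_def integral_flux_self[symmetric]
      by (subst Bochner_Integration.integral_add[symmetric])
         (auto simp: inner_add_right intro!: integrable_flux_inner s f g)
    also have "\<dots> \<le> X powr (1 - 1 / p) * (Lp_int p M f powr (1 / p) + Lp_int p M g powr (1 / p))"
      using Lp_Holder_flux[OF s f] Lp_Holder_flux[OF s g] by (simp add: X_def algebra_simps)
    finally have "X powr (1 - 1 / p) * X powr (1 / p)
        \<le> X powr (1 - 1 / p) * (Lp_int p M f powr (1 / p) + Lp_int p M g powr (1 / p))"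
      using X by (simp flip: powr_add)
    then show ?thesis using X by (simp add: X_def)
  qed (simp add: X_def)
qed

lemma Lp_subgradient:
  assumes f: "Lp_on p M f" and g: "Lp_on p M g"
  shows "Lp_int p M f + p * (\<integral>x. flux p (f x) \<bullet> (g x - f x) \<partial>M) \<le> Lp_int p M g"
proof -
  have i: "integrable M (\<lambda>x. flux p (f x) \<bullet> (g x - f x))"
    using p assms by (intro integrable_flux_inner Lp_on_diff) auto
  have "Lp_int p M f + p * (\<integral>x. flux p (f x) \<bullet> (g x - f x) \<partial>M)
      = (\<integral>x. norm (f x) powr p + p * (flux p (f x) \<bullet> (g x - f x)) \<partial>M)"
    using i Lp_on_integrable[OF f] by (simp add: Lp_int_def)
  also have "\<dots> \<le> Lp_int p M g"
    unfolding Lp_int_def using i Lp_on_integrable[OF f] Lp_on_integrable[OF g] norm_powr_subgradient[OF p]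
    by (intro integral_mono) auto
  finally show ?thesis .
qed

lemma Lp_int_tendsto_0_powr:
  assumes "((\<lambda>k. Lp_int p M (u k)) \<longlongrightarrow> 0) F"
  shows "((\<lambda>k. Lp_int p M (u k) powr (1 / p)) \<longlongrightarrow> 0) F"
  using tendsto_powr'[OF assms tendsto_const, of "1 / p"] p by simp

lemma Lp_int_tendsto:
  assumes u: "\<forall>\<^sub>F k in F. Lp_on p M (u k)" and w: "Lp_on p M w"
    and lim: "((\<lambda>k. Lp_int p M (\<lambda>x. u k x - w x)) \<longlongrightarrow> 0) F"
  shows "((\<lambda>k. Lp_int p M (u k)) \<longlongrightarrow> Lp_int p M w) F"
proof -
  let ?n = "\<lambda>u. Lp_int p M u powr (1 / p)"
  have lim': "((\<lambda>k. ?n (\<lambda>x. u k x - w x)) \<longlongrightarrow> 0) F" by (rule Lp_int_tendsto_0_powr[OF lim])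
  have "\<forall>\<^sub>F k in F. norm (?n (u k) - ?n w) \<le> ?n (\<lambda>x. u k x - w x)"
    using u
  proof eventually_elim
    case (elim k)
    have d: "Lp_on p M (\<lambda>x. u k x - w x)" "Lp_on p M (\<lambda>x. w x - u k x)"
      using p elim w by (auto intro: Lp_on_diff)
    show ?case
      using Lp_Minkowski[OF d(1) w] Lp_Minkowski[OF d(2) elim] Lp_int_minus_commute[of p M w "u k"]
      by (simp add: abs_le_iff)
  qed
  then have "((\<lambda>k. ?n (u k) - ?n w) \<longlongrightarrow> 0) F" by (rule Lim_null_comparison[OF _ lim'])
  then have "((\<lambda>k. ?n (u k)) \<longlongrightarrow> ?n w) F" by (simp add: LIM_zero_iff)
  then have "((\<lambda>k. ?n (u k) powr p) \<longlongrightarrow> ?n w powr p) F"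
    by (rule tendsto_powr'[OF _ tendsto_const]) (use p in auto)
  then show ?thesis using p by (simp add: powr_powr)
qed

lemma Lp_flux_inner_tendsto:
  assumes f: "Lp_on p M f" and u: "\<forall>\<^sub>F k in F. Lp_on p M (u k)" and w: "Lp_on p M w"
    and lim: "((\<lambda>k. Lp_int p M (\<lambda>x. u k x - w x)) \<longlongrightarrow> 0) F"
  shows "((\<lambda>k. \<integral>x. flux p (f x) \<bullet> u k x \<partial>M) \<longlongrightarrow> (\<integral>x. flux p (f x) \<bullet> w x \<partial>M)) F"
proof -
  let ?c = "Lp_int p M f powr (1 - 1 / p)"
  have "((\<lambda>k. ?c * Lp_int p M (\<lambda>x. u k x - w x) powr (1 / p)) \<longlongrightarrow> ?c * 0) F"
    by (intro tendsto_mult tendsto_const Lp_int_tendsto_0_powr lim)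
  then have lim': "((\<lambda>k. ?c * Lp_int p M (\<lambda>x. u k x - w x) powr (1 / p)) \<longlongrightarrow> 0) F" by simp
  have "\<forall>\<^sub>F k in F. norm ((\<integral>x. flux p (f x) \<bullet> u k x \<partial>M) - (\<integral>x. flux p (f x) \<bullet> w x \<partial>M))
      \<le> ?c * Lp_int p M (\<lambda>x. u k x - w x) powr (1 / p)"
    using u
  proof eventually_elim
    case (elim k)
    have d: "Lp_on p M (\<lambda>x. u k x - w x)" using p elim w by (auto intro: Lp_on_diff)
    have "(\<integral>x. flux p (f x) \<bullet> u k x \<partial>M) - (\<integral>x. flux p (f x) \<bullet> w x \<partial>M)
        = (\<integral>x. flux p (f x) \<bullet> (u k x - w x) \<partial>M)"
      by (subst Bochner_Integration.integral_diff[symmetric])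
         (auto simp: inner_diff_right intro!: integrable_flux_inner f elim w)
    then show ?case using Lp_Holder_flux[OF f d] by simp
  qed
  then have "((\<lambda>k. (\<integral>x. flux p (f x) \<bullet> u k x \<partial>M) - (\<integral>x. flux p (f x) \<bullet> w x \<partial>M)) \<longlongrightarrow> 0) F"
    by (rule Lim_null_comparison[OF _ lim'])
  then show ?thesis by (simp add: LIM_zero_iff)
qed

lemma Lp_Fatou:
  assumes u: "\<And>k. Lp_on p M (u k)" and w: "w \<in> borel_measurable M"
    and lim: "AE x in M. (\<lambda>k. u k x) \<longlonglongrightarrow> w x"
    and le: "\<forall>\<^sub>F k in sequentially. Lp_int p M (u k) \<le> e"
  shows "Lp_on p M w" "Lp_int p M w \<le> e"
proof -
  note [measurable] = u[THEN Lp_on_measurable] w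
  have e: "0 \<le> e"
    using le Lp_int_nonneg order_trans unfolding eventually_sequentially by blast
  have "(\<integral>\<^sup>+x. ennreal (norm (w x) powr p) \<partial>M) = (\<integral>\<^sup>+x. liminf (\<lambda>k. ennreal (norm (u k x) powr p)) \<partial>M)"
  proof (rule nn_integral_cong_AE, use lim in eventually_elim)
    case (elim x)
    have "(\<lambda>k. ennreal (norm (u k x) powr p)) \<longlonglongrightarrow> ennreal (norm (w x) powr p)"
      using p elim by (intro tendsto_ennrealI tendsto_powr' tendsto_norm tendsto_const) auto
    then show ?case using lim_imp_Liminf[OF sequentially_bot] by metis
  qed
  also have "\<dots> \<le> liminf (\<lambda>k. \<integral>\<^sup>+x. ennreal (norm (u k x) powr p) \<partial>M)"
    by (intro nn_integral_liminf) measurable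
  also have "\<dots> = liminf (\<lambda>k. ennreal (Lp_int p M (u k)))"
    using u[THEN Lp_on_integrable] by (simp add: nn_integral_eq_integral Lp_int_def)
  also have "\<dots> \<le> ennreal e"
    by (rule Liminf_le) (use le in \<open>auto elim!: eventually_mono intro: ennreal_leI\<close>)
  finally have *: "(\<integral>\<^sup>+x. ennreal (norm (w x) powr p) \<partial>M) \<le> ennreal e" .
  then have i: "integrable M (\<lambda>x. norm (w x) powr p)"
    by (intro integrableI_bounded) (auto simp: order.strict_trans1[OF _ ennreal_less_top])
  then show "Lp_on p M w" using w by blast
  show "Lp_int p M w \<le> e"
    using * i e by (simp add: nn_integral_eq_integral Lp_int_def)
qed

text \<open>
  Completeness by a rapidly converging subsequence: its weighted increments have a finite sum almost
  everywhere, so it converges pointwise, and Fatou's lemma turns this into convergence of the integrals.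
\<close>

lemma Lp_complete:
  fixes g :: "nat \<Rightarrow> 'a \<Rightarrow> 'b::euclidean_space"
  assumes g: "\<And>n. Lp_on p M (g n)"
    and cauchy: "\<And>e. 0 < e \<Longrightarrow> \<exists>K. \<forall>m\<ge>K. \<forall>n\<ge>K. Lp_int p M (\<lambda>x. g m x - g n x) < e"
  obtains w where "Lp_on p M w" "(\<lambda>n. Lp_int p M (\<lambda>x. g n x - w x)) \<longlonglongrightarrow> 0"
proof -
  note [measurable] = g[THEN Lp_on_measurable]
  \<comment> \<open>The first factor makes the pointwise increments geometric, the second makes the weighted integrals summable.\<close>
  define e where "e k = (1/2) powr (real k * p) * (1/2) ^ k" for k
  have e: "e k > 0" for k by (simp add: e_def)
  obtain K where K: "\<And>k m n. m \<ge> K k \<Longrightarrow> n \<ge> K k \<Longrightarrow> Lp_int p M (\<lambda>x. g m x - g n x) < e k"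
    using cauchy[OF e] by metis
  have "\<exists>r. \<forall>k. r k \<ge> K k \<and> r (Suc k) > r k"
  proof (rule dependent_nat_choice)
    show "\<exists>x. K 0 \<le> x" by blast
    show "\<exists>y. K (Suc n) \<le> y \<and> x < y" for x n by (intro exI[of _ "max (K (Suc n)) (Suc x)"]) auto
  qed
  then obtain r where r: "\<And>k. r k \<ge> K k" "\<And>k. r (Suc k) > r k" by blast
  have sm: "strict_mono r" using r(2) by (simp add: strict_mono_Suc_iff)
  define d where "d k x = g (r (Suc k)) x - g (r k) x" for k x
  have d: "Lp_on p M (d k)" for k unfolding d_def using p by (intro Lp_on_diff g) auto
  note [measurable] = d[THEN Lp_on_measurable]
  have dl: "Lp_int p M (d k) \<le> e k" for k
    unfolding d_def using K[of k "r (Suc k)" "r k"] r[of k] less_imp_le by fastforce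
  have "(\<integral>\<^sup>+x. (\<Sum>k. ennreal (2 powr (real k * p) * norm (d k x) powr p)) \<partial>M)
      = (\<Sum>k. \<integral>\<^sup>+x. ennreal (2 powr (real k * p) * norm (d k x) powr p) \<partial>M)"
    by (intro nn_integral_suminf) measurable
  also have "\<dots> = (\<Sum>k. ennreal (2 powr (real k * p) * Lp_int p M (d k)))"
    using d[THEN Lp_on_integrable] by (subst nn_integral_eq_integral) (auto simp: Lp_int_def)
  also have "\<dots> \<le> (\<Sum>k. ennreal ((1/2) ^ k))"
  proof (intro suminf_le ennreal_leI allI)
    fix k
    have "2 powr (real k * p) * Lp_int p M (d k) \<le> 2 powr (real k * p) * e k"
      using dl by (intro mult_left_mono) auto
    also have "\<dots> = (1/2) ^ k" by (simp add: e_def powr_divide)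
    finally show "2 powr (real k * p) * Lp_int p M (d k) \<le> (1/2) ^ k" .
  qed auto
  also have "\<dots> = ennreal (\<Sum>k. (1/2) ^ k)"
    by (intro suminf_ennreal2) auto
  also have "\<dots> < \<infinity>" by simp
  finally have "AE x in M. (\<Sum>k. ennreal (2 powr (real k * p) * norm (d k x) powr p)) \<noteq> \<infinity>"
    by (intro nn_integral_PInf_AE) auto
  then have conv: "AE x in M. convergent (\<lambda>k. g (r k) x)"
  proof eventually_elim
    case (elim x)
    have sum: "summable (\<lambda>k. 2 powr (real k * p) * norm (d k x) powr p)"
      by (rule summable_suminf_not_top) (use elim in auto)
    then obtain S where S: "\<And>k. 2 powr (real k * p) * norm (d k x) powr p \<le> S"
      using Bseq_def summable_imp_Bseq by (metis (mono_tags, lifting) real_norm_def abs_le_D1)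
    have S0: "S \<ge> 0" using S[of 0] by (smt (verit) mult_nonneg_nonneg powr_ge_zero)
    have dS: "norm (d k x) \<le> S powr (1 / p) * (1/2) ^ k" for k
    proof -
      have "(2 powr real k * norm (d k x)) powr p \<le> S"
        using S[of k] by (simp add: powr_mult powr_powr)
      then have "((2 powr real k * norm (d k x)) powr p) powr (1 / p) \<le> S powr (1 / p)"
        using p by (intro powr_mono2) auto
      then have "2 ^ k * norm (d k x) \<le> S powr (1 / p)" using p by (simp add: powr_powr powr_realpow)
      then show ?thesis by (simp add: field_simps power_divide)
    qed
    have "summable (\<lambda>k. S powr (1 / p) * (1/2) ^ k)"
      by (intro summable_mult summable_geometric) simp
    then have "summable (\<lambda>k. d k x)"
      by (rule summable_comparison_test'[where N=0]) (rule dS)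
    then have "(\<lambda>n. g (r 0) x + (\<Sum>k<n. d k x)) \<longlonglongrightarrow> g (r 0) x + (\<Sum>k. d k x)"
      by (intro tendsto_add tendsto_const summable_LIMSEQ)
    moreover have "g (r 0) x + (\<Sum>k<n. d k x) = g (r n) x" for n
      unfolding d_def by (subst sum_lessThan_telescope) simp
    ultimately show ?case by (auto simp: convergent_def)
  qed
  define w where "w x = lim (\<lambda>k. g (r k) x)" for x
  have w [measurable]: "w \<in> borel_measurable M" unfolding w_def by measurable
  have lim: "AE x in M. (\<lambda>k. g (r k) x) \<longlonglongrightarrow> w x"
    using conv by eventually_elim (simp add: w_def convergent_LIMSEQ_iff)
  have fat: "Lp_on p M (\<lambda>x. g n x - w x) \<and> Lp_int p M (\<lambda>x. g n x - w x) \<le> \<epsilon>"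
    if Kn: "\<And>m n. m \<ge> N \<Longrightarrow> n \<ge> N \<Longrightarrow> Lp_int p M (\<lambda>x. g m x - g n x) < \<epsilon>" "n \<ge> N" for n N \<epsilon>
  proof -
    have l: "AE x in M. (\<lambda>k. g n x - g (r k) x) \<longlonglongrightarrow> g n x - w x"
      using lim by eventually_elim (intro tendsto_diff tendsto_const)
    have ev: "\<forall>\<^sub>F k in sequentially. Lp_int p M (\<lambda>x. g n x - g (r k) x) \<le> \<epsilon>"
      using eventually_ge_at_top[of N]
      by eventually_elim (use that strict_mono_imp_increasing[OF sm] in \<open>meson less_imp_le order_trans\<close>)
    have m: "Lp_on p M (\<lambda>x. g n x - g (r k) x)" for k using p by (intro Lp_on_diff g) auto
    show ?thesis using Lp_Fatou[OF m _ l ev] by simp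
  qed
  have "Lp_on p M w"
  proof -
    obtain n where n: "Lp_on p M (\<lambda>x. g n x - w x)" using fat[of "K 0" "e 0" "K 0"] K by blast
    show ?thesis using Lp_on_diff[OF _ g[of n] n] p by simp
  qed
  moreover have "(\<lambda>n. Lp_int p M (\<lambda>x. g n x - w x)) \<longlonglongrightarrow> 0"
  proof (rule LIMSEQ_I)
    fix \<epsilon> :: real assume "0 < \<epsilon>"
    then obtain N where "\<forall>m\<ge>N. \<forall>n\<ge>N. Lp_int p M (\<lambda>x. g m x - g n x) < \<epsilon> / 2"
      using cauchy[of "\<epsilon> / 2"] by auto
    then have "Lp_int p M (\<lambda>x. g n x - w x) < \<epsilon>" if "n \<ge> N" for n
      using fat[of N "\<epsilon> / 2" n] that \<open>0 < \<epsilon>\<close> by fastforce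
    then show "\<exists>no. \<forall>n\<ge>no. norm (Lp_int p M (\<lambda>x. g n x - w x) - 0) < \<epsilon>"
      using \<open>0 < \<epsilon>\<close> by (intro exI[of _ N]) auto
  qed
  ultimately show thesis by (rule that)
qed

text \<open>
  In this form uniform convexity yields Cauchy sequences: functions of nearly equal energy whose
  midpoint does not have a noticeably smaller energy are close.
\<close>

lemma Lp_uniformly_convex:
  fixes M :: "'a measure"
  assumes e: "0 < e" and C: "0 \<le> C"
  obtains \<delta> where "0 < \<delta>"
    "\<And>g h :: 'a \<Rightarrow> 'b::euclidean_space. \<lbrakk>Lp_on p M g; Lp_on p M h; Lp_int p M g \<le> C; Lp_int p M h \<le> C;
       (Lp_int p M g + Lp_int p M h) / 2 - Lp_int p M (\<lambda>x. (1/2) *\<^sub>R (g x + h x)) \<le> \<delta>\<rbrakk>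
      \<Longrightarrow> Lp_int p M (\<lambda>x. g x - h x) < e"
proof -
  define \<epsilon> where "\<epsilon> = e / (4 * (C + 1))"
  have \<epsilon>: "\<epsilon> > 0" using e C by (simp add: \<epsilon>_def)
  obtain B where B: "B > 0" "\<And>z w :: 'b. norm (z - w) powr p \<le> \<epsilon> * (norm z powr p + norm w powr p) + B * midpoint_gap p z w"
    using norm_diff_powr_le_midpoint_gap[OF p \<epsilon>] by blast
  show thesis
  proof (rule that[of "e / (4 * B)"])
    show "0 < e / (4 * B)" using e B by simp
    fix g h :: "'a \<Rightarrow> 'b"
    assume g: "Lp_on p M g" and h: "Lp_on p M h" and le: "Lp_int p M g \<le> C" "Lp_int p M h \<le> C"
      and gap: "(Lp_int p M g + Lp_int p M h) / 2 - Lp_int p M (\<lambda>x. (1/2) *\<^sub>R (g x + h x)) \<le> e / (4 * B)"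
    have m: "Lp_on p M (\<lambda>x. (1/2) *\<^sub>R (g x + h x))"
      using p by (intro Lp_on_scaleR Lp_on_add g h) auto
    have d: "Lp_on p M (\<lambda>x. g x - h x)" using p by (intro Lp_on_diff g h) auto
    note int = g[THEN Lp_on_integrable] h[THEN Lp_on_integrable] m[THEN Lp_on_integrable]
    have "Lp_int p M (\<lambda>x. g x - h x)
        \<le> (\<integral>x. \<epsilon> * (norm (g x) powr p + norm (h x) powr p) + B * midpoint_gap p (g x) (h x) \<partial>M)"
      unfolding Lp_int_def midpoint_gap_def
      using int d[THEN Lp_on_integrable] B(2) by (intro integral_mono) (auto simp: midpoint_gap_def)
    also have "\<dots> = \<epsilon> * (Lp_int p M g + Lp_int p M h)
        + B * ((Lp_int p M g + Lp_int p M h) / 2 - Lp_int p M (\<lambda>x. (1/2) *\<^sub>R (g x + h x)))"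
      unfolding Lp_int_def midpoint_gap_def using int by simp
    also have "\<dots> \<le> \<epsilon> * (C + C) + B * (e / (4 * B))"
      using \<epsilon> B(1) le gap by (intro add_mono mult_left_mono) auto
    also have "B * (e / (4 * B)) = e / 4" using B(1) by simp
    also have "\<epsilon> * (C + C) < e / 2"
      using e C by (simp add: \<epsilon>_def field_simps)
    finally show "Lp_int p M (\<lambda>x. g x - h x) < e" using e by simp
  qed
qed

end

section \<open>Smooth bumps on boxes\<close>

lemma C_k_Suc_imp: "C_k (Suc k) f \<Longrightarrow> C_k k f"
proof (induction k arbitrary: f)
  case 0
  then show ?case
    by (auto simp: continuous_on_eq_continuous_at intro: differentiable_imp_continuous_within)
next
  case (Suc k)
  then show ?case by (metis C_k.simps(2))
qed

lemma C_k_has_derivativeI: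
  assumes "\<And>x. (f has_derivative f' x) (at x)" "\<And>h. C_k k (\<lambda>x. f' x h)"
  shows "C_k (Suc k) f"
proof -
  have "frechet_derivative f (at x) = f' x" for x
    using frechet_derivative_at[OF assms(1)] by metis
  then show ?thesis using assms by (auto simp: differentiable_def)
qed

lemma C_k_Suc_has_derivative:
  "C_k (Suc k) f \<Longrightarrow> (f has_derivative frechet_derivative f (at x)) (at x)"
  by (simp add: frechet_derivative_works)

lemma C_k_add: "C_k k f \<Longrightarrow> C_k k g \<Longrightarrow> C_k k (\<lambda>x. f x + g x)"
proof (induction k arbitrary: f g)
  case (Suc k)
  show ?case
  proof (rule C_k_has_derivativeI)
    show "((\<lambda>x. f x + g x) has_derivative
        (\<lambda>h. frechet_derivative f (at x) h + frechet_derivative g (at x) h)) (at x)" for x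
      by (intro has_derivative_add C_k_Suc_has_derivative[OF Suc.prems(1)] C_k_Suc_has_derivative[OF Suc.prems(2)])
    show "C_k k (\<lambda>x. frechet_derivative f (at x) h + frechet_derivative g (at x) h)" for h
      using Suc.prems by (intro Suc.IH) simp_all
  qed
qed (simp add: continuous_on_add)

lemma C_k_mult:
  fixes f g :: "'a::euclidean_space \<Rightarrow> real"
  shows "C_k k f \<Longrightarrow> C_k k g \<Longrightarrow> C_k k (\<lambda>x. f x * g x)"
proof (induction k arbitrary: f g)
  case (Suc k)
  show ?case
  proof (rule C_k_has_derivativeI)
    show "((\<lambda>x. f x * g x) has_derivative
        (\<lambda>h. f x * frechet_derivative g (at x) h + frechet_derivative f (at x) h * g x)) (at x)" for x
      by (intro has_derivative_mult C_k_Suc_has_derivative[OF Suc.prems(1)] C_k_Suc_has_derivative[OF Suc.prems(2)])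
    show "C_k k (\<lambda>x. f x * frechet_derivative g (at x) h + frechet_derivative f (at x) h * g x)" for h
      using Suc.prems Suc.prems[THEN C_k_Suc_imp] by (intro C_k_add Suc.IH) simp_all
  qed
qed (simp add: continuous_on_mult)

lemma C_infty_const: "C_infty (\<lambda>x :: 'a::euclidean_space. c :: 'b::real_normed_vector)"
proof -
  have "C_k k (\<lambda>x :: 'a. c)" for k and c :: 'b
  proof (induction k arbitrary: c)
    case (Suc k)
    show ?case by (rule C_k_has_derivativeI[of _ "\<lambda>x h. 0"]) (auto intro: Suc)
  qed simp
  then show ?thesis by (simp add: C_infty_def)
qed

lemma C_infty_mult:
  fixes f g :: "'a::euclidean_space \<Rightarrow> real"
  shows "C_infty f \<Longrightarrow> C_infty g \<Longrightarrow> C_infty (\<lambda>x. f x * g x)"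
  by (simp add: C_infty_def C_k_mult)

lemma C_infty_prod:
  fixes f :: "'i \<Rightarrow> 'a::euclidean_space \<Rightarrow> real"
  shows "(\<And>i. i \<in> I \<Longrightarrow> C_infty (f i)) \<Longrightarrow> C_infty (\<lambda>x. \<Prod>i\<in>I. f i x)"
  by (induction I rule: infinite_finite_induct) (auto intro: C_infty_const C_infty_mult)

text \<open>
  The functions \<open>P(1/s) exp(-c/s)\<close>, extended by \<open>0\<close>, are closed under differentiation for polynomials \<open>P\<close>;
  carrying \<open>P\<close> along makes smoothness of the classical flat function an induction.
\<close>

definition exp_recip :: "real \<Rightarrow> real poly \<Rightarrow> real \<Rightarrow> real" where
  "exp_recip c P s = (if 0 < s then poly P (1 / s) * exp (- c / s) else 0)"

lemma poly_exp_tendsto_0: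
  fixes c :: real
  assumes "0 < c"
  shows "((\<lambda>u. poly P u * exp (- c * u)) \<longlongrightarrow> 0) at_top"
proof -
  have "((\<lambda>u. u ^ n * exp (- c * u)) \<longlongrightarrow> 0) at_top" for n
  proof -
    have "((\<lambda>u. (c * u) ^ n / exp (c * u)) \<longlongrightarrow> 0) at_top"
      by (rule filterlim_compose[OF tendsto_power_div_exp_0])
         (use assms in \<open>auto intro!: filterlim_tendsto_pos_mult_at_top[OF tendsto_const] filterlim_ident\<close>)
    then have "((\<lambda>u. (c * u) ^ n / exp (c * u) / c ^ n) \<longlongrightarrow> 0 / c ^ n) at_top"
      using assms by (intro tendsto_divide tendsto_const) auto
    moreover have "(c * u) ^ n / exp (c * u) / c ^ n = u ^ n * exp (- c * u)" for u
      using assms by (simp add: power_mult_distrib exp_minus field_simps)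
    ultimately show ?thesis by simp
  qed
  then have "((\<lambda>u. \<Sum>i\<le>degree P. coeff P i * (u ^ i * exp (- c * u))) \<longlongrightarrow> (\<Sum>i\<le>degree P. coeff P i * 0)) at_top"
    by (intro tendsto_sum tendsto_mult tendsto_const)
  then show ?thesis by (simp add: poly_altdef sum_distrib_right mult.assoc)
qed

lemma exp_recip_tendsto_0:
  assumes "0 < c" shows "(exp_recip c P \<longlongrightarrow> 0) (at 0)"
proof -
  have "((\<lambda>s. poly P (inverse s) * exp (- c * inverse s)) \<longlongrightarrow> 0) (at_right 0)"
    by (rule filterlim_compose[OF poly_exp_tendsto_0[OF assms] filterlim_inverse_at_top_right])
  then have "(exp_recip c P \<longlongrightarrow> 0) (at_right 0)"
    by (rule Lim_transform_eventually)
       (auto simp: eventually_at_filter exp_recip_def divide_inverse)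
  moreover have "(exp_recip c P \<longlongrightarrow> 0) (at_left 0)"
    by (rule Lim_transform_eventually[OF tendsto_const])
       (auto simp: eventually_at_filter exp_recip_def)
  ultimately show ?thesis by (simp add: filterlim_at_split)
qed

lemma exp_recip_deriv:
  assumes c: "0 < c"
  shows "(exp_recip c P has_real_derivative exp_recip c ([:0, 0, 1:] * (smult c P - pderiv P)) s) (at s)"
proof (cases s "0 :: real" rule: linorder_cases)
  case less
  have "((\<lambda>_. 0) has_real_derivative 0) (at s)" by simp
  then have "(exp_recip c P has_real_derivative 0) (at s)"
    by (rule has_field_derivative_transform_within_open[of _ _ _ "{..<0}"])
       (use less in \<open>auto simp: exp_recip_def\<close>)
  then show ?thesis using less by (simp add: exp_recip_def)
next
  case greater
  have "((\<lambda>s. poly P (1 / s) * exp (- c / s)) has_real_derivative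
      poly P (1 / s) * (exp (- c / s) * (c / s\<^sup>2)) + poly (pderiv P) (1 / s) * (- 1 / s\<^sup>2) * exp (- c / s)) (at s)"
    using greater by (auto intro!: derivative_eq_intros simp: power2_eq_square)
  also have "poly P (1 / s) * (exp (- c / s) * (c / s\<^sup>2)) + poly (pderiv P) (1 / s) * (- 1 / s\<^sup>2) * exp (- c / s)
      = exp_recip c ([:0, 0, 1:] * (smult c P - pderiv P)) s"
    using greater by (simp add: exp_recip_def algebra_simps power2_eq_square)
  finally show ?thesis
    by (rule has_field_derivative_transform_within_open[of _ _ _ "{0<..}"])
       (use greater in \<open>auto simp: exp_recip_def\<close>)
next
  case equal
  have "((\<lambda>h. (exp_recip c P (0 + h) - exp_recip c P 0) / h) \<longlongrightarrow> 0) (at 0)"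
    by (rule Lim_transform_eventually[OF exp_recip_tendsto_0[OF c, of "[:0, 1:] * P"]])
       (auto simp: eventually_at_filter exp_recip_def)
  then show ?thesis using equal by (simp add: DERIV_def exp_recip_def)
qed

lemma C_infty_exp_recip:
  fixes L :: "'a::euclidean_space \<Rightarrow> real"
  assumes c: "0 < c" and L: "bounded_linear L"
  shows "C_infty (\<lambda>x. exp_recip c P (L x + d))"
proof -
  have "C_k k (\<lambda>x. exp_recip c P (L x + d) * b)" for k b
  proof (induction k arbitrary: P b)
    case 0
    have "isCont (exp_recip c P) y" for y using exp_recip_deriv[OF c] DERIV_isCont by blast
    then have "continuous_on UNIV (exp_recip c P)" by (simp add: continuous_on_eq_continuous_at)
    moreover have "continuous_on UNIV L" using L by (rule linear_continuous_on)
    ultimately show ?case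
      by (auto intro!: continuous_intros continuous_on_compose2[of UNIV "exp_recip c P"])
  next
    case (Suc k)
    show ?case
    proof (rule C_k_has_derivativeI)
      show "((\<lambda>x. exp_recip c P (L x + d) * b) has_derivative
        (\<lambda>h. exp_recip c ([:0, 0, 1:] * (smult c P - pderiv P)) (L x + d) * (L h * b))) (at x)" for x
      proof -
        have "((\<lambda>x. L x + d) has_derivative L) (at x)"
          using has_derivative_add[OF bounded_linear_imp_has_derivative[OF L] has_derivative_const] by simp
        from has_derivative_mult_left[OF has_derivative_compose[OF this
              exp_recip_deriv[OF c, of P, unfolded has_field_derivative_def]], of b]
        show ?thesis by (simp add: mult.assoc)
      qed
      show "C_k k (\<lambda>x. exp_recip c ([:0, 0, 1:] * (smult c P - pderiv P)) (L x + d) * (L h * b))" for h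
        by (rule Suc.IH)
    qed
  qed
  from this[of _ 1] show ?thesis by (simp add: C_infty_def)
qed

text \<open>
  The root of order \<open>k + 1\<close> of one fixed bump. As \<open>k\<close> grows it flattens to the indicator of the open
  interval while the support stays the same.
\<close>

definition bump1 :: "nat \<Rightarrow> real \<Rightarrow> real \<Rightarrow> real \<Rightarrow> real" where
  "bump1 k a b s = exp_recip (1 / Suc k) 1 (s - a) * exp_recip (1 / Suc k) 1 (b - s)"

lemma C_infty_bump1:
  fixes L :: "'a::euclidean_space \<Rightarrow> real"
  assumes "bounded_linear L"
  shows "C_infty (\<lambda>x. bump1 k a b (L x))"
proof -
  have "C_infty (\<lambda>x. exp_recip (1 / Suc k) 1 (L x + (- a)))"
    by (intro C_infty_exp_recip assms) simp
  moreover have "C_infty (\<lambda>x. exp_recip (1 / Suc k) 1 (- L x + b))"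
    by (intro C_infty_exp_recip bounded_linear_minus assms) simp
  ultimately show ?thesis unfolding bump1_def using C_infty_mult by (auto simp: algebra_simps)
qed

lemma exp_recip_1_bounds:
  assumes "0 \<le> c" shows "0 \<le> exp_recip c 1 s" "exp_recip c 1 s \<le> 1"
  using assms by (auto simp: exp_recip_def)

lemma bump1_bounds: "0 \<le> bump1 k a b s" "bump1 k a b s \<le> 1"
  unfolding bump1_def by (intro mult_nonneg_nonneg mult_le_one exp_recip_1_bounds; simp)+

lemma bump1_eq_0: "s \<notin> {a<..<b} \<Longrightarrow> bump1 k a b s = 0"
  by (auto simp: bump1_def exp_recip_def)

lemma exp_recip_1_tendsto: "(\<lambda>k. exp_recip (1 / Suc k) 1 s) \<longlonglongrightarrow> indicator {0<..} s"
proof (cases "0 < s")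
  case True
  have "(\<lambda>k. - (1 / real (Suc k)) / s) \<longlonglongrightarrow> - 0 / s"
    by (intro tendsto_divide tendsto_minus tendsto_const LIMSEQ_inverse_real_of_nat[unfolded inverse_eq_divide])
       (use True in auto)
  then have "(\<lambda>k. exp (- (1 / real (Suc k)) / s)) \<longlonglongrightarrow> exp (- 0 / s)" by (rule tendsto_exp)
  then show ?thesis using True by (simp add: exp_recip_def)
qed (simp add: exp_recip_def)

lemma bump1_tendsto: "(\<lambda>k. bump1 k a b s) \<longlonglongrightarrow> indicator {a<..<b} s"
proof -
  have "(\<lambda>k. bump1 k a b s) \<longlonglongrightarrow> indicator {0<..} (s - a) * indicator {0<..} (b - s)"
    unfolding bump1_def by (intro tendsto_mult exp_recip_1_tendsto)
  also have "indicator {0<..} (s - a) * indicator {0<..} (b - s) = (indicator {a<..<b} s :: real)"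
    by (auto simp: indicator_def)
  finally show ?thesis .
qed

definition bump :: "nat \<Rightarrow> 'a::euclidean_space \<Rightarrow> 'a \<Rightarrow> 'a \<Rightarrow> real" where
  "bump k a b x = (\<Prod>i\<in>Basis. bump1 k (a \<bullet> i) (b \<bullet> i) (x \<bullet> i))"

lemma C_infty_bump:
  fixes L :: "'c::euclidean_space \<Rightarrow> 'a::euclidean_space"
  assumes "bounded_linear L"
  shows "C_infty (\<lambda>x. bump k a b (L x))"
  unfolding bump_def
  by (intro C_infty_prod C_infty_bump1 bounded_linear_compose[OF bounded_linear_inner_left assms])

lemma bump_bounds: "0 \<le> bump k a b x" "bump k a b x \<le> 1"
  unfolding bump_def by (auto intro!: prod_nonneg prod_le_1 bump1_bounds)

lemma bump_eq_0: "x \<notin> box a b \<Longrightarrow> bump k a b x = 0"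
proof -
  assume "x \<notin> box a b"
  then obtain i where "i \<in> Basis" "x \<bullet> i \<notin> {a \<bullet> i<..<b \<bullet> i}" by (auto simp: mem_box)
  then show ?thesis unfolding bump_def by (intro prod_zero finite_Basis bexI[of _ i] bump1_eq_0)
qed

lemma bump_tendsto: "(\<lambda>k. bump k a b x) \<longlonglongrightarrow> indicator (box a b) x"
proof -
  have "(\<lambda>k. bump k a b x) \<longlonglongrightarrow> (\<Prod>i\<in>Basis. indicator {a \<bullet> i<..<b \<bullet> i} (x \<bullet> i))"
    unfolding bump_def by (intro tendsto_prod bump1_tendsto)
  also have "(\<Prod>i\<in>Basis. indicator {a \<bullet> i<..<b \<bullet> i} (x \<bullet> i)) = (indicator (box a b) x :: real)"
  proof (cases "x \<in> box a b")
    case False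
    then obtain i where "i \<in> Basis" "x \<bullet> i \<notin> {a \<bullet> i<..<b \<bullet> i}" by (auto simp: mem_box)
    then have "(\<Prod>i\<in>Basis. indicator {a \<bullet> i<..<b \<bullet> i} (x \<bullet> i)) = (0 :: real)"
      by (intro prod_zero finite_Basis bexI[of _ i]) simp_all
    then show ?thesis using False by simp
  qed (simp add: mem_box)
  finally show ?thesis .
qed

lemma test_function_bump:
  assumes "cbox a b \<subseteq> U" shows "test_function U (bump k a b)"
  unfolding test_function_def
proof
  show "C_infty (bump k a b)" using C_infty_bump[OF bounded_linear_ident] .
  show "\<exists>K. compact K \<and> K \<subseteq> U \<and> (\<forall>x. x \<notin> K \<longrightarrow> bump k a b x = 0)"
  proof (intro exI conjI allI impI)
    show "bump k a b x = 0" if "x \<notin> cbox a b" for x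
      using that box_subset_cbox[of a b] by (intro bump_eq_0) blast
  qed (use assms in auto)
qed

section \<open>The fundamental lemma and weak derivatives\<close>

lemma integrable_lebesgue_on_subset:
  fixes h :: "'a::euclidean_space \<Rightarrow> 'b::euclidean_space"
  assumes "K \<subseteq> U" "K \<in> sets lebesgue" "U \<in> sets lebesgue"
  shows "integrable (lebesgue_on U) (\<lambda>x. indicator K x *\<^sub>R h x) \<longleftrightarrow> integrable (lebesgue_on K) h"
    and "(\<integral>x. indicator K x *\<^sub>R h x \<partial>lebesgue_on U) = (\<integral>x. h x \<partial>lebesgue_on K)"
proof -
  have *: "indicator U x * indicator K x = (indicator K x :: real)" for x
    using assms(1) by (auto simp: indicator_def)
  show "integrable (lebesgue_on U) (\<lambda>x. indicator K x *\<^sub>R h x) \<longleftrightarrow> integrable (lebesgue_on K) h"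
    using assms(2,3) by (simp add: integrable_restrict_space * )
  show "(\<integral>x. indicator K x *\<^sub>R h x \<partial>lebesgue_on U) = (\<integral>x. h x \<partial>lebesgue_on K)"
    using assms(2,3) by (simp add: integral_restrict_space * )
qed

lemma borel_measurable_lebesgue_on_AE:
  fixes f g :: "'a::euclidean_space \<Rightarrow> 'b::euclidean_space"
  assumes S: "S \<in> sets lebesgue" and f: "f \<in> borel_measurable (lebesgue_on S)"
    and ae: "AE x in lebesgue_on S. f x = g x"
  shows "g \<in> borel_measurable (lebesgue_on S)"
proof -
  have "(\<lambda>x. indicator S x *\<^sub>R f x) \<in> borel_measurable lebesgue"
    using S f by (simp add: borel_measurable_restrict_space_iff)
  moreover have "AE x in lebesgue. indicator S x *\<^sub>R f x = indicator S x *\<^sub>R g x"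
    using ae S by (auto simp: AE_restrict_space_iff indicator_def)
  ultimately have "(\<lambda>x. indicator S x *\<^sub>R g x) \<in> borel_measurable lebesgue"
    by (rule borel_measurable_AE)
  then show ?thesis using S by (simp add: borel_measurable_restrict_space_iff)
qed

lemma negligible_imp_AE_notin: "negligible N \<Longrightarrow> AE x in lebesgue. x \<notin> N"
  by (simp add: AE_not_in negligible_iff_null_sets)

text \<open>
  By Lebesgue differentiation the function is almost everywhere the limit of its averages over small
  cubes, and these vanish.
\<close>

lemma AE_eq_0_on_box:
  fixes h :: "'a::euclidean_space \<Rightarrow> 'b::euclidean_space"
  assumes int: "integrable (lebesgue_on (cbox c d)) h"
    and zero: "\<And>a b. cbox a b \<subseteq> cbox c d \<Longrightarrow> (\<integral>x. h x \<partial>lebesgue_on (cbox a b)) = 0"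
  shows "AE x in lebesgue. x \<in> cbox c d \<longrightarrow> h x = 0"
proof -
  define h' where "h' = (\<lambda>x. if x \<in> cbox c d then h x else 0)"
  have "h integrable_on cbox c d" by (intro integrable_on_lebesgue_on int) simp
  then have "h' integrable_on UNIV" by (simp add: h'_def integrable_restrict_UNIV)
  then have "h' integrable_on cbox a b" for a b by (rule integrable_on_subcbox) simp
  then obtain N where N: "negligible N" and lim: "\<And>x e. \<lbrakk>x \<notin> N; 0 < e\<rbrakk> \<Longrightarrow>
      \<exists>r>0. \<forall>t. 0 < t \<and> t < r \<longrightarrow> norm (integral (cbox x (x + t *\<^sub>R One)) h' /\<^sub>R t ^ DIM('a) - h' x) < e"
    by (rule integrable_ccontinuous_explicit) blast
  have inner: "h x = 0" if x: "x \<in> box c d" "x \<notin> N" for x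
  proof (rule ccontr)
    assume "h x \<noteq> 0"
    then obtain r where r: "r > 0" "\<And>t. 0 < t \<Longrightarrow> t < r \<Longrightarrow>
        norm (integral (cbox x (x + t *\<^sub>R One)) h' /\<^sub>R t ^ DIM('a) - h' x) < norm (h x)"
      using lim[OF x(2), of "norm (h x)"] by auto
    define m where "m = Min ((\<lambda>i. d \<bullet> i - x \<bullet> i) ` Basis)"
    have m: "m > 0" "\<And>i. i \<in> Basis \<Longrightarrow> m \<le> d \<bullet> i - x \<bullet> i"
      using x(1) unfolding m_def by (auto simp: mem_box)
    define t where "t = min (r / 2) m"
    have t: "0 < t" "t < r" "t \<le> m" using r(1) m(1) by (auto simp: t_def)
    have sub: "cbox x (x + t *\<^sub>R One) \<subseteq> cbox c d"
    proof
      fix y assume y: "y \<in> cbox x (x + t *\<^sub>R One)"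
      have "c \<bullet> i \<le> y \<bullet> i \<and> y \<bullet> i \<le> d \<bullet> i" if i: "i \<in> Basis" for i
      proof -
        have "x \<bullet> i \<le> y \<bullet> i" "y \<bullet> i \<le> x \<bullet> i + t" using y i by (auto simp: mem_box inner_add_left)
        moreover have "c \<bullet> i < x \<bullet> i" using x(1) i by (auto simp: mem_box)
        ultimately show ?thesis using m(2)[OF i] t(3) by linarith
      qed
      then show "y \<in> cbox c d" by (simp add: mem_box)
    qed
    have "integrable (lebesgue_on (cbox x (x + t *\<^sub>R One))) h"
    proof -
      have "set_integrable lebesgue (cbox c d) h"
        using int by (simp add: set_integrable_def integrable_restrict_space)
      then have "set_integrable lebesgue (cbox x (x + t *\<^sub>R One)) h"
        by (rule set_integrable_subset) (use sub in auto)
      then show ?thesis by (simp add: set_integrable_def integrable_restrict_space)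
    qed
    then have "integral (cbox x (x + t *\<^sub>R One)) h = 0"
      using zero[OF sub] lebesgue_integral_eq_integral by fastforce
    moreover have "integral (cbox x (x + t *\<^sub>R One)) h' = integral (cbox x (x + t *\<^sub>R One)) h"
      using sub by (intro integral_cong) (auto simp: h'_def)
    moreover have "h' x = h x" using x(1) box_subset_cbox by (auto simp: h'_def)
    ultimately show False using r(2)[OF t(1,2)] by simp
  qed
  show ?thesis
    using negligible_imp_AE_notin[OF N] negligible_imp_AE_notin[OF negligible_frontier_interval[of c d]]
    by eventually_elim (use inner in auto)
qed

lemma AE_eq_0_if_box_integrals_0:
  fixes h :: "'a::euclidean_space \<Rightarrow> 'b::euclidean_space"
  assumes U: "open U" and int: "locally_integrable U h"
    and zero: "\<And>a b. cbox a b \<subseteq> U \<Longrightarrow> (\<integral>x. h x \<partial>lebesgue_on (cbox a b)) = 0"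
  shows "AE x in lebesgue_on U. h x = 0"
proof -
  obtain \<D> where \<D>: "countable \<D>" "\<D> \<subseteq> Pow U" "\<And>X. X \<in> \<D> \<Longrightarrow> \<exists>a b. X = cbox a b" "\<Union>\<D> = U"
    using open_countable_Union_open_cbox[OF U] by metis
  have "AE x in lebesgue. x \<in> X \<longrightarrow> h x = 0" if X: "X \<in> \<D>" for X
  proof -
    obtain a b where ab: "X = cbox a b" using \<D>(3)[OF X] by blast
    have sub: "cbox a b \<subseteq> U" using X \<D>(2) ab by blast
    show ?thesis unfolding ab
      using int sub zero by (intro AE_eq_0_on_box) (auto simp: locally_integrable_def)
  qed
  then have "AE x in lebesgue. \<forall>X\<in>\<D>. x \<in> X \<longrightarrow> h x = 0"
    unfolding AE_ball_countable[OF \<D>(1)] by blast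
  then have "AE x in lebesgue. x \<in> U \<longrightarrow> h x = 0"
    by eventually_elim (use \<D>(4) in blast)
  then show ?thesis using U by (simp add: AE_restrict_space_iff)
qed

lemma compact_sets_lebesgue: "compact K \<Longrightarrow> K \<in> sets lebesgue"
  by (intro fmeasurableD lmeasurable_compact)

lemma integrable_continuous_scaleR:
  fixes u :: "'a::euclidean_space \<Rightarrow> 'b::euclidean_space" and \<psi> :: "'a \<Rightarrow> real"
  assumes \<psi>: "continuous_on UNIV \<psi>" and K: "compact K" "K \<subseteq> U" "\<And>x. x \<notin> K \<Longrightarrow> \<psi> x = 0"
    and U: "open U" and u: "locally_integrable U u"
  shows "integrable (lebesgue_on U) (\<lambda>x. \<psi> x *\<^sub>R u x)"
proof -
  have "compact (\<psi> ` K)" using \<psi> K by (meson compact_continuous_image continuous_on_subset subset_UNIV)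
  then have "bounded (\<psi> ` K)" by (rule compact_imp_bounded)
  then obtain C where C: "\<And>x. x \<in> K \<Longrightarrow> norm (\<psi> x) \<le> C" by (auto simp: bounded_iff)
  have uK: "integrable (lebesgue_on K) u" using u K by (simp add: locally_integrable_def)
  note [measurable] = borel_measurable_integrable[OF uK]
  have [measurable]: "\<psi> \<in> borel_measurable (lebesgue_on K)"
    using \<psi> K(1) by (meson compact_sets_lebesgue continuous_imp_measurable_on_sets_lebesgue
        continuous_on_subset subset_UNIV)
  have "integrable (lebesgue_on K) (\<lambda>x. \<psi> x *\<^sub>R u x)"
  proof (rule Bochner_Integration.integrable_bound)
    show "integrable (lebesgue_on K) (\<lambda>x. C * norm (u x))" using uK by simp
    show "AE x in lebesgue_on K. norm (\<psi> x *\<^sub>R u x) \<le> norm (C * norm (u x))"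
      using C by (intro AE_I2) (auto simp: abs_mult intro!: mult_right_mono order_trans[OF _ abs_ge_self])
  qed measurable
  moreover have "(\<lambda>x. \<psi> x *\<^sub>R u x) = (\<lambda>x. indicator K x *\<^sub>R (\<psi> x *\<^sub>R u x))"
    using K(3) by (auto simp: indicator_def fun_eq_iff)
  moreover have "K \<in> sets lebesgue" "U \<in> sets lebesgue" using K(1) U compact_sets_lebesgue by auto
  ultimately show ?thesis
    using integrable_lebesgue_on_subset(1)[OF K(2), of "\<lambda>x. \<psi> x *\<^sub>R u x"] by metis
qed

lemma test_functionE:
  fixes \<phi> :: "'a::euclidean_space \<Rightarrow> real"
  assumes "test_function U \<phi>"
  obtains K where "compact K" "K \<subseteq> U" "\<And>x. x \<notin> K \<Longrightarrow> \<phi> x = 0"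
    "\<And>x h. x \<notin> K \<Longrightarrow> frechet_derivative \<phi> (at x) h = 0"
    "continuous_on UNIV \<phi>" "\<And>h. continuous_on UNIV (\<lambda>x. frechet_derivative \<phi> (at x) h)"
proof -
  obtain K where K: "compact K" "K \<subseteq> U" "\<And>x. x \<notin> K \<Longrightarrow> \<phi> x = 0"
    using assms by (auto simp: test_function_def)
  have C: "C_k 0 \<phi>" "C_k (Suc 0) \<phi>" using assms by (auto simp: test_function_def C_infty_def)
  have "frechet_derivative \<phi> (at x) h = 0" if x: "x \<notin> K" for x h
  proof -
    have "((\<lambda>_. 0) has_derivative (\<lambda>_. 0)) (at x)" by simp
    then have "(\<phi> has_derivative (\<lambda>_. 0)) (at x)"
      by (rule has_derivative_transform_within_open[of _ _ _ _ "- K"])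
         (use x K compact_imp_closed in auto)
    then show ?thesis using frechet_derivative_at by (metis (no_types))
  qed
  then show thesis using that K C by auto
qed

lemma test_function_integrable:
  fixes u :: "'a::euclidean_space \<Rightarrow> 'b::euclidean_space"
  assumes "test_function U \<phi>" "open U" "locally_integrable U u"
  shows "integrable (lebesgue_on U) (\<lambda>x. \<phi> x *\<^sub>R u x)"
    and "integrable (lebesgue_on U) (\<lambda>x. frechet_derivative \<phi> (at x) h *\<^sub>R u x)"
proof -
  obtain K where K: "compact K" "K \<subseteq> U" "\<And>x. x \<notin> K \<Longrightarrow> \<phi> x = 0"
    "\<And>x h. x \<notin> K \<Longrightarrow> frechet_derivative \<phi> (at x) h = 0"
    "continuous_on UNIV \<phi>" "\<And>h. continuous_on UNIV (\<lambda>x. frechet_derivative \<phi> (at x) h)"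
    by (rule test_functionE[OF assms(1)]) blast
  show "integrable (lebesgue_on U) (\<lambda>x. \<phi> x *\<^sub>R u x)"
    by (rule integrable_continuous_scaleR[OF K(5,1,2)]) (use K assms in auto)
  show "integrable (lebesgue_on U) (\<lambda>x. frechet_derivative \<phi> (at x) h *\<^sub>R u x)"
    by (rule integrable_continuous_scaleR[OF K(6,1,2)]) (use K assms in auto)
qed

lemma locally_integrable_diff:
  "locally_integrable U u \<Longrightarrow> locally_integrable U w \<Longrightarrow> locally_integrable U (\<lambda>x. u x - w x)"
  by (auto simp: locally_integrable_def)

lemma fundamental_lemma_of_variations:
  fixes u :: "'a::euclidean_space \<Rightarrow> 'b::euclidean_space"
  assumes U: "open U" and u: "locally_integrable U u"
    and zero: "\<And>\<phi> :: 'a \<Rightarrow> real. test_function U \<phi> \<Longrightarrow> (\<integral>x. \<phi> x *\<^sub>R u x \<partial>lebesgue_on U) = 0"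
  shows "AE x in lebesgue_on U. u x = 0"
proof (rule AE_eq_0_if_box_integrals_0[OF U u])
  fix a b assume sub: "cbox a b \<subseteq> U"
  have [simp]: "U \<in> sets lebesgue" using U by simp
  have intK: "integrable (lebesgue_on (cbox a b)) u" using u sub by (simp add: locally_integrable_def)
  have "(\<lambda>k. \<integral>x. bump k a b x *\<^sub>R u x \<partial>lebesgue_on U) \<longlonglongrightarrow> (\<integral>x. indicator (box a b) x *\<^sub>R u x \<partial>lebesgue_on U)"
  proof (rule integral_dominated_convergence[where w="\<lambda>x. indicator (cbox a b) x *\<^sub>R norm (u x)"])
    show "integrable (lebesgue_on U) (\<lambda>x. indicator (cbox a b) x *\<^sub>R norm (u x))"
      using intK sub by (subst integrable_lebesgue_on_subset) auto
    show "(\<lambda>x. bump k a b x *\<^sub>R u x) \<in> borel_measurable (lebesgue_on U)" for k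
      by (intro borel_measurable_integrable test_function_integrable test_function_bump sub U u)
    have "integrable (lebesgue_on (box a b)) u"
      using intK integrable_lebesgue_on_subset(1)[of "box a b" "cbox a b" u] box_subset_cbox[of a b]
      using integrable_mult_indicator[of "box a b" "lebesgue_on (cbox a b)" u]
      by (auto simp: sets_restrict_space_iff)
    then show "(\<lambda>x. indicator (box a b) x *\<^sub>R u x) \<in> borel_measurable (lebesgue_on U)"
      using sub box_subset_cbox[of a b] integrable_lebesgue_on_subset(1)[of "box a b" U u]
      by (intro borel_measurable_integrable) auto
    show "AE x in lebesgue_on U. (\<lambda>k. bump k a b x *\<^sub>R u x) \<longlonglongrightarrow> indicator (box a b) x *\<^sub>R u x"
      by (intro AE_I2 tendsto_scaleR bump_tendsto tendsto_const)
    show "AE x in lebesgue_on U. norm (bump k a b x *\<^sub>R u x) \<le> indicator (cbox a b) x *\<^sub>R norm (u x)" for k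
    proof (rule AE_I2)
      fix x
      show "norm (bump k a b x *\<^sub>R u x) \<le> indicator (cbox a b) x *\<^sub>R norm (u x)"
      proof (cases "x \<in> cbox a b")
        case False
        then have "x \<notin> box a b" using box_subset_cbox[of a b] by blast
        then show ?thesis using bump_eq_0[of x a b k] by simp
      qed (use bump_bounds[of k a b x] in \<open>auto simp: mult_left_le_one_le\<close>)
    qed
  qed
  moreover have "(\<integral>x. bump k a b x *\<^sub>R u x \<partial>lebesgue_on U) = 0" for k
    by (intro zero test_function_bump sub)
  ultimately have "(\<integral>x. indicator (box a b) x *\<^sub>R u x \<partial>lebesgue_on U) = 0"
    by (simp add: LIMSEQ_const_iff)
  also have "(\<integral>x. indicator (box a b) x *\<^sub>R u x \<partial>lebesgue_on U) = (\<integral>x. u x \<partial>lebesgue_on (box a b))"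
    using sub box_subset_cbox[of a b] by (intro integrable_lebesgue_on_subset) auto
  also have "\<dots> = (\<integral>x. u x \<partial>lebesgue_on (cbox a b))"
  proof -
    have "integrable (lebesgue_on (box a b)) u"
      using intK integrable_lebesgue_on_subset(1)[of "box a b" "cbox a b" u] box_subset_cbox[of a b]
      using integrable_mult_indicator[of "box a b" "lebesgue_on (cbox a b)" u]
      by (auto simp: sets_restrict_space_iff)
    then show ?thesis using intK
      by (simp add: lebesgue_integral_eq_integral integral_open_interval)
  qed
  finally show "(\<integral>x. u x \<partial>lebesgue_on (cbox a b)) = 0" .
qed

lemma has_weak_deriv_unique:
  assumes U: "open U" and "has_weak_deriv U h u g" "has_weak_deriv U h u g'"
  shows "AE x in lebesgue_on U. g x = g' x"
proof -
  have g: "locally_integrable U g" "locally_integrable U g'" using assms by (auto simp: has_weak_deriv_def)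
  have "AE x in lebesgue_on U. g x - g' x = 0"
  proof (rule fundamental_lemma_of_variations[OF U locally_integrable_diff[OF g]])
    fix \<phi> :: "'a \<Rightarrow> real" assume \<phi>: "test_function U \<phi>"
    have "(\<integral>x. \<phi> x *\<^sub>R (g x - g' x) \<partial>lebesgue_on U)
        = (\<integral>x. \<phi> x *\<^sub>R g x \<partial>lebesgue_on U) - (\<integral>x. \<phi> x *\<^sub>R g' x \<partial>lebesgue_on U)"
      using test_function_integrable(1)[OF \<phi> U g(1)] test_function_integrable(1)[OF \<phi> U g(2)]
      by (simp add: scaleR_diff_right)
    also have "\<dots> = 0" using assms(2,3) \<phi> unfolding has_weak_deriv_def
      by (metis neg_equal_iff_equal right_minus_eq)
    finally show "(\<integral>x. \<phi> x *\<^sub>R (g x - g' x) \<partial>lebesgue_on U) = 0" .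
  qed
  then show ?thesis by simp
qed

lemma has_weak_deriv_diff:
  assumes U: "open U" and uw: "has_weak_deriv U h u g" "has_weak_deriv U h w k"
  shows "has_weak_deriv U h (\<lambda>x. u x - w x) (\<lambda>x. g x - k x)"
proof -
  note l = uw[unfolded has_weak_deriv_def]
  show ?thesis unfolding has_weak_deriv_def
  proof (intro conjI allI impI locally_integrable_diff)
    fix \<phi> :: "'a \<Rightarrow> real" assume \<phi>: "test_function U \<phi>"
    have loc: "locally_integrable U u" "locally_integrable U w" "locally_integrable U g" "locally_integrable U k"
      using l by auto
    note t = test_function_integrable[OF \<phi> U]
    have "(\<integral>x. frechet_derivative \<phi> (at x) h *\<^sub>R (u x - w x) \<partial>lebesgue_on U)
        = (\<integral>x. frechet_derivative \<phi> (at x) h *\<^sub>R u x \<partial>lebesgue_on U)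
          - (\<integral>x. frechet_derivative \<phi> (at x) h *\<^sub>R w x \<partial>lebesgue_on U)"
      unfolding scaleR_diff_right by (intro Bochner_Integration.integral_diff t loc)
    also have "\<dots> = - ((\<integral>x. \<phi> x *\<^sub>R g x \<partial>lebesgue_on U) - (\<integral>x. \<phi> x *\<^sub>R k x \<partial>lebesgue_on U))"
      using l \<phi> by simp
    also have "\<dots> = - (\<integral>x. \<phi> x *\<^sub>R (g x - k x) \<partial>lebesgue_on U)"
      unfolding scaleR_diff_right by (simp add: Bochner_Integration.integral_diff[OF t(1)[OF loc(3)] t(1)[OF loc(4)]])
    finally show "(\<integral>x. frechet_derivative \<phi> (at x) h *\<^sub>R (u x - w x) \<partial>lebesgue_on U)
        = - (\<integral>x. \<phi> x *\<^sub>R (g x - k x) \<partial>lebesgue_on U)" .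
  qed (use l in auto)
qed

lemma test_scaleR_tendsto:
  fixes u :: "nat \<Rightarrow> 'a::euclidean_space \<Rightarrow> 'b::euclidean_space"
  assumes \<psi>: "\<psi> \<in> borel_measurable (lebesgue_on U)" "\<And>x. \<bar>\<psi> x\<bar> \<le> C"
    and u: "\<And>k. integrable (lebesgue_on U) (u k)" "integrable (lebesgue_on U) w"
    and lim: "(\<lambda>k. \<integral>x. norm (u k x - w x) \<partial>lebesgue_on U) \<longlonglongrightarrow> 0"
  shows "(\<lambda>k. \<integral>x. \<psi> x *\<^sub>R u k x \<partial>lebesgue_on U) \<longlonglongrightarrow> (\<integral>x. \<psi> x *\<^sub>R w x \<partial>lebesgue_on U)"
proof -
  have int: "integrable (lebesgue_on U) (\<lambda>x. \<psi> x *\<^sub>R y x)" if y: "integrable (lebesgue_on U) y"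
    for y :: "'a \<Rightarrow> 'b"
  proof (rule Bochner_Integration.integrable_bound)
    show "integrable (lebesgue_on U) (\<lambda>x. C * norm (y x))" using y by simp
    show "(\<lambda>x. \<psi> x *\<^sub>R y x) \<in> borel_measurable (lebesgue_on U)" using \<psi>(1) y by measurable
    show "AE x in lebesgue_on U. norm (\<psi> x *\<^sub>R y x) \<le> norm (C * norm (y x))"
      using \<psi>(2) by (intro AE_I2) (auto simp: abs_mult intro!: mult_right_mono order_trans[OF _ abs_ge_self])
  qed
  have bound: "norm ((\<integral>x. \<psi> x *\<^sub>R u k x \<partial>lebesgue_on U) - (\<integral>x. \<psi> x *\<^sub>R w x \<partial>lebesgue_on U))
      \<le> C * (\<integral>x. norm (u k x - w x) \<partial>lebesgue_on U)" for k
  proof -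
    have "(\<integral>x. \<psi> x *\<^sub>R u k x \<partial>lebesgue_on U) - (\<integral>x. \<psi> x *\<^sub>R w x \<partial>lebesgue_on U)
        = (\<integral>x. \<psi> x *\<^sub>R (u k x - w x) \<partial>lebesgue_on U)"
      using int u by (simp add: scaleR_diff_right)
    also have "norm \<dots> \<le> (\<integral>x. norm (\<psi> x *\<^sub>R (u k x - w x)) \<partial>lebesgue_on U)"
      by (rule Bochner_Integration.integral_norm_bound)
    also have "\<dots> \<le> (\<integral>x. C * norm (u k x - w x) \<partial>lebesgue_on U)"
      using \<psi>(2) u int[OF Bochner_Integration.integrable_diff[OF u(1) u(2)]]
      by (intro integral_mono integrable_norm) (auto intro: mult_right_mono)
    finally show ?thesis by simp
  qed
  have "(\<lambda>k. C * (\<integral>x. norm (u k x - w x) \<partial>lebesgue_on U)) \<longlonglongrightarrow> 0"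
    using tendsto_mult[OF tendsto_const lim, of C] by simp
  then have "(\<lambda>k. (\<integral>x. \<psi> x *\<^sub>R u k x \<partial>lebesgue_on U) - (\<integral>x. \<psi> x *\<^sub>R w x \<partial>lebesgue_on U)) \<longlonglongrightarrow> 0"
    by (rule Lim_null_comparison[OF always_eventually[OF allI[OF bound]]])
  then show ?thesis by (simp add: LIM_zero_iff)
qed

lemma integrable_imp_locally_integrable:
  assumes "integrable (lebesgue_on U) u" "open U" shows "locally_integrable U u"
  unfolding locally_integrable_def
proof (intro allI impI)
  fix K assume "compact K \<and> K \<subseteq> U"
  then have "integrable (lebesgue_on U) (\<lambda>x. indicator K x *\<^sub>R u x)"
    using assms compact_sets_lebesgue by (intro integrable_mult_indicator) (auto simp: sets_restrict_space_iff)
  then show "integrable (lebesgue_on K) u"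
    using integrable_lebesgue_on_subset(1)[of K U u] \<open>compact K \<and> K \<subseteq> U\<close> compact_sets_lebesgue assms by auto
qed

text \<open>
  Both sides of the defining identity are integrals against a bounded function, hence continuous with
  respect to convergence in \<open>L\<^sup>1\<close>.
\<close>

lemma has_weak_deriv_limit:
  fixes u :: "nat \<Rightarrow> 'a::euclidean_space \<Rightarrow> 'b::euclidean_space"
  assumes U: "open U" and wd: "\<And>k. has_weak_deriv U h (u k) (g k)"
    and int: "\<And>k. integrable (lebesgue_on U) (u k)" "\<And>k. integrable (lebesgue_on U) (g k)"
      "integrable (lebesgue_on U) w" "integrable (lebesgue_on U) G"
    and lim: "(\<lambda>k. \<integral>x. norm (u k x - w x) \<partial>lebesgue_on U) \<longlonglongrightarrow> 0"
      "(\<lambda>k. \<integral>x. norm (g k x - G x) \<partial>lebesgue_on U) \<longlonglongrightarrow> 0"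
  shows "has_weak_deriv U h w G"
  unfolding has_weak_deriv_def
proof (intro conjI allI impI)
  show "locally_integrable U w" "locally_integrable U G"
    using int U by (auto intro: integrable_imp_locally_integrable)
  fix \<phi> :: "'a \<Rightarrow> real" assume \<phi>: "test_function U \<phi>"
  obtain K where K: "compact K" "K \<subseteq> U" "\<And>x. x \<notin> K \<Longrightarrow> \<phi> x = 0"
    "\<And>x h. x \<notin> K \<Longrightarrow> frechet_derivative \<phi> (at x) h = 0"
    "continuous_on UNIV \<phi>" "\<And>h. continuous_on UNIV (\<lambda>x. frechet_derivative \<phi> (at x) h)"
    by (rule test_functionE[OF \<phi>]) blast
  have conv: "(\<lambda>k. \<integral>x. \<psi> x *\<^sub>R y k x \<partial>lebesgue_on U) \<longlonglongrightarrow> (\<integral>x. \<psi> x *\<^sub>R z x \<partial>lebesgue_on U)"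
    if \<psi>: "continuous_on UNIV \<psi>" "\<And>x. x \<notin> K \<Longrightarrow> \<psi> x = 0"
      and y: "\<And>k. integrable (lebesgue_on U) (y k)" "integrable (lebesgue_on U) z"
        "(\<lambda>k. \<integral>x. norm (y k x - z x) \<partial>lebesgue_on U) \<longlonglongrightarrow> 0"
    for \<psi> :: "'a \<Rightarrow> real" and y :: "nat \<Rightarrow> 'a \<Rightarrow> 'b" and z
  proof -
    have "compact (\<psi> ` K)" using \<psi> K by (meson compact_continuous_image continuous_on_subset subset_UNIV)
    then have "bounded (\<psi> ` K)" by (rule compact_imp_bounded)
    then obtain C where C: "\<And>x. x \<in> K \<Longrightarrow> norm (\<psi> x) \<le> C" by (auto simp: bounded_iff)
    have "\<bar>\<psi> x\<bar> \<le> max C 0" for x using C[of x] \<psi>(2)[of x] by (cases "x \<in> K") auto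
    moreover have "\<psi> \<in> borel_measurable (lebesgue_on U)"
      using \<psi>(1) by (intro measurable_restrict_space1 measurable_completion)
        (simp add: borel_measurable_continuous_onI)
    ultimately show ?thesis using y by (intro test_scaleR_tendsto) auto
  qed
  have "(\<lambda>k. \<integral>x. frechet_derivative \<phi> (at x) h *\<^sub>R u k x \<partial>lebesgue_on U)
      \<longlonglongrightarrow> (\<integral>x. frechet_derivative \<phi> (at x) h *\<^sub>R w x \<partial>lebesgue_on U)"
    using K int lim by (intro conv) auto
  moreover have "(\<lambda>k. - (\<integral>x. \<phi> x *\<^sub>R g k x \<partial>lebesgue_on U)) \<longlonglongrightarrow> - (\<integral>x. \<phi> x *\<^sub>R G x \<partial>lebesgue_on U)"
    using K int lim by (intro tendsto_minus conv) auto
  moreover have "(\<integral>x. frechet_derivative \<phi> (at x) h *\<^sub>R u k x \<partial>lebesgue_on U)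
      = - (\<integral>x. \<phi> x *\<^sub>R g k x \<partial>lebesgue_on U)" for k
    using wd[of k] \<phi> by (simp add: has_weak_deriv_def)
  ultimately show "(\<integral>x. frechet_derivative \<phi> (at x) h *\<^sub>R w x \<partial>lebesgue_on U)
      = - (\<integral>x. \<phi> x *\<^sub>R G x \<partial>lebesgue_on U)"
    using LIMSEQ_unique by fastforce
qed

section \<open>Weak gradients in Sobolev spaces\<close>

lemma Lp_eq_Lp_on: "Lp p S f \<longleftrightarrow> Lp_on p (lebesgue_on S) f"
  by (simp add: Lp_def Lp_on_def)

lemma norm_column_le: "norm (column j A) \<le> norm A"
  for A :: "real^'n^'m"
  unfolding norm_vec_def[of A] norm_vec_def[of "column j A"]
  by (intro L2_set_mono) (auto simp: column_def component_le_norm_cart)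

lemma column_diff: "column j (A - B) = column j A - column j B"
  for A :: "real^'n^'m"
  by (simp add: column_def vec_eq_iff)

lemma bounded_linear_column: "bounded_linear (column j :: real^'n^'m \<Rightarrow> real^'m)"
  by (rule bounded_linear_intro[where K=1])
     (auto simp: column_def vec_eq_iff norm_column_le[of j, unfolded column_def])

lemma column_measurable [measurable]:
  "f \<in> borel_measurable M \<Longrightarrow> (\<lambda>x. column j (f x :: real^'n^'m)) \<in> borel_measurable M"
  by (rule measurable_compose[OF _ borel_measurable_continuous_onI])
     (auto intro: linear_continuous_on bounded_linear_column)

lemma has_weak_grad_unique:
  assumes "open U" "has_weak_grad U u G" "has_weak_grad U u H"
  shows "AE x in lebesgue_on U. G x = H x"
proof -
  have "AE x in lebesgue_on U. \<forall>j\<in>UNIV. column j (G x) = column j (H x)"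
  proof (rule AE_finite_allI)
    show "AE x in lebesgue_on U. column j (G x) = column j (H x)" for j
      using has_weak_deriv_unique[OF assms(1)] assms(2,3) unfolding has_weak_grad_def by metis
  qed simp
  then show ?thesis
    by eventually_elim (simp add: column_def vec_eq_iff)
qed

lemma has_weak_grad_weak_grad: "has_weak_grad U u G \<Longrightarrow> has_weak_grad U u (weak_grad U u)"
  unfolding weak_grad_def by (rule someI[of "has_weak_grad U u"])

lemma weak_grad_AE_eq:
  assumes "open U" "has_weak_grad U u G"
  shows "AE x in lebesgue_on U. weak_grad U u x = G x"
  by (rule has_weak_grad_unique[OF assms(1) has_weak_grad_weak_grad[OF assms(2)] assms(2)])

lemma has_weak_grad_diff:
  assumes "open U" "has_weak_grad U u G" "has_weak_grad U w H"
  shows "has_weak_grad U (\<lambda>x. u x - w x) (\<lambda>x. G x - H x)"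
  unfolding has_weak_grad_def column_diff
  using assms(2,3) by (auto simp: has_weak_grad_def intro!: has_weak_deriv_diff[OF assms(1)])

lemma Lp_on_weak_grad:
  assumes U: "open U" and G: "has_weak_grad U u G" "Lp_on p (lebesgue_on U) G"
  shows "Lp_on p (lebesgue_on U) (weak_grad U u)"
    and "Lp_int p (lebesgue_on U) (weak_grad U u) = Lp_int p (lebesgue_on U) G"
proof -
  have ae: "AE x in lebesgue_on U. G x = weak_grad U u x"
    using weak_grad_AE_eq[OF U G(1)] by eventually_elim simp
  have m: "weak_grad U u \<in> borel_measurable (lebesgue_on U)"
    using U by (intro borel_measurable_lebesgue_on_AE[OF _ Lp_on_measurable[OF G(2)] ae]) simp
  note [measurable] = m G(2)[THEN Lp_on_measurable]
  show "Lp_on p (lebesgue_on U) (weak_grad U u)"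
  proof (rule Lp_onI[OF m])
    show "integrable (lebesgue_on U) (\<lambda>x. norm (weak_grad U u x) powr p)"
      by (rule integrable_cong_AE_imp[OF G(2)[THEN Lp_on_integrable]]) (measurable, use ae in eventually_elim, simp)
  qed
  show "Lp_int p (lebesgue_on U) (weak_grad U u) = Lp_int p (lebesgue_on U) G"
    by (rule Lp_int_cong_AE[OF weak_grad_AE_eq[OF U G(1)] m Lp_on_measurable[OF G(2)]])
qed

lemma W1pD:
  assumes U: "open U" and u: "W1p p U u"
  shows "Lp_on p (lebesgue_on U) u" "has_weak_grad U u (weak_grad U u)"
    "Lp_on p (lebesgue_on U) (weak_grad U u)"
proof -
  obtain G where G: "has_weak_grad U u G" "Lp_on p (lebesgue_on U) G" and "Lp_on p (lebesgue_on U) u"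
    using u by (auto simp: W1p_def Lp_eq_Lp_on)
  then show "Lp_on p (lebesgue_on U) u" by simp
  show "has_weak_grad U u (weak_grad U u)" by (rule has_weak_grad_weak_grad[OF G(1)])
  show "Lp_on p (lebesgue_on U) (weak_grad U u)" by (rule Lp_on_weak_grad(1)[OF U G])
qed

text \<open>
  The Sobolev norm of a difference uses the weak gradient of the difference, an arbitrary choice; by
  uniqueness it is almost everywhere the difference of the chosen gradients.
\<close>

lemma W1p_norm_tendsto_0:
  assumes U: "open U" and p: "1 < p" and u: "\<And>k. W1p p U (u k)" and w: "W1p p U w"
    and lim: "(\<lambda>k. W1p_norm p U (\<lambda>x. u k x - w x)) \<longlonglongrightarrow> 0"
  shows "(\<lambda>k. Lp_int p (lebesgue_on U) (\<lambda>x. u k x - w x)) \<longlonglongrightarrow> 0"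
    and "(\<lambda>k. Lp_int p (lebesgue_on U) (\<lambda>x. weak_grad U (u k) x - weak_grad U w x)) \<longlonglongrightarrow> 0"
proof -
  let ?X = "\<lambda>k. Lp_int p (lebesgue_on U) (\<lambda>x. u k x - w x)"
  let ?Y = "\<lambda>k. Lp_int p (lebesgue_on U) (\<lambda>x. weak_grad U (u k) x - weak_grad U w x)"
  have Y: "?Y k = Lp_int p (lebesgue_on U) (weak_grad U (\<lambda>x. u k x - w x))" for k
    using p u w U by (intro Lp_on_weak_grad(2)[symmetric] has_weak_grad_diff Lp_on_diff W1pD) auto
  have "W1p_norm p U (\<lambda>x. u k x - w x) powr p = ?X k + ?Y k" for k
    unfolding W1p_norm_def Y using p by (simp add: powr_powr Lp_int_def)
  moreover have "(\<lambda>k. W1p_norm p U (\<lambda>x. u k x - w x) powr p) \<longlonglongrightarrow> 0"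
    using tendsto_powr'[OF lim tendsto_const, of p] p by (simp add: W1p_norm_def)
  ultimately have s: "(\<lambda>k. ?X k + ?Y k) \<longlonglongrightarrow> 0" by simp
  show "?X \<longlonglongrightarrow> 0" "?Y \<longlonglongrightarrow> 0"
    by (rule tendsto_sandwich[OF _ _ tendsto_const s]; simp)+
qed

lemma (in finite_measure) Lp_on_L1:
  fixes u :: "'a \<Rightarrow> 'b::euclidean_space"
  assumes p: "1 < p" and u: "Lp_on p M u"
  shows "integrable M u"
    and "(\<integral>x. norm (u x) \<partial>M) \<le> measure M (space M) powr (1 - 1 / p) * Lp_int p M u powr (1 / p)"
proof -
  have one: "Lp_on p M (\<lambda>x. 1 :: real)" by (simp add: Lp_on_def)
  have "integrable M (\<lambda>x. norm (u x))" using integrable_powr_mult[OF p one u] by simp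
  then show "integrable M u" using u by (simp add: integrable_norm_iff Lp_on_def)
  show "(\<integral>x. norm (u x) \<partial>M) \<le> measure M (space M) powr (1 - 1 / p) * Lp_int p M u powr (1 / p)"
    using Lp_Holder[OF p one u] by (simp add: Lp_int_def)
qed

lemma (in finite_measure) Lp_tendsto_L1:
  fixes u :: "nat \<Rightarrow> 'a \<Rightarrow> 'b::euclidean_space"
  assumes p: "1 < p" and u: "\<And>k. Lp_on p M (u k)" and w: "Lp_on p M w"
    and lim: "(\<lambda>k. Lp_int p M (\<lambda>x. u k x - w x)) \<longlonglongrightarrow> 0"
  shows "(\<lambda>k. \<integral>x. norm (u k x - w x) \<partial>M) \<longlonglongrightarrow> 0"
proof (rule tendsto_sandwich[OF _ _ tendsto_const])
  let ?c = "measure M (space M) powr (1 - 1 / p)"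
  show "(\<lambda>k. ?c * Lp_int p M (\<lambda>x. u k x - w x) powr (1 / p)) \<longlonglongrightarrow> 0"
    using tendsto_mult[OF tendsto_const Lp_int_tendsto_0_powr[OF p lim], of ?c] by simp
  show "\<forall>\<^sub>F k in sequentially. (\<integral>x. norm (u k x - w x) \<partial>M) \<le> ?c * Lp_int p M (\<lambda>x. u k x - w x) powr (1 / p)"
    using p u w by (intro always_eventually allI Lp_on_L1(2) Lp_on_diff) auto
qed simp

lemma has_weak_grad_limit:
  fixes u :: "nat \<Rightarrow> real^'n \<Rightarrow> real^'m"
  assumes U: "open U" "bounded U" and p: "1 < p"
    and wd: "\<And>k. has_weak_grad U (u k) (G k)"
    and Lp: "\<And>k. Lp_on p (lebesgue_on U) (u k)" "\<And>k. Lp_on p (lebesgue_on U) (G k)"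
      "Lp_on p (lebesgue_on U) w" "Lp_on p (lebesgue_on U) H"
    and lim: "(\<lambda>k. Lp_int p (lebesgue_on U) (\<lambda>x. u k x - w x)) \<longlonglongrightarrow> 0"
      "(\<lambda>k. Lp_int p (lebesgue_on U) (\<lambda>x. G k x - H x)) \<longlonglongrightarrow> 0"
  shows "has_weak_grad U w H"
proof -
  interpret finite_measure "lebesgue_on U"
    using U by (intro finite_measure_lebesgue_on lmeasurable_open)
  have int: "integrable (lebesgue_on U) (G k)" "integrable (lebesgue_on U) H"
    "integrable (lebesgue_on U) (u k)" "integrable (lebesgue_on U) w" for k
    using Lp p by (auto intro: Lp_on_L1)
  have L1: "(\<lambda>k. \<integral>x. norm (u k x - w x) \<partial>lebesgue_on U) \<longlonglongrightarrow> 0"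
    "(\<lambda>k. \<integral>x. norm (G k x - H x) \<partial>lebesgue_on U) \<longlonglongrightarrow> 0"
    using Lp_tendsto_L1[where u=u and w=w] Lp_tendsto_L1[where u=G and w=H] p Lp lim by simp_all
  show ?thesis unfolding has_weak_grad_def
  proof
    fix j
    show "has_weak_deriv U (axis j 1) w (\<lambda>x. column j (H x))"
    proof (rule has_weak_deriv_limit[OF U(1), where u=u and g="\<lambda>k x. column j (G k x)"])
    fix k
    show "has_weak_deriv U (axis j 1) (u k) (\<lambda>x. column j (G k x))"
      using wd by (simp add: has_weak_grad_def)
    have colint: "integrable (lebesgue_on U) (\<lambda>x. column j (F x))"
      if "integrable (lebesgue_on U) F" for F :: "real^'n \<Rightarrow> real^'n^'m"
      by (rule integrable_bounded_linear[OF bounded_linear_column that])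
    show "integrable (lebesgue_on U) (\<lambda>x. column j (G k x))" "integrable (lebesgue_on U) (\<lambda>x. column j (H x))"
      using int colint by auto
    show "(\<lambda>k. \<integral>x. norm (column j (G k x) - column j (H x)) \<partial>lebesgue_on U) \<longlonglongrightarrow> 0"
    proof (rule tendsto_sandwich[OF _ _ tendsto_const L1(2)])
      show "\<forall>\<^sub>F k in sequentially. (\<integral>x. norm (column j (G k x) - column j (H x)) \<partial>lebesgue_on U)
          \<le> (\<integral>x. norm (G k x - H x) \<partial>lebesgue_on U)"
        unfolding column_diff[symmetric]
        using int by (intro always_eventually allI integral_mono integrable_norm colint norm_column_le) auto
    qed simp
    qed (use int L1 in auto)
  qed
qed

section \<open>Backward averages in time\<close>

lemma Lp_interval_Jensen:
  fixes g :: "real \<Rightarrow> 'b::euclidean_space"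
  assumes p: "1 < p" and g: "Lp_on p lborel g" and cd: "c \<le> d"
  shows "integrable lborel (\<lambda>r. indicator {c..d} r *\<^sub>R g r)"
    and "norm (\<integral>r. indicator {c..d} r *\<^sub>R g r \<partial>lborel) powr p
      \<le> (d - c) powr (p - 1) * (\<integral>r. indicator {c..d} r * norm (g r) powr p \<partial>lborel)"
proof -
  note [measurable] = Lp_on_measurable[OF g]
  let ?i = "indicator {c..d} :: real \<Rightarrow> real" and ?g = "\<lambda>r. indicator {c..d} r *\<^sub>R g r"
  have i: "norm (?i r) powr q = ?i r" for r q by (simp add: indicator_def)
  have ii: "Lp_on p lborel ?i" by (intro Lp_onI) (simp_all only: i, auto intro!: integrable_real_indicator simp: emeasure_lborel_Icc_eq)
  have eq: "norm (?g r) powr p = ?i r * norm (g r) powr p" for r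
    by (simp add: powr_mult i[simplified])
  have gg: "Lp_on p lborel ?g"
  proof
    show "integrable lborel (\<lambda>r. norm (?g r) powr p)"
      unfolding eq using integrable_mult_indicator[OF _ Lp_on_integrable[OF g], of "{c..d}"] by simp
  qed measurable
  have eq2: "norm (?i r) powr (p - 1) * norm (?g r) = norm (?g r)" for r
    by (simp add: indicator_def)
  have "integrable lborel (\<lambda>r. norm (?g r))"
    using integrable_powr_mult[OF p ii gg] unfolding eq2 .
  then show int: "integrable lborel ?g"
    by (subst (asm) integrable_norm_iff) measurable
  have Li: "Lp_int p lborel ?i = d - c" unfolding Lp_int_def i using cd by simp
  have "norm (\<integral>r. ?g r \<partial>lborel) \<le> (\<integral>r. norm (?g r) \<partial>lborel)"
    by (rule Bochner_Integration.integral_norm_bound)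
  also have "\<dots> \<le> (d - c) powr (1 - 1 / p) * Lp_int p lborel ?g powr (1 / p)"
    using Lp_Holder[OF p ii gg] unfolding eq2 Li .
  finally have "norm (\<integral>r. ?g r \<partial>lborel) powr p
      \<le> ((d - c) powr (1 - 1 / p) * Lp_int p lborel ?g powr (1 / p)) powr p"
    using p by (intro powr_mono2) auto
  also have "\<dots> = (d - c) powr (p - 1) * Lp_int p lborel ?g"
    using p cd by (simp add: powr_mult powr_powr algebra_simps)
  finally show "norm (\<integral>r. ?g r \<partial>lborel) powr p
      \<le> (d - c) powr (p - 1) * (\<integral>r. ?i r * norm (g r) powr p \<partial>lborel)"
    by (simp add: Lp_int_def eq del: norm_scaleR)
qed

lemma lborel_integral_eq_HK:
  fixes g :: "real \<Rightarrow> 'b::euclidean_space"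
  assumes "integrable lborel (\<lambda>r. indicator {c..d} r *\<^sub>R g r)"
  shows "g integrable_on {c..d}" "integral {c..d} g = (\<integral>r. indicator {c..d} r *\<^sub>R g r \<partial>lborel)"
proof -
  have "set_integrable lborel {c..d} g" using assms by (simp add: set_integrable_def)
  from set_borel_integral_eq_integral[OF this]
  show "g integrable_on {c..d}" "integral {c..d} g = (\<integral>r. indicator {c..d} r *\<^sub>R g r \<partial>lborel)"
    by (simp_all add: set_lebesgue_integral_def)
qed

lemma AE_lebesgue_lborel: "(AE x in lebesgue. P x) \<longleftrightarrow> (AE x in lborel. P x)"
  by (rule AE_completion_iff)

text \<open>
  The differentiation theorem for boxes is about averages over \<open>[s, s + h]\<close>; reflecting the line gives those
  over \<open>[s - h, s]\<close>.
\<close>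

lemma backward_average_tendsto:
  fixes g :: "real \<Rightarrow> 'b::euclidean_space"
  assumes int: "\<And>c d. integrable lborel (\<lambda>r. indicator {c..d} r *\<^sub>R g r)"
    and h: "h \<longlonglongrightarrow> 0" "\<And>k. 0 < h k"
  shows "AE s in lborel. (\<lambda>k. (1 / h k) *\<^sub>R (\<integral>r. indicator {s - h k..s} r *\<^sub>R g r \<partial>lborel)) \<longlonglongrightarrow> g s"
proof -
  define g' where "g' r = g (- r)" for r
  have "g' integrable_on {c..d}" for c d
    using lborel_integral_eq_HK(1)[OF int, of "- d" "- c"]
      Henstock_Kurzweil_Integration.integrable_reflect_real[where f=g and a="- d" and b="- c"]
    by (simp add: g'_def[abs_def])
  then have "\<And>c d. g' integrable_on cbox c d" by (simp add: cbox_interval)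
  then obtain N where N: "negligible N" and lim: "\<And>x e. \<lbrakk>x \<notin> N; 0 < e\<rbrakk> \<Longrightarrow>
      \<exists>r>0. \<forall>t. 0 < t \<and> t < r \<longrightarrow> norm (integral (cbox x (x + t *\<^sub>R One)) g' /\<^sub>R t ^ DIM(real) - g' x) < e"
    by (rule integrable_ccontinuous_explicit) blast
  have conv: "(\<lambda>k. (1 / h k) *\<^sub>R (\<integral>r. indicator {s - h k..s} r *\<^sub>R g r \<partial>lborel)) \<longlonglongrightarrow> g s"
    if s: "- s \<notin> N" for s
  proof (rule LIMSEQ_I)
    fix e :: real assume "0 < e"
    then obtain r where r: "r > 0" "\<And>t. 0 < t \<Longrightarrow> t < r \<Longrightarrow> norm (integral {- s..- s + t} g' /\<^sub>R t - g' (- s)) < e"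
      using lim[OF s \<open>0 < e\<close>] unfolding cbox_interval by auto
    have "\<forall>\<^sub>F k in sequentially. h k < r" using order_tendstoD(2)[OF h(1) r(1)] .
    then obtain K where K: "\<And>k. k \<ge> K \<Longrightarrow> h k < r" by (auto simp: eventually_sequentially)
    show "\<exists>K. \<forall>k\<ge>K. norm ((1 / h k) *\<^sub>R (\<integral>r. indicator {s - h k..s} r *\<^sub>R g r \<partial>lborel) - g s) < e"
    proof (intro exI allI impI)
      fix k assume "K \<le> k"
      then have "norm (integral {- s..- s + h k} g' /\<^sub>R h k - g' (- s)) < e"
        using r(2)[OF h(2) K] by blast
      moreover have "integral {- s..- s + h k} g' = integral {s - h k..s} g"
        using Henstock_Kurzweil_Integration.integral_reflect_real[where a="s - h k" and b=s and f=g] by (simp add: g'_def[abs_def])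
      ultimately show "norm ((1 / h k) *\<^sub>R (\<integral>r. indicator {s - h k..s} r *\<^sub>R g r \<partial>lborel) - g s) < e"
        by (simp add: lborel_integral_eq_HK(2)[OF int] g'_def divide_inverse)
    qed
  qed
  have "AE x in lborel. x \<notin> N"
    using N unfolding AE_lebesgue_lborel[symmetric] by (simp add: AE_not_in negligible_iff_null_sets)
  then have "AE s in distr lborel borel uminus. s \<notin> N" unfolding lborel_distr_uminus .
  then have "AE s in lborel. - s \<notin> N"
    by (rule AE_distrD[rotated]) simp
  then show ?thesis by eventually_elim (rule conv)
qed

definition backward_mean :: "real \<Rightarrow> ('a \<times> real \<Rightarrow> 'b::euclidean_space) \<Rightarrow> 'a \<times> real \<Rightarrow> 'b" where
  "backward_mean h f z = (1 / h) *\<^sub>R (\<integral>r. indicator {snd z - h..snd z} r *\<^sub>R f (fst z, r) \<partial>lborel)"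

lemma backward_mean_measurable [measurable]:
  assumes [measurable]: "f \<in> borel_measurable (M \<Otimes>\<^sub>M lborel)"
  shows "backward_mean h f \<in> borel_measurable (M \<Otimes>\<^sub>M lborel)"
proof -
  have "(\<lambda>w. if snd (fst w) - h \<le> snd w \<and> snd w \<le> snd (fst w) then f (fst (fst w), snd w) else 0)
      \<in> borel_measurable ((M \<Otimes>\<^sub>M lborel) \<Otimes>\<^sub>M lborel)"
    by measurable
  also have "(\<lambda>w. if snd (fst w) - h \<le> snd w \<and> snd w \<le> snd (fst w) then f (fst (fst w), snd w) else 0)
      = case_prod (\<lambda>z r. indicator {snd z - h..snd z} r *\<^sub>R f (fst z, r))"
    by (auto simp: indicator_def fun_eq_iff)
  finally have "(\<lambda>z. \<integral>r. indicator {snd z - h..snd z} r *\<^sub>R f (fst z, r) \<partial>lborel) \<in> borel_measurable (M \<Otimes>\<^sub>M lborel)"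
    by (rule lborel.borel_measurable_lebesgue_integral)
  then show ?thesis unfolding backward_mean_def[abs_def] by measurable
qed

context sigma_finite_measure
begin

lemma pair_sigma_finite_lborel: "pair_sigma_finite M lborel"
  by (intro pair_sigma_finite.intro sigma_finite_measure_axioms lborel.sigma_finite_measure_axioms)

lemma AE_Lp_on_fst:
  assumes f: "Lp_on p (M \<Otimes>\<^sub>M lborel) f"
  shows "AE x in M. Lp_on p lborel (\<lambda>t. f (x, t))"
proof -
  interpret pair: pair_sigma_finite M lborel by (rule pair_sigma_finite_lborel)
  note [measurable] = Lp_on_measurable[OF f]
  have "AE x in M. integrable lborel (\<lambda>t. norm (f (x, t)) powr p)"
    using pair.AE_integrable_fst'[OF Lp_on_integrable[OF f]] by simp
  moreover have "AE x in M. (\<lambda>t. f (x, t)) \<in> borel_measurable lborel"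
    by (intro AE_I2) measurable
  ultimately show ?thesis by eventually_elim (rule Lp_onI)
qed

lemma AE_Lp_on_snd:
  assumes f: "Lp_on p (M \<Otimes>\<^sub>M lborel) f"
  shows "AE t in lborel. Lp_on p M (\<lambda>x. f (x, t))"
proof -
  interpret pair: pair_sigma_finite M lborel by (rule pair_sigma_finite_lborel)
  note [measurable] = Lp_on_measurable[OF f]
  have "AE t in lborel. integrable M (\<lambda>x. norm (f (x, t)) powr p)"
    using pair.AE_integrable_snd[of "\<lambda>x t. norm (f (x, t)) powr p"] Lp_on_integrable[OF f]
    by (simp add: case_prod_beta' )
  moreover have "AE t in lborel. (\<lambda>x. f (x, t)) \<in> borel_measurable M"
    by (intro AE_I2) measurable
  ultimately show ?thesis by eventually_elim (rule Lp_onI)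
qed

lemma Lp_int_snd:
  assumes f: "Lp_on p (M \<Otimes>\<^sub>M lborel) f"
  shows "integrable lborel (\<lambda>t. Lp_int p M (\<lambda>x. f (x, t)))"
    and "(\<integral>t. Lp_int p M (\<lambda>x. f (x, t)) \<partial>lborel) = Lp_int p (M \<Otimes>\<^sub>M lborel) f"
proof -
  interpret pair: pair_sigma_finite M lborel by (rule pair_sigma_finite_lborel)
  have i: "integrable (M \<Otimes>\<^sub>M lborel) (case_prod (\<lambda>x t. norm (f (x, t)) powr p))"
    using Lp_on_integrable[OF f] by (simp add: case_prod_beta')
  show "integrable lborel (\<lambda>t. Lp_int p M (\<lambda>x. f (x, t)))"
    unfolding Lp_int_def by (rule pair.integrable_snd[OF i])
  show "(\<integral>t. Lp_int p M (\<lambda>x. f (x, t)) \<partial>lborel) = Lp_int p (M \<Otimes>\<^sub>M lborel) f"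
    unfolding Lp_int_def pair.integral_snd[OF i] by (simp add: case_prod_beta')
qed

lemma Lp_on_slab:
  assumes f: "Lp_on p (M \<Otimes>\<^sub>M lborel) f" and [measurable]: "I \<in> sets borel"
  shows "Lp_on p (M \<Otimes>\<^sub>M lborel) (\<lambda>z. indicator I (snd z) *\<^sub>R f z)"
proof
  note [measurable] = Lp_on_measurable[OF f]
  show m: "(\<lambda>z. indicator I (snd z) *\<^sub>R f z) \<in> borel_measurable (M \<Otimes>\<^sub>M lborel)" by measurable
  show "integrable (M \<Otimes>\<^sub>M lborel) (\<lambda>z. norm (indicator I (snd z) *\<^sub>R f z) powr p)"
    by (rule Bochner_Integration.integrable_bound[OF Lp_on_integrable[OF f]])
       (use m in \<open>auto simp: indicator_def\<close>)
qed

lemma Lp_int_slab: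
  assumes f: "Lp_on p (M \<Otimes>\<^sub>M lborel) f" and I: "I \<in> sets borel"
  shows "(\<integral>t. indicator I t * Lp_int p M (\<lambda>x. f (x, t)) \<partial>lborel)
    = Lp_int p (M \<Otimes>\<^sub>M lborel) (\<lambda>z. indicator I (snd z) *\<^sub>R f z)"
proof -
  have "Lp_int p M (\<lambda>x. indicator I t *\<^sub>R f (x, t)) = indicator I t * Lp_int p M (\<lambda>x. f (x, t))" for t
    by (simp add: Lp_int_def indicator_def)
  then show ?thesis using Lp_int_snd(2)[OF Lp_on_slab[OF f I]] by simp
qed

text \<open>
  Jensen's inequality in time, followed by an exchange of the two time integrals, each point \<open>r\<close> being
  averaged over an interval of length \<open>h\<close>.
\<close>

lemma Lp_backward_mean:
  assumes p: "1 < p" and f: "Lp_on p (M \<Otimes>\<^sub>M lborel) f" and h: "0 < h"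
  shows "Lp_on p (M \<Otimes>\<^sub>M lborel) (backward_mean h f)"
    and "Lp_int p (M \<Otimes>\<^sub>M lborel) (backward_mean h f) \<le> Lp_int p (M \<Otimes>\<^sub>M lborel) f"
proof -
  interpret pair: pair_sigma_finite M lborel by (rule pair_sigma_finite_lborel)
  note [measurable] = Lp_on_measurable[OF f]
  have le: "(\<integral>\<^sup>+s. ennreal (norm (backward_mean h f (x, s)) powr p) \<partial>lborel)
      \<le> (\<integral>\<^sup>+s. ennreal (norm (f (x, s)) powr p) \<partial>lborel)"
    if x: "x \<in> space M" "Lp_on p lborel (\<lambda>t. f (x, t))" for x
  proof -
    note [measurable] = Lp_on_measurable[OF x(2)]
    let ?F = "\<lambda>r. norm (f (x, r)) powr p"
    have iF: "integrable lborel (\<lambda>r. indicator {s - h..s} r * ?F r)" for s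
      using integrable_mult_indicator[OF _ Lp_on_integrable[OF x(2)], of "{s - h..s}"] by simp
    have pt: "ennreal (norm (backward_mean h f (x, s)) powr p)
        \<le> (\<integral>\<^sup>+r. ennreal (1 / h) * (indicator {s - h..s} r * ennreal (?F r)) \<partial>lborel)" for s
    proof -
      have "norm (backward_mean h f (x, s)) powr p
          = (1 / h) powr p * norm (\<integral>r. indicator {s - h..s} r *\<^sub>R f (x, r) \<partial>lborel) powr p"
        using h by (simp add: backward_mean_def powr_mult powr_divide)
      also have "\<dots> \<le> (1 / h) powr p * (h powr (p - 1) * (\<integral>r. indicator {s - h..s} r * ?F r \<partial>lborel))"
        using Lp_interval_Jensen(2)[OF p x(2), of "s - h" s] h by (intro mult_left_mono) auto
      also have "\<dots> = (1 / h) * (\<integral>r. indicator {s - h..s} r * ?F r \<partial>lborel)"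
        using h by (simp add: powr_divide powr_diff)
      finally have "norm (backward_mean h f (x, s)) powr p \<le> (\<integral>r. (1 / h) * (indicator {s - h..s} r * ?F r) \<partial>lborel)"
        by simp
      then have "ennreal (norm (backward_mean h f (x, s)) powr p)
          \<le> (\<integral>\<^sup>+r. ennreal ((1 / h) * (indicator {s - h..s} r * ?F r)) \<partial>lborel)"
        using h iF[of s] by (subst nn_integral_eq_integral) (auto intro!: ennreal_leI)
      also have "\<dots> = (\<integral>\<^sup>+r. ennreal (1 / h) * (indicator {s - h..s} r * ennreal (?F r)) \<partial>lborel)"
        using h by (intro nn_integral_cong) (auto simp: indicator_def simp flip: ennreal_mult)
      finally show ?thesis .
    qed
    have [measurable]: "(\<lambda>w. ennreal (1 / h) * ((if fst w - h \<le> snd w \<and> snd w \<le> fst w then 1 else 0) * ennreal (?F (snd w))))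
        \<in> borel_measurable (lborel \<Otimes>\<^sub>M lborel)" by measurable
    have ind: "(if s - h \<le> r \<and> r \<le> s then 1 else 0) = (indicator {s - h..s} r :: ennreal)"
       "(if s - h \<le> r \<and> r \<le> s then 1 else 0) = (indicator {r..r + h} s :: ennreal)" for s r
      by (auto simp: indicator_def)
    have "(\<integral>\<^sup>+s. ennreal (norm (backward_mean h f (x, s)) powr p) \<partial>lborel)
        \<le> (\<integral>\<^sup>+s. (\<integral>\<^sup>+r. ennreal (1 / h) * ((if s - h \<le> r \<and> r \<le> s then 1 else 0) * ennreal (?F r)) \<partial>lborel) \<partial>lborel)"
      unfolding ind(1) by (intro nn_integral_mono pt)
    also have "\<dots> = (\<integral>\<^sup>+r. (\<integral>\<^sup>+s. ennreal (1 / h) * ((if s - h \<le> r \<and> r \<le> s then 1 else 0) * ennreal (?F r)) \<partial>lborel) \<partial>lborel)"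
      by (rule lborel_pair.Fubini') (simp add: case_prod_beta')
    also have "\<dots> = (\<integral>\<^sup>+r. ennreal (?F r) \<partial>lborel)"
    proof (rule nn_integral_cong)
      fix r
      have "(\<integral>\<^sup>+s. ennreal (1 / h) * ((if s - h \<le> r \<and> r \<le> s then 1 else 0) * ennreal (?F r)) \<partial>lborel)
          = (\<integral>\<^sup>+s. (ennreal (1 / h) * ennreal (?F r)) * indicator {r..r + h} s \<partial>lborel)"
        unfolding ind(2) by (intro nn_integral_cong) (simp add: ac_simps)
      also have "\<dots> = (ennreal (1 / h) * ennreal (?F r)) * ennreal h"
        using h by (subst nn_integral_cmult_indicator) auto
      also have "\<dots> = ennreal (?F r)" using h by (simp flip: ennreal_mult)
      finally show "(\<integral>\<^sup>+s. ennreal (1 / h) * ((if s - h \<le> r \<and> r \<le> s then 1 else 0) * ennreal (?F r)) \<partial>lborel) = ennreal (?F r)" .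
    qed
    finally show ?thesis .
  qed
  have "(\<integral>\<^sup>+z. ennreal (norm (backward_mean h f z) powr p) \<partial>(M \<Otimes>\<^sub>M lborel))
      = (\<integral>\<^sup>+x. (\<integral>\<^sup>+s. ennreal (norm (backward_mean h f (x, s)) powr p) \<partial>lborel) \<partial>M)"
    by (rule lborel.nn_integral_fst[symmetric]) measurable
  also have "\<dots> \<le> (\<integral>\<^sup>+x. (\<integral>\<^sup>+s. ennreal (norm (f (x, s)) powr p) \<partial>lborel) \<partial>M)"
  proof (rule nn_integral_mono_AE)
    show "AE x in M. (\<integral>\<^sup>+s. ennreal (norm (backward_mean h f (x, s)) powr p) \<partial>lborel)
        \<le> (\<integral>\<^sup>+s. ennreal (norm (f (x, s)) powr p) \<partial>lborel)"
      using AE_Lp_on_fst[OF f] AE_space by eventually_elim (rule le)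
  qed
  also have "\<dots> = (\<integral>\<^sup>+z. ennreal (norm (f z) powr p) \<partial>(M \<Otimes>\<^sub>M lborel))"
    by (rule lborel.nn_integral_fst) measurable
  also have "\<dots> = ennreal (Lp_int p (M \<Otimes>\<^sub>M lborel) f)"
    using Lp_on_integrable[OF f] by (simp add: nn_integral_eq_integral Lp_int_def)
  finally have *: "(\<integral>\<^sup>+z. ennreal (norm (backward_mean h f z) powr p) \<partial>(M \<Otimes>\<^sub>M lborel)) \<le> ennreal (Lp_int p (M \<Otimes>\<^sub>M lborel) f)" .
  then have i: "integrable (M \<Otimes>\<^sub>M lborel) (\<lambda>z. norm (backward_mean h f z) powr p)"
    by (intro integrableI_bounded) (auto simp: order.strict_trans1[OF _ ennreal_less_top])
  then show "Lp_on p (M \<Otimes>\<^sub>M lborel) (backward_mean h f)" by (intro Lp_onI) measurable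
  show "Lp_int p (M \<Otimes>\<^sub>M lborel) (backward_mean h f) \<le> Lp_int p (M \<Otimes>\<^sub>M lborel) f"
    using * i by (simp add: nn_integral_eq_integral Lp_int_def[of _ _ "backward_mean h f"])
qed

text \<open>
  Convergence holds on almost every line \<open>{x} \<times> \<real>\<close>. Phrasing it by a limes superior makes it a measurable
  property of the pair, so that Fubini's theorem applies.
\<close>

lemma AE_backward_mean_tendsto:
  assumes p: "1 < p" and f: "Lp_on p (M \<Otimes>\<^sub>M lborel) f"
    and h: "h \<longlonglongrightarrow> 0" "\<And>k. 0 < h k"
  shows "AE z in M \<Otimes>\<^sub>M lborel. (\<lambda>k. backward_mean (h k) f z) \<longlonglongrightarrow> f z"
proof -
  interpret pair: pair_sigma_finite M lborel by (rule pair_sigma_finite_lborel)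
  note [measurable] = Lp_on_measurable[OF f]
  have iff: "((\<lambda>k. backward_mean (h k) f z) \<longlonglongrightarrow> f z)
      \<longleftrightarrow> limsup (\<lambda>k. ennreal (norm (backward_mean (h k) f z - f z))) = 0" for z
  proof
    assume "(\<lambda>k. backward_mean (h k) f z) \<longlonglongrightarrow> f z"
    then have "(\<lambda>k. ennreal (norm (backward_mean (h k) f z - f z))) \<longlonglongrightarrow> ennreal 0"
      by (intro tendsto_ennrealI) (simp add: LIM_zero_iff tendsto_norm_zero_iff)
    then show "limsup (\<lambda>k. ennreal (norm (backward_mean (h k) f z - f z))) = 0"
      by (simp add: lim_imp_Limsup)
  next
    assume "limsup (\<lambda>k. ennreal (norm (backward_mean (h k) f z - f z))) = 0"
    then have "(\<lambda>k. ennreal (norm (backward_mean (h k) f z - f z))) \<longlonglongrightarrow> ennreal 0"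
      using tendsto_0_if_Limsup_eq_0_ennreal by simp
    then have "(\<lambda>k. norm (backward_mean (h k) f z - f z)) \<longlonglongrightarrow> 0"
      by (rule tendsto_ennrealD) auto
    then show "(\<lambda>k. backward_mean (h k) f z) \<longlonglongrightarrow> f z"
      by (simp add: LIM_zero_iff tendsto_norm_zero_iff)
  qed
  have "AE x in M. AE s in lborel. (\<lambda>k. backward_mean (h k) f (x, s)) \<longlonglongrightarrow> f (x, s)"
    using AE_Lp_on_fst[OF f]
  proof eventually_elim
    case (elim x)
    have "integrable lborel (\<lambda>r. indicator {c..d} r *\<^sub>R f (x, r))" for c d
      using Lp_interval_Jensen(1)[OF p elim, of c d] by (cases "c \<le> d") auto
    then show ?case
      unfolding backward_mean_def using backward_average_tendsto[of "\<lambda>r. f (x, r)" h] h by simp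
  qed
  then have "AE x in M. AE s in lborel. limsup (\<lambda>k. ennreal (norm (backward_mean (h k) f (x, s) - f (x, s)))) = 0"
    unfolding iff .
  then have "AE z in M \<Otimes>\<^sub>M lborel. limsup (\<lambda>k. ennreal (norm (backward_mean (h k) f z - f z))) = 0"
    by (intro pair.AE_pair_measure) measurable
  then show ?thesis unfolding iff .
qed

end

section \<open>Curves with an integrable velocity\<close>

lemma AE_lborel_shift:
  fixes c :: real
  assumes "AE s in lborel. P s" shows "AE s in lborel. P (s - c)"
proof -
  have "AE s in distr lborel borel ((+) (- c)). P s" using assms unfolding lborel_distr_plus .
  then have "AE s in lborel. P (- c + s)" by (rule AE_distrD[rotated]) simp
  then show ?thesis by simp
qed

text \<open>
  Strong convergence of the backward averages is not available; Fatou's lemma replaces it. The function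
  \<open>|f|\<^sup>p + |q|\<^sup>p + J(f) \<cdot> q\<close> is nonnegative by Young's inequality, it tends to \<open>3 |f|\<^sup>p\<close> when \<open>q\<close> is the backward average,
  and the first two terms contribute at most \<open>2 |f|\<^sup>p\<close> to the integral. The third must make up for the rest.
\<close>

lemma (in sigma_finite_measure) flux_backward_mean_liminf:
  assumes p: "1 < p" and f: "Lp_on p (M \<Otimes>\<^sub>M lborel) f"
    and h: "h \<longlonglongrightarrow> 0" "\<And>k. 0 < h k"
    and I [measurable]: "\<And>k. I k \<in> sets borel"
    and supp: "AE z in M \<Otimes>\<^sub>M lborel. f z \<noteq> 0 \<longrightarrow> (\<forall>\<^sub>F k in sequentially. snd z \<in> I k)"
    and e: "0 < e"
  shows "\<forall>\<^sub>F k in sequentially. Lp_int p (M \<Otimes>\<^sub>M lborel) f - e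
    \<le> (\<integral>z. indicator (I k) (snd z) * (flux p (f z) \<bullet> backward_mean (h k) f z) \<partial>(M \<Otimes>\<^sub>M lborel))"
proof -
  let ?N = "M \<Otimes>\<^sub>M lborel" and ?X = "Lp_int p (M \<Otimes>\<^sub>M lborel) f"
  let ?q = "\<lambda>k. backward_mean (h k) f"
  let ?g = "\<lambda>k z. indicator (I k) (snd z) * (flux p (f z) \<bullet> ?q k z)"
  define u where "u k z = norm (f z) powr p + norm (?q k z) powr p + ?g k z" for k z
  note [measurable] = Lp_on_measurable[OF f]
  note q = Lp_backward_mean[OF p f h(2)]
  have gi: "integrable ?N (?g k)" for k
  proof -
    have "integrable ?N (\<lambda>z. indicator (space M \<times> I k) z *\<^sub>R (flux p (f z) \<bullet> ?q k z))"
      by (intro integrable_mult_indicator integrable_flux_inner p f q) measurable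
    then show ?thesis
      by (rule Bochner_Integration.integrable_cong[THEN iffD1, rotated -1])
         (auto simp: indicator_def space_pair_measure)
  qed
  have u_int: "integrable ?N (u k)" for k
    unfolding u_def using f[THEN Lp_on_integrable] q(1)[THEN Lp_on_integrable] gi by auto
  have u_nn: "0 \<le> u k z" for k z
    using order_trans[OF inner_flux_le[of p "f z" "?q k z"] powr_mult_le_sum[OF p, of "norm (f z)" "norm (?q k z)"]]
    by (auto simp: u_def indicator_def)
  have int_u: "(\<integral>z. u k z \<partial>?N) \<le> 2 * ?X + (\<integral>z. ?g k z \<partial>?N)" for k
    unfolding u_def using f[THEN Lp_on_integrable] q(1)[THEN Lp_on_integrable, of k] gi[of k] q(2)[of k]
    by (simp add: Lp_int_def)
  have "AE z in ?N. (\<lambda>k. u k z) \<longlonglongrightarrow> 3 * norm (f z) powr p"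
    using AE_backward_mean_tendsto[OF p f h] supp
  proof eventually_elim
    case (elim z)
    have 1: "(\<lambda>k. norm (?q k z) powr p) \<longlonglongrightarrow> norm (f z) powr p"
      by (rule tendsto_powr'[OF tendsto_norm[OF elim(1)] tendsto_const]) (use p in auto)
    have 2: "(\<lambda>k. flux p (f z) \<bullet> ?q k z) \<longlonglongrightarrow> norm (f z) powr p"
      using tendsto_inner[OF tendsto_const elim(1), of "flux p (f z)"] by (simp add: inner_flux_self)
    have "(\<lambda>k. ?g k z) \<longlonglongrightarrow> norm (f z) powr p"
    proof (cases "f z = 0")
      case True then show ?thesis by (simp add: flux_def)
    next
      case False
      then have "\<forall>\<^sub>F k in sequentially. snd z \<in> I k" using elim(2) by simp
      then have "\<forall>\<^sub>F k in sequentially. flux p (f z) \<bullet> ?q k z = ?g k z"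
        by eventually_elim simp
      then show ?thesis by (rule Lim_transform_eventually[OF 2])
    qed
    from tendsto_add[OF tendsto_add[OF tendsto_const 1, of "norm (f z) powr p"] this] show ?case
      by (simp add: u_def[abs_def])
  qed
  then have ae: "AE z in ?N. ennreal (3 * norm (f z) powr p) = liminf (\<lambda>k. ennreal (u k z))"
  proof eventually_elim
    case (elim z)
    then have "(\<lambda>k. ennreal (u k z)) \<longlonglongrightarrow> ennreal (3 * norm (f z) powr p)" by (rule tendsto_ennrealI)
    then show ?case using lim_imp_Liminf[OF sequentially_bot] by metis
  qed
  have "ennreal (3 * ?X) = (\<integral>\<^sup>+z. ennreal (3 * norm (f z) powr p) \<partial>?N)"
    using f[THEN Lp_on_integrable] by (subst nn_integral_eq_integral) (auto simp: Lp_int_def)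
  also have "\<dots> = (\<integral>\<^sup>+z. liminf (\<lambda>k. ennreal (u k z)) \<partial>?N)" by (rule nn_integral_cong_AE[OF ae])
  also have "\<dots> \<le> liminf (\<lambda>k. \<integral>\<^sup>+z. ennreal (u k z) \<partial>?N)"
    by (intro nn_integral_liminf measurable_compose[OF _ measurable_ennreal] borel_measurable_integrable u_int)
  also have "\<dots> = liminf (\<lambda>k. ennreal (\<integral>z. u k z \<partial>?N))"
    using u_int u_nn by (simp add: nn_integral_eq_integral)
  finally have lim: "ennreal (3 * ?X) \<le> liminf (\<lambda>k. ennreal (\<integral>z. u k z \<partial>?N))" .
  have "\<forall>\<^sub>F k in sequentially. 3 * ?X - e < 2 * ?X + (\<integral>z. ?g k z \<partial>?N) \<or> 3 * ?X - e < 0"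
  proof (cases "3 * ?X - e < 0")
    case False
    then have "ennreal (3 * ?X - e) < ennreal (3 * ?X)" using e by (intro ennreal_lessI) auto
    then have "ennreal (3 * ?X - e) < liminf (\<lambda>k. ennreal (\<integral>z. u k z \<partial>?N))" using lim by (rule less_le_trans)
    then have "\<forall>\<^sub>F k in sequentially. ennreal (3 * ?X - e) < ennreal (\<integral>z. u k z \<partial>?N)"
      by (rule less_LiminfD)
    then show ?thesis
    proof eventually_elim
      case (elim k)
      then have "3 * ?X - e < (\<integral>z. u k z \<partial>?N)" using False by (simp add: ennreal_less_iff)
      then show ?case using int_u[of k] by linarith
    qed
  qed simp
  then show ?thesis
  proof eventually_elim
    case (elim k)
    have "0 \<le> (\<integral>z. u k z \<partial>?N)" using u_nn by simp
    then show ?case using elim int_u[of k] by linarith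
  qed
qed

text \<open>
  A curve \<open>v\<close> in \<open>L\<^sup>p\<close> with velocity \<open>f\<close>. The velocity is defined for all real times, so that its averages
  need no boundary terms.
\<close>

locale Lp_curve = sigma_finite_measure M
  for M :: "'a measure" +
  fixes p T :: real and f :: "'a \<times> real \<Rightarrow> 'b::euclidean_space" and v :: "real \<Rightarrow> 'a \<Rightarrow> 'b"
  assumes p: "1 < p"
    and f: "Lp_on p (M \<Otimes>\<^sub>M lborel) f"
    and v: "\<And>t. 0 \<le> t \<Longrightarrow> t < T \<Longrightarrow> Lp_on p M (v t)"
    and increment: "\<And>a b. 0 < a \<Longrightarrow> a < b \<Longrightarrow> b < T \<Longrightarrow>
      AE x in M. v b x - v a x = (\<integral>r. indicator {a..b} r *\<^sub>R f (x, r) \<partial>lborel)"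
begin

sublocale pair: pair_sigma_finite M lborel by (rule pair_sigma_finite_lborel)

definition speed :: "real \<Rightarrow> real" where
  "speed t = Lp_int p M (\<lambda>x. f (x, t))"

definition action :: "real \<Rightarrow> real \<Rightarrow> real" where
  "action a b = (\<integral>t. indicator {a..b} t * speed t \<partial>lborel)"

lemma speed_nonneg [simp]: "0 \<le> speed t" by (simp add: speed_def)

lemma speed_integrable: "integrable lborel speed"
  using Lp_int_snd(1)[OF f] by (simp add: speed_def[abs_def])

lemma speed_indicator_integrable: "I \<in> sets borel \<Longrightarrow> integrable lborel (\<lambda>t. indicator I t * speed t)"
  using integrable_mult_indicator[OF _ speed_integrable, of I] by simp

lemma indicator_speed_le_action:
  assumes "I \<in> sets borel" "I \<subseteq> {a..b}"
  shows "(\<integral>t. indicator I t * speed t \<partial>lborel) \<le> action a b"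
  unfolding action_def using assms
  by (intro integral_mono speed_indicator_integrable) (auto simp: indicator_def)

lemma action_nonneg [simp]: "0 \<le> action a b" by (simp add: action_def)

lemma action_mono: "a' \<le> a \<Longrightarrow> b \<le> b' \<Longrightarrow> action a b \<le> action a' b'"
  unfolding action_def[of a b] by (intro indicator_speed_le_action) auto

lemma action_le_total: "action a b \<le> Lp_int p (M \<Otimes>\<^sub>M lborel) f"
proof -
  have "action a b \<le> (\<integral>t. speed t \<partial>lborel)"
    unfolding action_def by (intro integral_mono speed_indicator_integrable speed_integrable) (auto simp: indicator_def)
  then show ?thesis using Lp_int_snd(2)[OF f] by (simp add: speed_def)
qed

lemma action_tendsto:
  assumes a: "\<alpha> \<longlonglongrightarrow> a" and b: "\<beta> \<longlonglongrightarrow> b"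
  shows "(\<lambda>k. action (\<alpha> k) (\<beta> k)) \<longlonglongrightarrow> action a b"
  unfolding action_def
proof (rule integral_dominated_convergence[where w=speed])
  note [measurable] = borel_measurable_integrable[OF speed_integrable]
  show "integrable lborel speed" by (rule speed_integrable)
  show "(\<lambda>t. indicator {a..b} t * speed t) \<in> borel_measurable lborel" by measurable
  show "(\<lambda>t. indicator {\<alpha> k..\<beta> k} t * speed t) \<in> borel_measurable lborel" for k by measurable
  show "AE t in lborel. norm (indicator {\<alpha> k..\<beta> k} t * speed t) \<le> speed t" for k
    by (simp add: indicator_def)
  have "AE t in lborel. t \<noteq> a" "AE t in lborel. t \<noteq> b"
    by (simp_all add: AE_lborel_singleton)
  then show "AE t in lborel. (\<lambda>k. indicator {\<alpha> k..\<beta> k} t * speed t) \<longlonglongrightarrow> indicator {a..b} t * speed t"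
  proof eventually_elim
    case (elim t)
    have "\<forall>\<^sub>F k in sequentially. (\<alpha> k \<le> t \<longleftrightarrow> a \<le> t)"
    proof (cases "a < t")
      case True
      show ?thesis using order_tendstoD(2)[OF a True] by (rule eventually_mono) (use True in auto)
    next
      case False
      then have lt: "t < a" using elim by simp
      show ?thesis using order_tendstoD(1)[OF a lt] by (rule eventually_mono) (use lt in auto)
    qed
    moreover have "\<forall>\<^sub>F k in sequentially. (t \<le> \<beta> k \<longleftrightarrow> t \<le> b)"
    proof (cases "b < t")
      case True
      show ?thesis using order_tendstoD(2)[OF b True] by (rule eventually_mono) (use True in auto)
    next
      case False
      then have lt: "t < b" using elim by simp
      show ?thesis using order_tendstoD(1)[OF b lt] by (rule eventually_mono) (use lt in auto)
    qed
    ultimately have "\<forall>\<^sub>F k in sequentially. indicator {a..b} t * speed t = indicator {\<alpha> k..\<beta> k} t * speed t"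
      by eventually_elim (simp add: indicator_def)
    then show ?case by (rule Lim_transform_eventually[OF tendsto_const])
  qed
qed

lemma action_self [simp]: "action a a = 0"
proof -
  have "action a a = (\<integral>t. 0 \<partial>(lborel :: real measure))" unfolding action_def
  proof (rule integral_cong_AE)
    show "AE t in lborel. indicator {a..a} t * speed t = 0"
      using AE_lborel_singleton[of a] by eventually_elim simp
    show "(\<lambda>t. indicator {a..a} t * speed t) \<in> borel_measurable lborel"
      by (rule borel_measurable_integrable[OF speed_indicator_integrable]) simp
  qed simp
  then show ?thesis by simp
qed

lemma Lp_int_increment:
  assumes "0 < a" "a \<le> b" "b < T"
  shows "Lp_int p M (\<lambda>x. v b x - v a x) \<le> (b - a) powr (p - 1) * action a b"
proof (cases "a = b")
  case True then show ?thesis using p by (simp add: Lp_int_def)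
next
  case False
  then have ab: "a < b" using assms by simp
  have d: "Lp_on p M (\<lambda>x. v b x - v a x)" using assms p v by (intro Lp_on_diff) auto
  have sl: "Lp_on p (M \<Otimes>\<^sub>M lborel) (\<lambda>z. indicator {a..b} (snd z) *\<^sub>R f z)"
    by (intro Lp_on_slab f) simp
  have n: "(indicator {a..b} r * norm y) powr p = indicator {a..b} r * norm y powr p" for r and y :: 'b
    by (simp add: indicator_def)
  have i: "integrable (M \<Otimes>\<^sub>M lborel) (case_prod (\<lambda>x r. indicator {a..b} r * norm (f (x, r)) powr p))"
    using Lp_on_integrable[OF sl] n by (simp add: case_prod_beta')
  have action: "(\<integral>x. (\<integral>r. indicator {a..b} r * norm (f (x, r)) powr p \<partial>lborel) \<partial>M) = action a b"
    using pair.integral_fst[OF i] Lp_int_slab[OF f, of "{a..b}"] n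
    by (simp add: action_def speed_def Lp_int_def case_prod_beta')
  have "Lp_int p M (\<lambda>x. v b x - v a x)
      \<le> (\<integral>x. (b - a) powr (p - 1) * (\<integral>r. indicator {a..b} r * norm (f (x, r)) powr p \<partial>lborel) \<partial>M)"
    unfolding Lp_int_def
  proof (rule integral_mono_AE)
    show "integrable M (\<lambda>x. norm (v b x - v a x) powr p)" by (rule Lp_on_integrable[OF d])
    show "integrable M (\<lambda>x. (b - a) powr (p - 1) * (\<integral>r. indicator {a..b} r * norm (f (x, r)) powr p \<partial>lborel))"
      using pair.integrable_fst[OF i] by simp
    show "AE x in M. norm (v b x - v a x) powr p
        \<le> (b - a) powr (p - 1) * (\<integral>r. indicator {a..b} r * norm (f (x, r)) powr p \<partial>lborel)"
      using increment[OF assms(1) ab assms(3)] AE_Lp_on_fst[OF f]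
    proof eventually_elim
      case (elim x)
      show ?case unfolding elim(1) using Lp_interval_Jensen(2)[OF p elim(2) assms(2)] .
    qed
  qed
  then show ?thesis using action by simp
qed

lemma Lp_int_increment_le:
  assumes "0 < a" "a \<le> s" "s \<le> t" "t \<le> a + h" "t < T"
  shows "Lp_int p M (\<lambda>x. v t x - v s x) \<le> h powr (p - 1) * action a (a + h)"
proof -
  have "Lp_int p M (\<lambda>x. v t x - v s x) \<le> (t - s) powr (p - 1) * action s t"
    using assms by (intro Lp_int_increment) auto
  also have "\<dots> \<le> h powr (p - 1) * action a (a + h)"
    using assms p by (intro mult_mono powr_mono2 action_mono) auto
  finally show ?thesis .
qed

text \<open>
  The subgradient inequality at \<open>v(a)\<close> bounds the loss by the pairing of \<open>|v(a)|\<^sup>p\<^sup>-\<^sup>1\<close> with the velocity, to which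
  Hoelder's inequality is applied at each time.
\<close>

lemma Lp_int_v_decrease:
  assumes ab: "0 < a" "a < b" "b < T"
  shows "Lp_int p M (v a) - Lp_int p M (v b)
    \<le> p * Lp_int p M (v a) powr (1 - 1 / p) * (\<integral>t. indicator {a..b} t * speed t powr (1 / p) \<partial>lborel)"
proof -
  let ?n = "Lp_int p M (v a) powr (1 - 1 / p)"
  have va: "Lp_on p M (v a)" and vb: "Lp_on p M (v b)" using v ab by auto
  note [measurable] = Lp_on_measurable[OF f] Lp_on_measurable[OF va] borel_measurable_integrable[OF speed_integrable]
  let ?w = "\<lambda>z. indicator {a..b} (snd z) *\<^sub>R v a (fst z)"
  have w: "Lp_on p (M \<Otimes>\<^sub>M lborel) ?w"
  proof
    show "?w \<in> borel_measurable (M \<Otimes>\<^sub>M lborel)" by measurable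
    have w: "norm (?w (x, t)) powr p = norm (v a x) powr p * indicator {a..b} t" for x t
      by (simp add: indicator_def)
    have ind: "integrable lborel (indicator {a..b} :: real \<Rightarrow> real)"
      by (intro integrable_real_indicator) (auto simp: emeasure_lborel_Icc_eq)
    show "integrable (M \<Otimes>\<^sub>M lborel) (\<lambda>z. norm (?w z) powr p)"
    proof (rule pair.Fubini_integrable)
      show "integrable M (\<lambda>x. \<integral>t. norm (norm (?w (x, t)) powr p) \<partial>lborel)"
        unfolding real_norm_def abs_of_nonneg[OF powr_ge_zero] w using Lp_on_integrable[OF va] by simp
      show "AE x in M. integrable lborel (\<lambda>t. norm (?w (x, t)) powr p)"
        unfolding w using ind by simp
    qed measurable
  qed
  have "(indicator {a..b} t * r) powr (p - 1) = indicator {a..b} t * r powr (p - 1)" for t r :: real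
    by (simp add: indicator_def)
  then have i: "integrable (M \<Otimes>\<^sub>M lborel) (case_prod (\<lambda>x t. norm (v a x) powr (p - 1) * (indicator {a..b} t * norm (f (x, t)))))"
    using integrable_powr_mult[OF p w f] by (simp add: case_prod_beta' ac_simps)
  have neg: "- (\<integral>x. flux p (v a x) \<bullet> (v b x - v a x) \<partial>M)
      \<le> (\<integral>x. (\<integral>t. norm (v a x) powr (p - 1) * (indicator {a..b} t * norm (f (x, t))) \<partial>lborel) \<partial>M)"
    unfolding Bochner_Integration.integral_minus[symmetric]
  proof (rule integral_mono_AE)
    show "integrable M (\<lambda>x. - (flux p (v a x) \<bullet> (v b x - v a x)))"
      using p va vb by (intro Bochner_Integration.integrable_minus integrable_flux_inner Lp_on_diff) auto
    show "integrable M (\<lambda>x. \<integral>t. norm (v a x) powr (p - 1) * (indicator {a..b} t * norm (f (x, t))) \<partial>lborel)"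
      by (rule pair.integrable_fst[OF i])
    show "AE x in M. - (flux p (v a x) \<bullet> (v b x - v a x))
        \<le> (\<integral>t. norm (v a x) powr (p - 1) * (indicator {a..b} t * norm (f (x, t))) \<partial>lborel)"
      using increment[OF ab]
    proof eventually_elim
      case (elim x)
      have "- (flux p (v a x) \<bullet> (v b x - v a x)) \<le> norm (v a x) powr (p - 1) * norm (v b x - v a x)"
        using inner_flux_le[of p "v a x" "v b x - v a x"] by linarith
      also have "\<dots> \<le> norm (v a x) powr (p - 1) * (\<integral>t. norm (indicator {a..b} t *\<^sub>R f (x, t)) \<partial>lborel)"
        unfolding elim by (intro mult_left_mono Bochner_Integration.integral_norm_bound) simp
      finally show ?case by simp
    qed
  qed
  also have "(\<integral>x. (\<integral>t. norm (v a x) powr (p - 1) * (indicator {a..b} t * norm (f (x, t))) \<partial>lborel) \<partial>M)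
      = (\<integral>t. (\<integral>x. norm (v a x) powr (p - 1) * (indicator {a..b} t * norm (f (x, t))) \<partial>M) \<partial>lborel)"
    by (rule pair.Fubini_integral[OF i, symmetric])
  also have "\<dots> \<le> (\<integral>t. ?n * (indicator {a..b} t * speed t powr (1 / p)) \<partial>lborel)"
  proof (rule integral_mono_AE)
    show "integrable lborel (\<lambda>t. \<integral>x. norm (v a x) powr (p - 1) * (indicator {a..b} t * norm (f (x, t))) \<partial>M)"
      by (rule pair.integrable_snd[OF i])
    have "integrable lborel (\<lambda>t. indicator {a..b} t * speed t powr (1 / p))"
    proof (rule Bochner_Integration.integrable_bound)
      show "integrable lborel (\<lambda>t. indicator {a..b} t + speed t)"
        by (intro Bochner_Integration.integrable_add speed_integrable integrable_real_indicator) (auto simp: emeasure_lborel_Icc_eq)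
      have "y powr (1 / p) \<le> 1 + y" if "0 \<le> y" for y
        using powr_mono2[of "1 / p" y "1 + y"] powr_mono[of "1 / p" 1 "1 + y"] that p by simp
      then show "AE t in lborel. norm (indicator {a..b} t * speed t powr (1 / p)) \<le> norm (indicator {a..b} t + speed t)"
        by (intro AE_I2) (auto simp: indicator_def)
    qed measurable
    then show "integrable lborel (\<lambda>t. ?n * (indicator {a..b} t * speed t powr (1 / p)))" by simp
    show "AE t in lborel. (\<integral>x. norm (v a x) powr (p - 1) * (indicator {a..b} t * norm (f (x, t))) \<partial>M)
        \<le> ?n * (indicator {a..b} t * speed t powr (1 / p))"
      using AE_Lp_on_snd[OF f]
      by eventually_elim (use Lp_Holder[OF p va] in \<open>auto simp: indicator_def speed_def\<close>)
  qed
  finally have "- (\<integral>x. flux p (v a x) \<bullet> (v b x - v a x) \<partial>M)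
      \<le> ?n * (\<integral>t. indicator {a..b} t * speed t powr (1 / p) \<partial>lborel)" by simp
  then have "p * - (\<integral>x. flux p (v a x) \<bullet> (v b x - v a x) \<partial>M)
      \<le> p * (?n * (\<integral>t. indicator {a..b} t * speed t powr (1 / p) \<partial>lborel))"
    using p by (intro mult_left_mono) auto
  then show ?thesis using Lp_subgradient[OF p va vb] by (simp add: algebra_simps)
qed

end

section \<open>Energy dissipation along the flow\<close>

text \<open>
  The gradients \<open>G t\<close> are arbitrary functions, tied to the curve by the weak equation at the good times \<open>S\<close>,
  so that the energy argument takes place in \<open>L\<^sup>p\<close> alone.
\<close>

locale Lp_flow = Lp_curve M p T f v
  for M :: "'a measure" and p T and f :: "'a \<times> real \<Rightarrow> 'b::euclidean_space" and v +
  fixes G :: "real \<Rightarrow> 'a \<Rightarrow> 'c::euclidean_space" and S :: "real set" and C :: real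
  assumes S: "S \<subseteq> {0<..<T}" "S \<in> sets borel" "AE t in lborel. 0 < t \<and> t < T \<longrightarrow> t \<in> S"
    and G: "\<And>t. t \<in> S \<Longrightarrow> Lp_on p M (G t)" "\<And>t. t \<in> S \<Longrightarrow> Lp_int p M (G t) \<le> C"
    and fS: "\<And>t. t \<in> S \<Longrightarrow> Lp_on p M (\<lambda>x. f (x, t))"
    and eq: "\<And>s t. s \<in> S \<Longrightarrow> t \<in> S \<Longrightarrow>
      (\<integral>x. flux p (f (x, s)) \<bullet> v t x \<partial>M) + (\<integral>x. flux p (G s x) \<bullet> G t x \<partial>M) = 0"
    and energy_measurable: "(\<lambda>t. indicator S t * Lp_int p M (G t)) \<in> borel_measurable borel"
begin

definition energy :: "real \<Rightarrow> real" where "energy t = Lp_int p M (G t)"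

text \<open>
  Cut off outside the good times, where nothing is known yet, to have a bounded measurable function.
\<close>

definition good_energy :: "real \<Rightarrow> real" where "good_energy t = indicator S t * energy t"

lemma good_energy_eq: "t \<in> S \<Longrightarrow> good_energy t = energy t" by (simp add: good_energy_def)

lemma vS: "t \<in> S \<Longrightarrow> Lp_on p M (v t)" using v S(1) by force

lemma C_nonneg: "t \<in> S \<Longrightarrow> 0 \<le> C" using G(2)[of t] Lp_int_nonneg[of p M "G t"] by linarith

lemma good_energy_integrable: "integrable lborel (\<lambda>t. indicator {a<..b} t * good_energy t)"
proof (rule Bochner_Integration.integrable_bound)
  show "integrable lborel (\<lambda>t. indicator {a<..b} t * C)"
    by (intro Bochner_Integration.integrable_mult_left integrable_real_indicator) (cases "a \<le> b"; simp)+
  have [measurable]: "good_energy \<in> borel_measurable borel" using energy_measurable by (simp add: good_energy_def[abs_def] energy_def)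
  show "(\<lambda>t. indicator {a<..b} t * good_energy t) \<in> borel_measurable lborel" by measurable
  show "AE t in lborel. norm (indicator {a<..b} t * good_energy t) \<le> norm (indicator {a<..b} t * C)"
    using G(2) C_nonneg by (intro AE_I2) (auto simp: indicator_def good_energy_def energy_def)
qed

text \<open>
  The substitute for the chain rule: convexity of the energy at time \<open>s\<close>, with its derivative in the
  direction \<open>v(t) - v(s)\<close> read off from the weak equation.
\<close>

lemma subgradient:
  assumes s: "s \<in> S" and t: "t \<in> S"
  shows "energy s + p * (\<integral>x. flux p (f (x, s)) \<bullet> (v s x - v t x) \<partial>M) \<le> energy t"
    and "(\<integral>x. flux p (f (x, s)) \<bullet> (v s x - v t x) \<partial>M) = (\<integral>x. flux p (G s x) \<bullet> (G t x - G s x) \<partial>M)"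
proof -
  have "(\<integral>x. flux p (f (x, s)) \<bullet> (v s x - v t x) \<partial>M)
      = (\<integral>x. flux p (f (x, s)) \<bullet> v s x \<partial>M) - (\<integral>x. flux p (f (x, s)) \<bullet> v t x \<partial>M)"
    unfolding inner_diff_right
    by (intro Bochner_Integration.integral_diff integrable_flux_inner p fS vS s t)
  also have "\<dots> = (\<integral>x. flux p (G s x) \<bullet> G t x \<partial>M) - (\<integral>x. flux p (G s x) \<bullet> G s x \<partial>M)"
    using eq[OF s s] eq[OF s t] by linarith
  also have "\<dots> = (\<integral>x. flux p (G s x) \<bullet> (G t x - G s x) \<partial>M)"
    unfolding inner_diff_right
    by (intro Bochner_Integration.integral_diff[symmetric] integrable_flux_inner p G s t)
  finally show *: "(\<integral>x. flux p (f (x, s)) \<bullet> (v s x - v t x) \<partial>M)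
      = (\<integral>x. flux p (G s x) \<bullet> (G t x - G s x) \<partial>M)" .
  show "energy s + p * (\<integral>x. flux p (f (x, s)) \<bullet> (v s x - v t x) \<partial>M) \<le> energy t"
    unfolding * energy_def using Lp_subgradient[OF p G(1)[OF s] G(1)[OF t]] .
qed

lemma flux_increment_ge:
  assumes s: "s \<in> S" and t: "t \<in> S" and a: "0 \<le> a" "a \<le> t" "t \<le> s" "s \<le> a + h" and h: "0 < h"
  shows "- (h * speed s + action a (a + h)) \<le> (\<integral>x. flux p (f (x, s)) \<bullet> (v s x - v t x) \<partial>M)"
proof -
  have st: "0 < t" "s < T" using s t S(1) by auto
  have d: "Lp_on p M (\<lambda>x. v s x - v t x)" using p by (intro Lp_on_diff vS s t) auto
  have "- (\<integral>x. flux p (f (x, s)) \<bullet> (v s x - v t x) \<partial>M)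
      = (\<integral>x. - (flux p (f (x, s)) \<bullet> (v s x - v t x)) \<partial>M)" by simp
  also have "\<dots> \<le> (\<integral>x. h * norm (f (x, s)) powr p + h powr (1 - p) * norm (v s x - v t x) powr p \<partial>M)"
  proof (rule integral_mono)
    show "integrable M (\<lambda>x. - (flux p (f (x, s)) \<bullet> (v s x - v t x)))"
      by (intro Bochner_Integration.integrable_minus integrable_flux_inner p fS s d)
    show "integrable M (\<lambda>x. h * norm (f (x, s)) powr p + h powr (1 - p) * norm (v s x - v t x) powr p)"
      using Lp_on_integrable[OF fS[OF s]] Lp_on_integrable[OF d] by simp
    show "- (flux p (f (x, s)) \<bullet> (v s x - v t x)) \<le> h * norm (f (x, s)) powr p + h powr (1 - p) * norm (v s x - v t x) powr p" for x
      using inner_flux_le[of p "f (x, s)" "v s x - v t x"]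
        powr_mult_le_weighted[OF p _ _ h, of "norm (f (x, s))" "norm (v s x - v t x)"] by simp
  qed
  also have "\<dots> = h * speed s + h powr (1 - p) * Lp_int p M (\<lambda>x. v s x - v t x)"
    using Lp_on_integrable[OF fS[OF s]] Lp_on_integrable[OF d] by (simp add: speed_def Lp_int_def)
  also have "\<dots> \<le> h * speed s + h powr (1 - p) * ((s - t) powr (p - 1) * action t s)"
    using st a by (intro add_left_mono mult_left_mono Lp_int_increment) auto
  also have "\<dots> \<le> h * speed s + h powr (1 - p) * (h powr (p - 1) * action a (a + h))"
    using a p h by (intro add_left_mono mult_left_mono mult_mono powr_mono2 action_mono) auto
  also have "h powr (1 - p) * (h powr (p - 1) * action a (a + h)) = action a (a + h)"
    using h by (simp flip: powr_add mult.assoc)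
  finally show ?thesis by linarith
qed

lemma AE_in_S: "AE t in lborel. a \<le> t \<and> t \<le> b \<and> 0 < a \<and> b < T \<longrightarrow> t \<in> S"
  using S(3) by eventually_elim auto

text \<open>
  At a good time \<open>a\<close> the energy is at least its mean over \<open>[a, a + h]\<close>, up to an error that tends to \<open>0\<close>.
\<close>

lemma good_energy_upper_right:
  assumes a: "a \<in> S" and h: "0 < h" "a + h < T"
  shows "(\<integral>t. indicator {a<..a + h} t * good_energy t \<partial>lborel) \<le> h * energy a + 2 * p * h * action a (a + h)"
proof -
  have a0: "0 < a" using a S(1) by auto
  let ?i = "\<lambda>t. indicator {a<..a + h} t :: real"
  have ii: "integrable lborel ?i" by (intro integrable_real_indicator) (use h in auto)
  have "(\<integral>t. ?i t * good_energy t \<partial>lborel) \<le> (\<integral>t. ?i t * (energy a + p * action a (a + h)) + p * h * (?i t * speed t) \<partial>lborel)"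
  proof (rule integral_mono_AE)
    show "integrable lborel (\<lambda>t. ?i t * good_energy t)" by (rule good_energy_integrable)
    show "integrable lborel (\<lambda>t. ?i t * (energy a + p * action a (a + h)) + p * h * (?i t * speed t))"
      using ii speed_indicator_integrable[of "{a<..a + h}"] by simp
    show "AE t in lborel. ?i t * good_energy t \<le> ?i t * (energy a + p * action a (a + h)) + p * h * (?i t * speed t)"
      using AE_in_S[of a "a + h"]
    proof eventually_elim
      case (elim t)
      show ?case
      proof (cases "t \<in> {a<..a + h}")
        case True
        then have t: "t \<in> S" using elim a0 h by auto
        have "- (h * speed t + action a (a + h)) \<le> (\<integral>x. flux p (f (x, t)) \<bullet> (v t x - v a x) \<partial>M)"
          using True h a0 by (intro flux_increment_ge t a) auto
        then have "p * - (h * speed t + action a (a + h)) \<le> p * (\<integral>x. flux p (f (x, t)) \<bullet> (v t x - v a x) \<partial>M)"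
          using p by (intro mult_left_mono) auto
        then have "energy t \<le> energy a + p * (h * speed t + action a (a + h))"
          using subgradient(1)[OF t a] by linarith
        then show ?thesis using True t by (simp add: good_energy_eq algebra_simps)
      qed simp
    qed
  qed
  also have "\<dots> = h * (energy a + p * action a (a + h)) + p * h * (\<integral>t. ?i t * speed t \<partial>lborel)"
    using ii speed_indicator_integrable[of "{a<..a + h}"] h by simp
  also have "\<dots> \<le> h * (energy a + p * action a (a + h)) + p * h * action a (a + h)"
    using p h by (intro add_left_mono mult_left_mono indicator_speed_le_action) auto
  finally show ?thesis by (simp add: algebra_simps)
qed

text \<open>
  Here \<open>b\<close> is the time at which the equation is used, so that the error contains the fixed number
  \<open>speed b\<close>, and the increment of \<open>v\<close> makes it small.
\<close>

lemma good_energy_lower_left: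
  assumes b: "b \<in> S" and h: "0 < h" "h < b"
  shows "h * (energy b - p * (speed b powr (1 - 1 / p) * (h powr (p - 1) * Lp_int p (M \<Otimes>\<^sub>M lborel) f) powr (1 / p)))
    \<le> (\<integral>t. indicator {b - h<..b} t * good_energy t \<partial>lborel)"
proof -
  have bT: "b < T" using b S(1) by auto
  let ?i = "\<lambda>t. indicator {b - h<..b} t :: real"
  let ?c = "energy b - p * (speed b powr (1 - 1 / p) * (h powr (p - 1) * Lp_int p (M \<Otimes>\<^sub>M lborel) f) powr (1 / p))"
  have ii: "integrable lborel ?i" by (intro integrable_real_indicator) (use h in auto)
  have "h * ?c = (\<integral>t. ?i t * ?c \<partial>lborel)" using h by simp
  also have "\<dots> \<le> (\<integral>t. ?i t * good_energy t \<partial>lborel)"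
  proof (rule integral_mono_AE)
    show "integrable lborel (\<lambda>t. ?i t * good_energy t)" by (rule good_energy_integrable)
    show "integrable lborel (\<lambda>t. ?i t * ?c)" using ii by simp
    show "AE t in lborel. ?i t * ?c \<le> ?i t * good_energy t"
      using AE_in_S[of "b - h" b]
    proof eventually_elim
      case (elim t)
      show ?case
      proof (cases "t \<in> {b - h<..b}")
        case True
        then have t: "t \<in> S" using elim bT h by auto
        have d: "Lp_on p M (\<lambda>x. v b x - v t x)" using p by (intro Lp_on_diff vS b t) auto
        have "- (\<integral>x. flux p (f (x, b)) \<bullet> (v b x - v t x) \<partial>M)
            \<le> speed b powr (1 - 1 / p) * Lp_int p M (\<lambda>x. v b x - v t x) powr (1 / p)"
          using Lp_Holder_flux[OF p fS[OF b] d] by (simp add: speed_def)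
        also have "Lp_int p M (\<lambda>x. v b x - v t x) \<le> h powr (p - 1) * action (b - h) (b - h + h)"
          using True h bT by (intro Lp_int_increment_le) auto
        then have "Lp_int p M (\<lambda>x. v b x - v t x) \<le> h powr (p - 1) * Lp_int p (M \<Otimes>\<^sub>M lborel) f"
          using action_le_total[of "b - h" "b - h + h"] by (meson mult_left_mono order_trans powr_ge_zero)
        then have "speed b powr (1 - 1 / p) * Lp_int p M (\<lambda>x. v b x - v t x) powr (1 / p)
            \<le> speed b powr (1 - 1 / p) * (h powr (p - 1) * Lp_int p (M \<Otimes>\<^sub>M lborel) f) powr (1 / p)"
          using p by (intro mult_left_mono powr_mono2) auto
        finally have "p * - (\<integral>x. flux p (f (x, b)) \<bullet> (v b x - v t x) \<partial>M)
            \<le> p * (speed b powr (1 - 1 / p) * (h powr (p - 1) * Lp_int p (M \<Otimes>\<^sub>M lborel) f) powr (1 / p))"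
          using p by (intro mult_left_mono) auto
        then have "?c \<le> energy t" using subgradient(1)[OF b t] by linarith
        then show ?thesis using True t by (simp add: good_energy_eq)
      qed simp
    qed
  qed
  finally show ?thesis .
qed

text \<open>
  Cutting the velocity off outside \<open>[a, b]\<close> does not change its backward averages at times in \<open>[a + h, b]\<close>,
  and lets the bounds over all times apply to \<open>[a, b]\<close>.
\<close>

definition f_slab :: "real \<Rightarrow> real \<Rightarrow> 'a \<times> real \<Rightarrow> 'b" where
  "f_slab a b z = indicator {a..b} (snd z) *\<^sub>R f z"

lemma f_slab: "Lp_on p (M \<Otimes>\<^sub>M lborel) (f_slab a b)"
  unfolding f_slab_def[abs_def] by (intro Lp_on_slab f) simp

lemma Lp_int_f_slab: "Lp_int p (M \<Otimes>\<^sub>M lborel) (f_slab a b) = action a b"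
  unfolding f_slab_def[abs_def] action_def speed_def by (rule Lp_int_slab[OF f, symmetric]) simp

text \<open>
  The subgradient inequality between \<open>t\<close> and \<open>t - h\<close>, integrated over \<open>t\<close>; after a shift of time the energies
  cancel except near the two ends.
\<close>

lemma good_energy_difference:
  assumes a: "a \<in> S" and b: "b \<in> S" and h: "0 < h" "a + h < b"
  shows "p * h * (\<integral>z. indicator {a + h<..b} (snd z) *
        (flux p (f_slab a b z) \<bullet> backward_mean h (f_slab a b) z) \<partial>(M \<Otimes>\<^sub>M lborel))
    \<le> (\<integral>t. indicator {a<..a + h} t * good_energy t \<partial>lborel) - (\<integral>t. indicator {b - h<..b} t * good_energy t \<partial>lborel)"
proof -
  have ab: "0 < a" "b < T" using a b S(1) by auto
  let ?i = "\<lambda>t. indicator {a + h<..b} t :: real"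
  let ?g = "\<lambda>x t. flux p (f_slab a b (x, t)) \<bullet> backward_mean h (f_slab a b) (x, t)"
  have "integrable (M \<Otimes>\<^sub>M lborel) (\<lambda>z. indicator (space M \<times> {a + h<..b}) z *\<^sub>R
      (flux p (f_slab a b z) \<bullet> backward_mean h (f_slab a b) z))"
    by (intro integrable_mult_indicator integrable_flux_inner p f_slab Lp_backward_mean h) measurable
  then have i: "integrable (M \<Otimes>\<^sub>M lborel) (case_prod (\<lambda>x t. ?i t * ?g x t))"
    by (rule Bochner_Integration.integrable_cong[THEN iffD1, rotated -1])
       (auto simp: indicator_def space_pair_measure)
  have shift: "(\<integral>t. ?i t * good_energy (t - h) \<partial>lborel) = (\<integral>t. indicator {a<..b - h} t * good_energy t \<partial>lborel)"
    "integrable lborel (\<lambda>t. ?i t * good_energy (t - h))"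
  proof -
    have e: "indicator {a<..b - h} (t - h) * good_energy (t - h) = ?i t * good_energy (t - h)" for t
      by (auto simp: indicator_def)
    have "integrable lborel (\<lambda>t. indicator {a<..b - h} t * good_energy t)" by (rule good_energy_integrable)
    from lborel_integrable_real_affine[OF this, of 1 "- h"]
    show "integrable lborel (\<lambda>t. ?i t * good_energy (t - h))" by (simp add: e)
    show "(\<integral>t. ?i t * good_energy (t - h) \<partial>lborel) = (\<integral>t. indicator {a<..b - h} t * good_energy t \<partial>lborel)"
      using lborel_integral_real_affine[of 1 "\<lambda>t. indicator {a<..b - h} t * good_energy t" "- h"] by (simp add: e)
  qed
  have pull: "(\<integral>t. B t \<partial>lborel) * c = (\<integral>t. c * B t \<partial>lborel)" for B :: "real \<Rightarrow> real" and c
    by simp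
  have "(\<integral>t. (\<integral>x. ?i t * ?g x t \<partial>M) \<partial>lborel) * (p * h) = (\<integral>t. p * h * (\<integral>x. ?i t * ?g x t \<partial>M) \<partial>lborel)"
    by (rule pull)
  also have "\<dots> \<le> (\<integral>t. ?i t * good_energy (t - h) - ?i t * good_energy t \<partial>lborel)"
  proof (rule integral_mono_AE)
    show "integrable lborel (\<lambda>t. p * h * (\<integral>x. ?i t * ?g x t \<partial>M))"
      using pair.integrable_snd[OF i] by simp
    show "integrable lborel (\<lambda>t. ?i t * good_energy (t - h) - ?i t * good_energy t)"
      by (intro Bochner_Integration.integrable_diff good_energy_integrable shift)
    show "AE t in lborel. p * h * (\<integral>x. ?i t * ?g x t \<partial>M) \<le> ?i t * good_energy (t - h) - ?i t * good_energy t"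
      using AE_in_S[of a b] AE_lborel_shift[OF AE_in_S[of a b], of h]
    proof eventually_elim
      case (elim t)
      show ?case
      proof (cases "t \<in> {a + h<..b}")
        case True
        then have t: "t \<in> S" "t - h \<in> S" using elim ab h by auto
        have "AE x in M. h * ?g x t = flux p (f (x, t)) \<bullet> (v t x - v (t - h) x)"
        proof -
          have "AE x in M. v t x - v (t - h) x = (\<integral>r. indicator {t - h..t} r *\<^sub>R f (x, r) \<partial>lborel)"
            using increment[of "t - h" t] True ab h by auto
          then show ?thesis
          proof eventually_elim
            case (elim x)
            have "indicator {t - h..t} r *\<^sub>R f_slab a b (x, r) = indicator {t - h..t} r *\<^sub>R f (x, r)" for r
              using True by (auto simp: indicator_def f_slab_def)
            then have "(\<integral>r. indicator {t - h..t} r *\<^sub>R f_slab a b (x, r) \<partial>lborel)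
                = (\<integral>r. indicator {t - h..t} r *\<^sub>R f (x, r) \<partial>lborel)"
              by (intro Bochner_Integration.integral_cong refl)
            then have "h *\<^sub>R backward_mean h (f_slab a b) (x, t) = v t x - v (t - h) x"
              using h elim by (simp add: backward_mean_def)
            moreover have "f_slab a b (x, t) = f (x, t)" using True h by (simp add: f_slab_def)
            ultimately show ?case by (metis inner_scaleR_right)
          qed
        qed
        moreover have "integrable M (\<lambda>x. flux p (f (x, t)) \<bullet> (v t x - v (t - h) x))"
          using p by (intro integrable_flux_inner fS Lp_on_diff vS t) auto
        moreover have m: "(\<lambda>x. ?g x t) \<in> borel_measurable M"
          using f_slab[THEN Lp_on_measurable] Lp_backward_mean(1)[OF p f_slab h(1), THEN Lp_on_measurable]
          by measurable
        ultimately have "(\<integral>x. h * ?g x t \<partial>M) = (\<integral>x. flux p (f (x, t)) \<bullet> (v t x - v (t - h) x) \<partial>M)"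
          by (intro integral_cong_AE) auto
        then have "p * h * (\<integral>x. ?g x t \<partial>M) = p * (\<integral>x. flux p (f (x, t)) \<bullet> (v t x - v (t - h) x) \<partial>M)"
          by simp
        also have "\<dots> \<le> energy (t - h) - energy t" using subgradient(1)[OF t] by linarith
        finally show ?thesis using True t by (simp add: good_energy_eq)
      qed simp
    qed
  qed
  also have "\<dots> = (\<integral>t. indicator {a<..b - h} t * good_energy t \<partial>lborel) - (\<integral>t. ?i t * good_energy t \<partial>lborel)"
    by (simp add: shift good_energy_integrable)
  also have "\<dots> = (\<integral>t. indicator {a<..a + h} t * good_energy t \<partial>lborel) - (\<integral>t. indicator {b - h<..b} t * good_energy t \<partial>lborel)"
  proof -
    \<comment> \<open>Half-open intervals fit together without overlapping end points.\<close>
    have split: "(\<integral>t. indicator {a<..c} t * good_energy t \<partial>lborel) + (\<integral>t. indicator {c<..b} t * good_energy t \<partial>lborel)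
        = (\<integral>t. indicator {a<..b} t * good_energy t \<partial>lborel)" if "a \<le> c" "c \<le> b" for c
      unfolding Bochner_Integration.integral_add[OF good_energy_integrable good_energy_integrable, symmetric]
      using that by (intro Bochner_Integration.integral_cong) (auto simp: indicator_def)
    show ?thesis using split[of "a + h"] split[of "b - h"] h by simp
  qed
  also have "(\<integral>t. (\<integral>x. ?i t * ?g x t \<partial>M) \<partial>lborel) = (\<integral>z. indicator {a + h<..b} (snd z) *
        (flux p (f_slab a b z) \<bullet> backward_mean h (f_slab a b) z) \<partial>(M \<Otimes>\<^sub>M lborel))"
    using pair.integral_snd[OF i] by (simp add: case_prod_beta')
  finally show ?thesis by (simp add: ac_simps)
qed

lemma energy_dissipation:
  assumes a: "a \<in> S" and b: "b \<in> S" and ab: "a < b"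
  shows "energy b + p * action a b \<le> energy a"
proof (rule field_le_epsilon)
  fix e :: real assume e: "0 < e"
  have a0: "0 < a" and bT: "b < T" using a b S(1) by auto
  \<comment> \<open>The denominators start at \<open>2\<close> to keep \<open>a + h k\<close> strictly below \<open>b\<close>.\<close>
  define h where "h k = (b - a) / real (k + 2)" for k
  have h: "0 < h k" "a + h k < b" "a + h k < T" "h k < b" for k
  proof -
    show "0 < h k" using ab by (simp add: h_def)
    have "(b - a) / real (k + 2) < (b - a) / 1" using ab by (intro divide_strict_left_mono) auto
    then have "h k < b - a" by (simp add: h_def)
    then show "a + h k < b" "a + h k < T" "h k < b" using a0 bT by auto
  qed
  have h0: "h \<longlonglongrightarrow> 0" unfolding h_def
    by (rule tendsto_divide_0[OF tendsto_const]) (rule filterlim_at_top_imp_at_infinity,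
      rule filterlim_compose[OF filterlim_real_sequentially filterlim_add_const_nat_at_top])
  let ?R = "\<lambda>k. \<integral>z. indicator {a + h k<..b} (snd z) *
        (flux p (f_slab a b z) \<bullet> backward_mean (h k) (f_slab a b) z) \<partial>(M \<Otimes>\<^sub>M lborel)"
  let ?X = "Lp_int p (M \<Otimes>\<^sub>M lborel) f"
  let ?err = "\<lambda>k. p * (speed b powr (1 - 1 / p) * (h k powr (p - 1) * ?X) powr (1 / p))"
  have le: "p * ?R k \<le> energy a - energy b + 2 * p * action a (a + h k) + ?err k" for k
  proof -
    have "h k * (p * ?R k) \<le> h k * (energy a - energy b + 2 * p * action a (a + h k) + ?err k)"
      using good_energy_difference[OF a b h(1,2), of k] good_energy_upper_right[OF a h(1,3), of k] good_energy_lower_left[OF b h(1,4), of k]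
      by (simp add: algebra_simps)
    then show ?thesis using h(1)[of k] by simp
  qed
  have "AE z in M \<Otimes>\<^sub>M lborel. snd z \<noteq> a"
  proof (rule pair.AE_pair_measure)
    show "{z \<in> space (M \<Otimes>\<^sub>M lborel). snd z \<noteq> a} \<in> sets (M \<Otimes>\<^sub>M lborel)" by measurable
    show "AE x in M. AE t in lborel. snd (x, t) \<noteq> a" using AE_lborel_singleton[of a] by simp
  qed
  then have supp: "AE z in M \<Otimes>\<^sub>M lborel. f_slab a b z \<noteq> 0 \<longrightarrow> (\<forall>\<^sub>F k in sequentially. snd z \<in> {a + h k<..b})"
  proof eventually_elim
    case (elim z)
    show ?case
    proof
      assume "f_slab a b z \<noteq> 0"
      then have z: "0 < snd z - a" "snd z \<le> b" using elim by (auto simp: f_slab_def indicator_def split: if_splits)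
      show "\<forall>\<^sub>F k in sequentially. snd z \<in> {a + h k<..b}"
        using order_tendstoD(2)[OF h0 z(1)] by (rule eventually_mono) (use z in auto)
    qed
  qed
  have "e / (2 * p) > 0" using e p by simp
  from flux_backward_mean_liminf[OF p f_slab h0 h(1) _ supp this]
  have ev: "\<forall>\<^sub>F k in sequentially. action a b - e / (2 * p) \<le> ?R k" by (simp add: Lp_int_f_slab)
  have "(\<lambda>k. action a (a + h k)) \<longlonglongrightarrow> action a (a + 0)" by (intro action_tendsto tendsto_add tendsto_const h0)
  moreover have "(\<lambda>k. (h k powr (p - 1) * ?X) powr (1 / p)) \<longlonglongrightarrow> (0 powr (p - 1) * ?X) powr (1 / p)"
    using p h(1) by (intro tendsto_powr' tendsto_mult tendsto_const h0) (auto simp: less_imp_le intro!: always_eventually mult_nonneg_nonneg)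
  ultimately have "(\<lambda>k. energy a - energy b + 2 * p * action a (a + h k) + ?err k)
      \<longlonglongrightarrow> energy a - energy b + 2 * p * action a (a + 0) + p * (speed b powr (1 - 1 / p) * (0 powr (p - 1) * ?X) powr (1 / p))"
    by (intro tendsto_add tendsto_mult tendsto_const)
  then have lim: "(\<lambda>k. energy a - energy b + 2 * p * action a (a + h k) + ?err k) \<longlonglongrightarrow> energy a - energy b" by simp
  have "p * (action a b - e / (2 * p)) \<le> energy a - energy b"
  proof (rule tendsto_lowerbound[OF lim _ sequentially_bot])
    show "\<forall>\<^sub>F k in sequentially. p * (action a b - e / (2 * p)) \<le> energy a - energy b + 2 * p * action a (a + h k) + ?err k"
      using ev
    proof eventually_elim
      case (elim k)
      then have "p * (action a b - e / (2 * p)) \<le> p * ?R k" using p by (intro mult_left_mono) auto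
      then show ?case using le[of k] by linarith
    qed
  qed
  moreover have "p * (action a b - e / (2 * p)) = p * action a b - e / 2" using p by (simp add: algebra_simps)
  ultimately show "energy b + p * action a b \<le> energy a + e" using e by linarith
qed

lemma energy_antimono: "a \<in> S \<Longrightarrow> b \<in> S \<Longrightarrow> a \<le> b \<Longrightarrow> energy b \<le> energy a"
  using energy_dissipation[of a b] p by (cases "a = b") (auto intro: order_trans[rotated])

lemma energy_le_rate:
  assumes t: "t \<in> S"
  shows "energy t \<le> speed t powr (1 - 1 / p) * Lp_int p M (v t) powr (1 / p)"
proof -
  have "energy t = - (\<integral>x. flux p (f (x, t)) \<bullet> v t x \<partial>M)"
    using eq[OF t t] unfolding integral_flux_self[OF p] energy_def by linarith
  then show ?thesis using Lp_Holder_flux[OF p fS[OF t] vS[OF t]] by (simp add: speed_def)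
qed

text \<open>
  Otherwise the speed would exceed its mean value throughout the interval.
\<close>

lemma good_time_small_rate:
  assumes a: "0 \<le> a" and h: "0 < h" "a + h < T"
  obtains s where "s \<in> S" "a < s" "s < a + h" "h * speed s \<le> 2 * action a (a + h) + h"
proof -
  have "\<exists>s\<in>S. a < s \<and> s < a + h \<and> h * speed s \<le> 2 * action a (a + h) + h"
  proof (rule ccontr)
    assume no: "\<not> ?thesis"
    let ?c = "(2 * action a (a + h) + h) / h"
    have "2 * action a (a + h) + h = (\<integral>t. indicator {a<..<a + h} t * ?c \<partial>lborel)" using h by simp
    also have "\<dots> \<le> (\<integral>t. indicator {a<..<a + h} t * speed t \<partial>lborel)"
    proof (rule integral_mono_AE)
      show "integrable lborel (\<lambda>t. indicator {a<..<a + h} t * speed t)" by (intro speed_indicator_integrable) simp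
      show "integrable lborel (\<lambda>t. indicator {a<..<a + h} t * ?c)"
        by (intro Bochner_Integration.integrable_mult_left integrable_real_indicator) (use h in auto)
      show "AE t in lborel. indicator {a<..<a + h} t * ?c \<le> indicator {a<..<a + h} t * speed t"
        using S(3)
      proof eventually_elim
        case (elim t)
        show ?case
        proof (cases "t \<in> {a<..<a + h}")
          case True
          then have "\<not> h * speed t \<le> 2 * action a (a + h) + h" using no elim a h by auto
          then have "?c \<le> speed t" using h by (simp add: pos_divide_le_eq mult.commute)
          then show ?thesis using True by simp
        qed simp
      qed
    qed
    also have "\<dots> \<le> action a (a + h)" by (intro indicator_speed_le_action) auto
    finally show False using action_nonneg[of a "a + h"] h by linarith
  qed
  then show thesis using that by blast
qed

text \<open>
  At good times \<open>s\<close> with \<open>(s - a) A(s)\<close> small, the subgradient inequality at \<open>s\<close> for the midpoint of \<open>G(s)\<close> and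
  \<open>G(t)\<close>, with \<open>a < t < s\<close>, says that passing to the midpoint gains almost nothing. The energies at these times
  increase to their supremum as \<open>s\<close> decreases to \<open>a\<close>, so uniform convexity applies.
\<close>

lemma gradient_right_limit:
  assumes a: "0 \<le> a" "a < T"
  obtains s H where "\<And>k. s k \<in> S" "\<And>k. a < s k" "s \<longlonglongrightarrow> a"
    "Lp_on p M H" "(\<lambda>k. Lp_int p M (\<lambda>x. G (s k) x - H x)) \<longlonglongrightarrow> 0"
proof -
  define h where "h k = (T - a) / real (k + 2)" for k
  have h: "0 < h k" "a + h k < T" for k
  proof -
    show "0 < h k" using a by (simp add: h_def)
    have "(T - a) / real (k + 2) < (T - a) / 1" using a by (intro divide_strict_left_mono) auto
    then show "a + h k < T" by (simp add: h_def)
  qed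
  have h0: "h \<longlonglongrightarrow> 0" unfolding h_def
    by (rule tendsto_divide_0[OF tendsto_const]) (rule filterlim_at_top_imp_at_infinity,
      rule filterlim_compose[OF filterlim_real_sequentially filterlim_add_const_nat_at_top])
  have "\<exists>s. s \<in> S \<and> a < s \<and> s < a + h k \<and> h k * speed s \<le> 2 * action a (a + h k) + h k" for k
    using good_time_small_rate[OF a(1) h(1,2)] by metis
  then obtain s where s: "\<And>k. s k \<in> S" "\<And>k. a < s k" "\<And>k. s k < a + h k"
    "\<And>k. h k * speed (s k) \<le> 2 * action a (a + h k) + h k" by metis
  have lim: "s \<longlonglongrightarrow> a"
  proof (rule tendsto_sandwich[OF _ _ tendsto_const])
    show "(\<lambda>k. a + h k) \<longlonglongrightarrow> a" using tendsto_add[OF tendsto_const h0, of a] by simp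
    show "\<forall>\<^sub>F k in sequentially. a \<le> s k" "\<forall>\<^sub>F k in sequentially. s k \<le> a + h k"
      using s(2,3) by (auto intro!: always_eventually less_imp_le)
  qed
  have cauchy: "\<exists>K. \<forall>m\<ge>K. \<forall>n\<ge>K. Lp_int p M (\<lambda>x. G (s m) x - G (s n) x) < e" if e: "0 < e" for e
  proof -
    have C0: "0 \<le> C" by (rule C_nonneg[OF s(1)[of 0]])
    obtain \<delta> where \<delta>: "\<delta> > 0" "\<And>g g' :: 'a \<Rightarrow> 'c. \<lbrakk>Lp_on p M g; Lp_on p M g'; Lp_int p M g \<le> C; Lp_int p M g' \<le> C;
       (Lp_int p M g + Lp_int p M g') / 2 - Lp_int p M (\<lambda>x. (1/2) *\<^sub>R (g x + g' x)) \<le> \<delta>\<rbrakk>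
      \<Longrightarrow> Lp_int p M (\<lambda>x. g x - g' x) < e"
      by (rule Lp_uniformly_convex[OF p e C0]) blast
    define L where "L = (SUP t\<in>S \<inter> {a<..}. energy t)"
    have bdd: "bdd_above (energy ` (S \<inter> {a<..}))" using G(2) by (intro bdd_aboveI[of _ C]) (auto simp: energy_def)
    have ne: "S \<inter> {a<..} \<noteq> {}" using s(1,2)[of 0] by auto
    have "L - \<delta> < L" using \<delta> by simp
    \<comment> \<open>Monotonicity confines the energies at all good times between \<open>a\<close> and \<open>\<sigma>\<close> to an interval of length \<open>\<delta>\<close>.\<close>
    then obtain \<sigma> where \<sigma>: "\<sigma> \<in> S" "a < \<sigma>" "L - \<delta> < energy \<sigma>"
      unfolding L_def using less_cSUP_iff[OF ne bdd] by auto
    have "(\<lambda>k. 3 * action a (a + h k) + h k) \<longlonglongrightarrow> 3 * action a (a + 0) + 0"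
      by (intro tendsto_add tendsto_mult tendsto_const action_tendsto h0)
    then have "\<forall>\<^sub>F k in sequentially. 3 * action a (a + h k) + h k < \<delta> / p"
      using \<delta> p by (intro order_tendstoD(2)) auto
    moreover have "\<forall>\<^sub>F k in sequentially. s k < \<sigma>" by (rule order_tendstoD(2)[OF lim \<sigma>(2)])
    ultimately obtain K where K: "\<And>k. k \<ge> K \<Longrightarrow> 3 * action a (a + h k) + h k < \<delta> / p" "\<And>k. k \<ge> K \<Longrightarrow> s k < \<sigma>"
      unfolding eventually_sequentially by (metis nat_le_linear order_trans)
    have gap: "Lp_int p M (\<lambda>x. G (s m) x - G (s n) x) < e" if mn: "m \<ge> K" "n \<ge> K" "s n \<le> s m" for m n
    proof (rule \<delta>(2)[OF G(1) G(1) G(2) G(2)])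
      show "s m \<in> S" "s n \<in> S" "s m \<in> S" "s n \<in> S" using s by auto
      note GG = G(1)[OF s(1)[of m]] G(1)[OF s(1)[of n]]
      let ?w = "\<lambda>x. (1/2) *\<^sub>R (G (s m) x + G (s n) x)"
      let ?I = "\<integral>x. flux p (f (x, s m)) \<bullet> (v (s m) x - v (s n) x) \<partial>M"
      have w: "Lp_on p M ?w" using p GG by (intro Lp_on_scaleR Lp_on_add) auto
      have "?w x - G (s m) x = (1/2) *\<^sub>R (G (s n) x - G (s m) x)" for x
      proof -
        have cancel: "c + c = y \<Longrightarrow> c + d - y = d - c" for c d y :: 'c by auto
        show ?thesis unfolding scaleR_add_right scaleR_diff_right
          by (rule cancel) (simp flip: scaleR_left_distrib)
      qed
      then have W: "(\<integral>x. flux p (G (s m) x) \<bullet> (?w x - G (s m) x) \<partial>M) = (1/2) * ?I"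
        using subgradient(2)[OF s(1) s(1), of m n] by simp
      have 1: "energy (s m) + (p * ?I) / 2 \<le> Lp_int p M ?w"
        using Lp_subgradient[OF p GG(1) w] unfolding W energy_def by simp
      have "- (h m * speed (s m) + action a (a + h m)) \<le> ?I"
        using s[of m] s[of n] a h[of m] mn by (intro flux_increment_ge) auto
      then have "- (\<delta> / p) \<le> ?I" using s(4)[of m] K(1)[OF mn(1)] by linarith
      then have "p * - (\<delta> / p) \<le> p * ?I" using p by (intro mult_left_mono) auto
      then have 2: "- \<delta> \<le> p * ?I" using p by simp
      have arith: "(x + y) / 2 - w \<le> \<delta>"
        if "x + q / 2 \<le> w" "- \<delta> \<le> q" "y \<le> l" "z \<le> x" "l - \<delta> < z" for x y z w q l
        using that by argo
      have 3: "energy (s n) \<le> L" unfolding L_def using s by (intro cSUP_upper bdd) auto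
      have 4: "energy \<sigma> \<le> energy (s m)" using K(2)[OF mn(1)] s \<sigma> by (intro energy_antimono) auto
      show "(Lp_int p M (G (s m)) + Lp_int p M (G (s n))) / 2 - Lp_int p M ?w \<le> \<delta>"
        by (rule arith[OF 1[unfolded energy_def] 2 3[unfolded energy_def] 4[unfolded energy_def] \<sigma>(3)[unfolded energy_def]])
    qed
    have "Lp_int p M (\<lambda>x. G (s m) x - G (s n) x) < e" if "m \<ge> K" "n \<ge> K" for m n
      using gap[of m n] gap[of n m] that Lp_int_minus_commute[of p M "G (s m)" "G (s n)"] by linarith
    then show ?thesis by blast
  qed
  obtain H where "Lp_on p M H" "(\<lambda>k. Lp_int p M (\<lambda>x. G (s k) x - H x)) \<longlonglongrightarrow> 0"
    by (rule Lp_complete[OF p, where g="\<lambda>k. G (s k)", OF G(1)[OF s(1)] cauchy])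
  then show thesis by (rule that[OF s(1,2) lim])
qed

end

section \<open>Monotonicity of the quotient\<close>

text \<open>
  Induction along an interval: the supremum of the points up to which the property holds belongs to
  them by \<open>left\<close> and cannot be smaller than \<open>b\<close> by \<open>right\<close>.
\<close>

lemma real_right_induct:
  fixes P :: "real \<Rightarrow> bool"
  assumes ab: "a \<le> b" and base: "P a"
    and left: "\<And>t. a < t \<Longrightarrow> t \<le> b \<Longrightarrow> (\<And>s. a \<le> s \<Longrightarrow> s < t \<Longrightarrow> P s) \<Longrightarrow> P t"
    and right: "\<And>t. a \<le> t \<Longrightarrow> t < b \<Longrightarrow> P t \<Longrightarrow> \<forall>\<^sub>F s in at_right t. P s"
  shows "P b"
proof -
  define X where "X = {t \<in> {a..b}. \<forall>s\<in>{a..t}. P s}"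
  have aX: "a \<in> X" using ab base by (auto simp: X_def)
  have bdd: "bdd_above X" by (auto simp: X_def bdd_above_def)
  define c where "c = Sup X"
  have "a \<le> c" unfolding c_def by (rule cSup_upper[OF aX bdd])
  moreover have "c \<le> b" unfolding c_def
  proof (rule cSup_least)
    show "X \<noteq> {}" using aX by blast
  qed (simp add: X_def)
  ultimately have c: "a \<le> c" "c \<le> b" .
  have below: "P s" if "a \<le> s" "s < c" for s
  proof -
    obtain t where "t \<in> X" "s < t" using \<open>s < c\<close> aX less_cSup_iff[OF _ bdd] unfolding c_def by blast
    then show ?thesis using that by (auto simp: X_def)
  qed
  have Pc: "P c" using left[of c] below base c by (cases "a = c") auto
  have "c = b"
  proof (rule ccontr)
    assume "c \<noteq> b"
    then have "c < b" using c by simp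
    from right[OF c(1) this Pc] obtain d where d: "d > c" "\<And>s. c < s \<Longrightarrow> s < d \<Longrightarrow> P s"
      unfolding eventually_at_right_field by blast
    define t where "t = min b ((c + d) / 2)"
    have t: "c < t" "t \<le> b" "t < d" using d(1) \<open>c < b\<close> by (auto simp: t_def min_def field_simps)
    have "P s" if "s \<in> {a..t}" for s
      using that below[of s] Pc d(2)[of s] t by (cases s c rule: linorder_cases) auto
    then have "t \<in> X" using t c by (auto simp: X_def)
    then have "t \<le> c" unfolding c_def by (rule cSup_upper[OF _ bdd])
    then show False using t by simp
  qed
  then show ?thesis using Pc by simp
qed

context
  fixes D N A :: "real \<Rightarrow> real" and p T :: real
  assumes p: "1 < p"
    and dissipation: "\<And>a b. \<lbrakk>0 < a; a < b; b < T\<rbrakk> \<Longrightarrow> D b + p * (\<integral>t. indicator {a..b} t * A t \<partial>lborel) \<le> D a"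
    and D_nonneg: "\<And>t. 0 \<le> D t"
    and A: "\<And>t. 0 \<le> A t" "integrable lborel A"
    and D_right: "\<And>t. 0 \<le> t \<Longrightarrow> t < T \<Longrightarrow> (D \<longlongrightarrow> D t) (at_right t)"
    and N_right: "\<And>t. 0 \<le> t \<Longrightarrow> t < T \<Longrightarrow> (N \<longlongrightarrow> N t) (at_right t)"
    and N_left: "\<And>t. 0 < t \<Longrightarrow> t < T \<Longrightarrow> (N \<longlongrightarrow> N t) (at_left t)"
    and N_pos: "\<And>t. 0 \<le> t \<Longrightarrow> t < T \<Longrightarrow> 0 < N t"
    and rate: "AE t in lborel. 0 < t \<and> t < T \<longrightarrow> D t \<le> A t powr (1 - 1 / p) * N t powr (1 / p)"
    and N_decrease: "\<And>a b. \<lbrakk>0 < a; a < b; b < T\<rbrakk> \<Longrightarrow>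
      N a - N b \<le> p * N a powr (1 - 1 / p) * (\<integral>t. indicator {a..b} t * A t powr (1 / p) \<partial>lborel)"
begin

lemma D_antimono: "0 < a \<Longrightarrow> a \<le> b \<Longrightarrow> b < T \<Longrightarrow> D b \<le> D a"
proof (cases "a = b")
  case False
  assume "0 < a" "a \<le> b" "b < T"
  then have "D b + p * (\<integral>t. indicator {a..b} t * A t \<partial>lborel) \<le> D a"
    using False by (intro dissipation) auto
  moreover have "0 \<le> p * (\<integral>t. indicator {a..b} t * A t \<partial>lborel)"
    using p A(1) by (intro mult_nonneg_nonneg integral_nonneg_AE) auto
  ultimately show ?thesis by linarith
qed simp

text \<open>
  Insert \<open>A\<^sup>1\<^sup>/\<^sup>p \<le> A N\<^sup>1\<^sup>/\<^sup>p / D\<close>, which follows from \<open>rate\<close> by multiplication with \<open>A\<^sup>1\<^sup>/\<^sup>p / D\<close>, and bound the integral of \<open>A\<close>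
  by the dissipated energy.
\<close>

lemma N_decrease_le:
  assumes ab: "0 < a" "a < b" "b < T" and Db: "0 < D b"
    and m: "\<And>t. a \<le> t \<Longrightarrow> t \<le> b \<Longrightarrow> N t \<le> m * N a" "1 \<le> m"
  shows "N a - N b \<le> m * N a * (D a - D b) / D b"
proof -
  let ?i = "\<lambda>t. indicator {a..b} t :: real"
  have Na: "0 < N a" using N_pos ab by simp
  let ?c = "m * N a powr (1 / p) / D b"
  have iA: "integrable lborel (\<lambda>t. ?i t * A t)"
    using integrable_mult_indicator[OF _ A(2), of "{a..b}"] by simp
  have "(\<integral>t. ?i t * A t powr (1 / p) \<partial>lborel) \<le> (\<integral>t. ?c * (?i t * A t) \<partial>lborel)"
  proof (rule integral_mono_AE')
    show "integrable lborel (\<lambda>t. ?c * (?i t * A t))" using iA by simp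
    show "AE t in lborel. ?i t * A t powr (1 / p) \<le> ?c * (?i t * A t)"
      using rate
    proof eventually_elim
      case (elim t)
      show ?case
      proof (cases "t \<in> {a..b}")
        case True
        have "N t powr (1 / p) \<le> (m * N a) powr (1 / p)"
          using m(1)[of t] True N_pos[of t] ab p by (intro powr_mono2) auto
        also have "\<dots> = m powr (1 / p) * N a powr (1 / p)" using m(2) Na by (simp add: powr_mult)
        also have "m powr (1 / p) \<le> m" using powr_mono[of "1 / p" 1 m] m(2) p by simp
        finally have n: "N t powr (1 / p) \<le> m * N a powr (1 / p)" by (simp add: mult_right_mono)
        have "D b * A t powr (1 / p) \<le> D t * A t powr (1 / p)"
          using D_antimono[of t b] True ab by (intro mult_right_mono) auto
        also have "\<dots> \<le> (A t powr (1 - 1 / p) * N t powr (1 / p)) * A t powr (1 / p)"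
          using elim True ab by (intro mult_right_mono) auto
        also have "\<dots> = A t * N t powr (1 / p)"
          using A(1)[of t] by (cases "A t = 0") (simp_all add: powr_diff)
        also have "\<dots> \<le> A t * (m * N a powr (1 / p))" using A(1) n by (intro mult_left_mono)
        finally show ?thesis using True Db by (simp add: field_simps)
      qed simp
    qed
    show "AE t in lborel. 0 \<le> ?c * (?i t * A t)" using m(2) Db A(1) by (intro AE_I2) simp
  qed
  also have "\<dots> = ?c * (\<integral>t. ?i t * A t \<partial>lborel)" by simp
  finally have "p * N a powr (1 - 1 / p) * (\<integral>t. ?i t * A t powr (1 / p) \<partial>lborel)
      \<le> p * N a powr (1 - 1 / p) * (?c * (\<integral>t. ?i t * A t \<partial>lborel))"
    using p by (intro mult_left_mono) auto
  also have "\<dots> = (N a powr (1 - 1 / p) * N a powr (1 / p)) * m / D b * (p * (\<integral>t. ?i t * A t \<partial>lborel))"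
    by simp
  also have "N a powr (1 - 1 / p) * N a powr (1 / p) = N a" using Na by (simp flip: powr_add)
  also have "N a * m / D b * (p * (\<integral>t. ?i t * A t \<partial>lborel)) \<le> N a * m / D b * (D a - D b)"
    using dissipation[OF ab] Na m(2) Db by (intro mult_left_mono) auto
  finally show ?thesis using N_decrease[OF ab] by (simp add: ac_simps)
qed

text \<open>
  Near \<open>a\<close> the values of \<open>N\<close> and \<open>D\<close> differ from those at \<open>a\<close> by factors of at most \<open>1 + \<eta>\<close>. Three such factors
  occur: for the supremum of \<open>N\<close>, and for replacing \<open>N b\<close> by \<open>N a\<close> and \<open>D b\<close> by \<open>D a\<close> in the denominators.
\<close>

lemma log_quotient_right:
  assumes a: "0 < a" "a < T" and Da: "0 < D a" and \<eta>: "0 < \<eta>"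
  shows "\<forall>\<^sub>F b in at_right a. ln (N a) - ln (N b) \<le> (1 + \<eta>) ^ 3 * (ln (D a) - ln (D b))"
proof -
  have Na: "0 < N a" using N_pos a by simp
  have "N a < (1 + \<eta>) * N a" using Na \<eta> by simp
  then have 1: "\<forall>\<^sub>F b in at_right a. N b < (1 + \<eta>) * N a"
    using order_tendstoD(2)[OF N_right[of a]] a by simp
  have "N a / (1 + \<eta>) < N a" using Na \<eta> by (simp add: field_simps)
  then have 2: "\<forall>\<^sub>F b in at_right a. N a / (1 + \<eta>) < N b"
    using order_tendstoD(1)[OF N_right[of a]] a by simp
  have "D a / (1 + \<eta>) < D a" using Da \<eta> by (simp add: field_simps)
  then have 3: "\<forall>\<^sub>F b in at_right a. D a / (1 + \<eta>) < D b"
    using order_tendstoD(1)[OF D_right[of a]] a by simp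
  obtain d where d: "a < d" "\<And>b. a < b \<Longrightarrow> b < d \<Longrightarrow> N b < (1 + \<eta>) * N a \<and> N a / (1 + \<eta>) < N b \<and> D a / (1 + \<eta>) < D b"
    using eventually_conj[OF 1 eventually_conj[OF 2 3]] unfolding eventually_at_right_field by blast
  have "ln (N a) - ln (N b) \<le> (1 + \<eta>) ^ 3 * (ln (D a) - ln (D b))" if b: "a < b" "b < min d T" for b
  proof -
    note near = d(2)[of b]
    have Db: "0 < D b" using near b Da \<eta> by (smt (verit) divide_pos_pos min_less_iff_conj)
    have Nb: "0 < N b" using N_pos b a by simp
    have "N t \<le> (1 + \<eta>) * N a" if "a \<le> t" "t \<le> b" for t
      using that d(2)[of t] b Na \<eta> by (cases "t = a") auto
    then have "N a - N b \<le> (1 + \<eta>) * N a * (D a - D b) / D b"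
      using a b \<eta> Db by (intro N_decrease_le) auto
    then have "(N a - N b) / N b \<le> ((1 + \<eta>) * N a * (D a - D b) / D b) / N b"
      using Nb by (intro divide_right_mono) auto
    also have "\<dots> = (1 + \<eta>) * (N a / N b) * (D a - D b) * (1 / D b)" by simp
    also have "\<dots> \<le> (1 + \<eta>) * (1 + \<eta>) * (D a - D b) * ((1 + \<eta>) / D a)"
    proof (rule mult_mono)
      have "N a / N b \<le> 1 + \<eta>" using near b Nb \<eta> by (simp add: field_simps)
      moreover have "0 \<le> D a - D b" using D_antimono[of a b] a b by simp
      ultimately show "(1 + \<eta>) * (N a / N b) * (D a - D b) \<le> (1 + \<eta>) * (1 + \<eta>) * (D a - D b)"
        and "0 \<le> (1 + \<eta>) * (1 + \<eta>) * (D a - D b)"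
        using \<eta> by (intro mult_right_mono mult_left_mono mult_nonneg_nonneg; simp)+
      show "1 / D b \<le> (1 + \<eta>) / D a" using near b Da Db \<eta> by (simp add: field_simps)
      show "0 \<le> 1 / D b" using Db by simp
    qed
    also have "\<dots> = (1 + \<eta>) ^ 3 * ((D a - D b) / D a)" by (simp add: power3_eq_cube)
    also have "(D a - D b) / D a \<le> ln (D a) - ln (D b)"
      using ln_le_minus_one[of "D b / D a"] Da Db by (simp add: ln_div diff_divide_distrib)
    finally have "(N a - N b) / N b \<le> (1 + \<eta>) ^ 3 * (ln (D a) - ln (D b))" using \<eta> by simp
    moreover have "ln (N a) - ln (N b) \<le> (N a - N b) / N b"
      using ln_le_minus_one[of "N a / N b"] Na Nb by (simp add: ln_div diff_divide_distrib)
    ultimately show ?thesis by linarith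
  qed
  moreover have "a < min d T" using d(1) a by simp
  ultimately show ?thesis unfolding eventually_at_right_field by blast
qed

text \<open>
  Approaching a point from the left, \<open>N\<close> is continuous and \<open>D\<close> can only drop, so an upper bound for the
  difference of logarithms persists in the limit.
\<close>

lemma log_quotient:
  assumes ab: "0 < a" "a \<le> b" "b < T" and Db: "0 < D b" and \<eta>: "0 < \<eta>"
  shows "(1 + \<eta>) ^ 3 * ln (D b) - ln (N b) \<le> (1 + \<eta>) ^ 3 * ln (D a) - ln (N a)"
proof (rule real_right_induct[OF ab(2)])
  let ?K = "(1 + \<eta>) ^ 3" and ?\<phi> = "\<lambda>t. (1 + \<eta>) ^ 3 * ln (D t) - ln (N t)"
  have K: "0 < ?K" using \<eta> by simp
  have Dt: "0 < D t" if "a \<le> t" "t \<le> b" for t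
    using D_antimono[of t b] that ab Db by linarith
  fix t
  {
    assume t: "a < t" "t \<le> b" and le: "\<And>s. a \<le> s \<Longrightarrow> s < t \<Longrightarrow> ?\<phi> s \<le> ?\<phi> a"
    have "((\<lambda>s. ?K * ln (D t) - ln (N s)) \<longlongrightarrow> ?\<phi> t) (at_left t)"
      using t ab N_pos[of t] by (intro tendsto_diff tendsto_const tendsto_ln N_left) auto
    then show "?\<phi> t \<le> ?\<phi> a"
    proof (rule tendsto_upperbound)
      show "\<forall>\<^sub>F s in at_left t. ?K * ln (D t) - ln (N s) \<le> ?\<phi> a"
        unfolding eventually_at_left_field
      proof (intro exI[of _ a] conjI allI impI)
        fix s assume s: "a < s" "s < t"
        have "ln (D t) \<le> ln (D s)" using D_antimono[of s t] Dt[of t] s t ab by simp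
        then have "?K * ln (D t) \<le> ?K * ln (D s)" using K by (intro mult_left_mono) auto
        then show "?K * ln (D t) - ln (N s) \<le> ?\<phi> a" using le[of s] s by simp
      qed (use t in simp)
    qed simp
  next
    assume t: "a \<le> t" "t < b" and le: "?\<phi> t \<le> ?\<phi> a"
    show "\<forall>\<^sub>F s in at_right t. ?\<phi> s \<le> ?\<phi> a"
    proof -
      have "\<forall>\<^sub>F s in at_right t. ln (N t) - ln (N s) \<le> ?K * (ln (D t) - ln (D s))"
        using t ab by (intro log_quotient_right Dt \<eta>) auto
      then show ?thesis
      proof eventually_elim
        case (elim s)
        then show ?case using le by (simp add: right_diff_distrib)
      qed
    qed
  }
qed simp

lemma quotient_antimono_pos:
  assumes ab: "0 < a" "a \<le> b" "b < T"
  shows "D b / N b \<le> D a / N a"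
proof (cases "D b = 0")
  case True
  then show ?thesis using D_nonneg[of a] N_pos[of a] ab by (simp add: divide_nonneg_pos)
next
  case False
  then have Db: "0 < D b" using D_nonneg[of b] by simp
  have Da: "0 < D a" using D_antimono[OF ab] Db by linarith
  have Na: "0 < N a" and Nb: "0 < N b" using N_pos ab by auto
  have "(1 + 0) ^ 3 * ln (D b) - ln (N b) \<le> (1 + 0) ^ 3 * ln (D a) - ln (N a)"
  proof (rule tendsto_le)
    show "((\<lambda>\<eta>. (1 + \<eta>) ^ 3 * ln (D b) - ln (N b)) \<longlongrightarrow> (1 + 0) ^ 3 * ln (D b) - ln (N b)) (at_right 0)"
      "((\<lambda>\<eta>. (1 + \<eta>) ^ 3 * ln (D a) - ln (N a)) \<longlongrightarrow> (1 + 0) ^ 3 * ln (D a) - ln (N a)) (at_right 0)"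
      by (intro tendsto_intros)+
    show "\<forall>\<^sub>F \<eta> in at_right 0. (1 + \<eta>) ^ 3 * ln (D b) - ln (N b) \<le> (1 + \<eta>) ^ 3 * ln (D a) - ln (N a)"
      using eventually_at_right_less[of "0::real"] by eventually_elim (rule log_quotient[OF ab Db])
  qed simp
  then have "ln (D b / N b) \<le> ln (D a / N a)" using Da Db Na Nb by (simp add: ln_div)
  then show ?thesis using Da Db Na Nb by simp
qed

lemma quotient_antimono:
  assumes ab: "0 \<le> a" "a \<le> b" "b < T"
  shows "D b / N b \<le> D a / N a"
proof (cases "a = 0 \<and> 0 < b")
  case True
  have "((\<lambda>t. D t / N t) \<longlongrightarrow> D 0 / N 0) (at_right 0)"
    using N_pos[of 0] ab by (intro tendsto_divide D_right N_right) auto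
  moreover have "\<forall>\<^sub>F t in at_right 0. D b / N b \<le> D t / N t"
    unfolding eventually_at_right_field
    using True ab by (intro exI[of _ b] conjI allI impI quotient_antimono_pos) auto
  ultimately have "D b / N b \<le> D 0 / N 0" by (rule tendsto_lowerbound) simp
  then show ?thesis using True by simp
next
  case False
  then show ?thesis using quotient_antimono_pos[of a b] ab by (cases "a = 0") auto
qed

end

section \<open>Recovering endpoint values from a time derivative\<close>

definition bump1_deriv :: "nat \<Rightarrow> real \<Rightarrow> real \<Rightarrow> real \<Rightarrow> real" where
  "bump1_deriv k a b s =
     exp_recip (1 / Suc k) ([:0, 0, 1:] * (smult (1 / Suc k) 1 - pderiv 1)) (s - a) * exp_recip (1 / Suc k) 1 (b - s)
     - exp_recip (1 / Suc k) 1 (s - a) * exp_recip (1 / Suc k) ([:0, 0, 1:] * (smult (1 / Suc k) 1 - pderiv 1)) (b - s)"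

lemma bump1_has_deriv: "(bump1 k a b has_real_derivative bump1_deriv k a b s) (at s)"
proof -
  have c: "0 < 1 / real (Suc k)" by simp
  have 1: "((\<lambda>s. s - a) has_real_derivative 1) (at s)" "((\<lambda>s. b - s) has_real_derivative - 1) (at s)"
    by (auto intro!: derivative_eq_intros)
  note 2 = DERIV_cong[OF DERIV_chain2[OF exp_recip_deriv[OF c, of 1 "s - a"] 1(1)] mult_1_right]
  note 3 = DERIV_cong[OF DERIV_chain2[OF exp_recip_deriv[OF c, of 1 "b - s"] 1(2)] mult_minus1_right]
  have "x * y + - z * w = x * y - w * z" for x y z w :: real by simp
  from DERIV_cong[OF DERIV_mult[OF 2 3] this] show ?thesis
    unfolding bump1_def[abs_def] bump1_deriv_def .
qed

lemma continuous_exp_recip: "0 < c \<Longrightarrow> continuous_on UNIV (exp_recip c P)"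
  using exp_recip_deriv[of c P] DERIV_isCont by (auto simp: continuous_on_eq_continuous_at)

lemma continuous_bump1_deriv: "continuous_on S (bump1_deriv k a b)"
  unfolding bump1_deriv_def[abs_def]
  by (intro continuous_intros continuous_on_compose2[OF continuous_exp_recip]) auto

text \<open>
  The bump rises on the left half of its interval and falls on the right half, so that its derivative
  acts as a positive and a negative unit mass that concentrate at the two ends.
\<close>

lemma bump1_deriv_sign:
  shows "a \<le> s \<Longrightarrow> s \<le> (a + b) / 2 \<Longrightarrow> 0 \<le> bump1_deriv k a b s"
    and "(a + b) / 2 \<le> s \<Longrightarrow> s \<le> b \<Longrightarrow> bump1_deriv k a b s \<le> 0"
proof -
  let ?c = "1 / real (Suc k)"
  have e: "exp_recip ?c ([:0, 0, 1:] * (smult ?c 1 - pderiv 1)) r = ?c / r\<^sup>2 * exp_recip ?c 1 r" for r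
    by (simp add: exp_recip_def power2_eq_square pderiv_1)
  have eq: "bump1_deriv k a b s = ?c * (1 / (s - a)\<^sup>2 - 1 / (b - s)\<^sup>2) * (exp_recip ?c 1 (s - a) * exp_recip ?c 1 (b - s))"
    unfolding bump1_deriv_def e by (simp add: algebra_simps)
  have c: "0 \<le> ?c" by simp
  have nn: "0 \<le> ?c" "0 \<le> exp_recip ?c 1 (s - a) * exp_recip ?c 1 (b - s)"
    using mult_nonneg_nonneg[OF exp_recip_1_bounds(1)[OF c] exp_recip_1_bounds(1)[OF c]] c by auto
  show "0 \<le> bump1_deriv k a b s" if s: "a \<le> s" "s \<le> (a + b) / 2"
  proof (cases "s = a")
    case True then show ?thesis by (simp add: bump1_deriv_def exp_recip_def)
  next
    case False
    then have "0 < (s - a)\<^sup>2" "(s - a)\<^sup>2 \<le> (b - s)\<^sup>2" 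
      using s power_mono[of "s - a" "b - s" 2] by (auto simp: field_simps)
    then have *: "0 \<le> 1 / (s - a)\<^sup>2 - 1 / (b - s)\<^sup>2" by (simp add: frac_le)
    show ?thesis unfolding eq by (rule mult_nonneg_nonneg[OF mult_nonneg_nonneg[OF nn(1) *] nn(2)])
  qed
  show "bump1_deriv k a b s \<le> 0" if s: "(a + b) / 2 \<le> s" "s \<le> b"
  proof (cases "s = b")
    case True then show ?thesis by (simp add: bump1_deriv_def exp_recip_def)
  next
    case False
    then have "0 < (b - s)\<^sup>2" "(b - s)\<^sup>2 \<le> (s - a)\<^sup>2" 
      using s power_mono[of "b - s" "s - a" 2] by (auto simp: field_simps)
    then have *: "1 / (s - a)\<^sup>2 - 1 / (b - s)\<^sup>2 \<le> 0" by (simp add: frac_le)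
    show ?thesis unfolding eq by (rule mult_nonpos_nonneg[OF mult_nonneg_nonpos[OF nn(1) *] nn(2)])
  qed
qed

lemma integral_bump1_deriv:
  assumes "s \<le> t" shows "integral {s..t} (bump1_deriv k a b) = bump1 k a b t - bump1 k a b s"
  by (intro integral_unique fundamental_theorem_of_calculus assms)
     (use bump1_has_deriv in \<open>auto intro: has_field_derivative_at_within simp flip: has_real_derivative_iff_has_vector_derivative\<close>)

lemma concentrating_weights_tendsto:
  fixes U :: "real \<Rightarrow> 'b::euclidean_space" and w :: "nat \<Rightarrow> real \<Rightarrow> real"
  assumes w: "\<And>k. continuous_on {\<alpha>..\<beta>} (w k)" "\<And>k s. s \<in> {\<alpha>..\<beta>} \<Longrightarrow> 0 \<le> w k s"
    and mass: "(\<lambda>k. integral {\<alpha>..\<beta>} (w k)) \<longlonglongrightarrow> 1"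
    and U: "continuous_on {\<alpha>..\<beta>} U"
    and conc: "\<And>\<epsilon>. 0 < \<epsilon> \<Longrightarrow> \<exists>\<gamma> \<delta>. {\<gamma>..\<delta>} \<subseteq> {\<alpha>..\<beta>} \<and> (\<forall>s\<in>{\<alpha>..\<beta>} - {\<gamma>..\<delta>}. norm (U s - u) \<le> \<epsilon>)
      \<and> (\<lambda>k. integral {\<gamma>..\<delta>} (w k)) \<longlonglongrightarrow> 0"
  shows "(\<lambda>k. integral {\<alpha>..\<beta>} (\<lambda>s. w k s *\<^sub>R U s)) \<longlonglongrightarrow> u"
proof -
  have cU: "continuous_on {\<alpha>..\<beta>} (\<lambda>s. U s - u)" by (intro continuous_intros U)
  have "bounded ((\<lambda>s. U s - u) ` {\<alpha>..\<beta>})"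
    by (intro compact_imp_bounded compact_continuous_image cU) simp
  then obtain B where B: "B > 0" "\<And>s. s \<in> {\<alpha>..\<beta>} \<Longrightarrow> norm (U s - u) \<le> B"
    unfolding bounded_pos by auto
  have "(\<lambda>k. integral {\<alpha>..\<beta>} (\<lambda>s. w k s *\<^sub>R (U s - u))) \<longlonglongrightarrow> 0"
  proof (rule LIMSEQ_I)
    fix e :: real assume e: "0 < e"
    then have "0 < e / 4" by simp
    from conc[OF this] obtain \<gamma> \<delta> where gd: "{\<gamma>..\<delta>} \<subseteq> {\<alpha>..\<beta>}"
      "\<And>s. s \<in> {\<alpha>..\<beta>} - {\<gamma>..\<delta>} \<Longrightarrow> norm (U s - u) \<le> e / 4"
      "(\<lambda>k. integral {\<gamma>..\<delta>} (w k)) \<longlonglongrightarrow> 0" by blast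
    have "\<forall>\<^sub>F k in sequentially. integral {\<alpha>..\<beta>} (w k) < 2" by (rule order_tendstoD(2)[OF mass]) simp
    moreover have "\<forall>\<^sub>F k in sequentially. integral {\<gamma>..\<delta>} (w k) < e / (4 * B)"
      by (rule order_tendstoD(2)[OF gd(3)]) (use e B in simp)
    ultimately have "\<forall>\<^sub>F k in sequentially. norm (integral {\<alpha>..\<beta>} (\<lambda>s. w k s *\<^sub>R (U s - u)) - 0) < e"
    proof eventually_elim
      case (elim k)
      let ?r = "\<lambda>s. if s \<in> {\<gamma>..\<delta>} then w k s else 0"
      have iw: "w k integrable_on {\<alpha>..\<beta>}" "w k integrable_on {\<gamma>..\<delta>}"
        by (intro integrable_continuous_interval w(1) continuous_on_subset[OF w(1) gd(1)])+
      have ir: "?r integrable_on {\<alpha>..\<beta>}" "integral {\<alpha>..\<beta>} ?r = integral {\<gamma>..\<delta>} (w k)"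
        unfolding integrable_restrict_Int integral_restrict_Int Int_absorb2[OF gd(1)] by (rule iw(2), rule refl)
      have "norm (integral {\<alpha>..\<beta>} (\<lambda>s. w k s *\<^sub>R (U s - u)))
          \<le> integral {\<alpha>..\<beta>} (\<lambda>s. e / 4 * w k s + B * ?r s)"
      proof (rule Henstock_Kurzweil_Integration.integral_norm_bound_integral)
        show "(\<lambda>s. w k s *\<^sub>R (U s - u)) integrable_on {\<alpha>..\<beta>}"
          by (intro integrable_continuous_interval continuous_intros w U)
        show "(\<lambda>s. e / 4 * w k s + B * ?r s) integrable_on {\<alpha>..\<beta>}"
          by (intro Henstock_Kurzweil_Integration.integrable_add integrable_on_mult_right iw ir)
        fix s assume s: "s \<in> {\<alpha>..\<beta>}"
        show "norm (w k s *\<^sub>R (U s - u)) \<le> e / 4 * w k s + B * ?r s"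
        proof (cases "s \<in> {\<gamma>..\<delta>}")
          case True
          have "w k s * norm (U s - u) \<le> w k s * B" using w(2)[OF s] B(2)[OF s] by (intro mult_left_mono)
          moreover have "0 \<le> e / 4 * w k s" using w(2)[OF s] e by simp
          ultimately show ?thesis using True w(2)[OF s, of k] by (simp add: mult.commute)
        next
          case False
          then have "w k s * norm (U s - u) \<le> w k s * (e / 4)"
            using w(2)[OF s] gd(2)[of s] s by (intro mult_left_mono) auto
          then show ?thesis unfolding if_not_P[OF False] using w(2)[OF s, of k] by (simp add: mult.commute)
        qed
      qed
      also have "\<dots> = e / 4 * integral {\<alpha>..\<beta>} (w k) + B * integral {\<gamma>..\<delta>} (w k)"
        using Henstock_Kurzweil_Integration.integral_add[OF integrable_on_mult_right[OF iw(1), of "e / 4"]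
            integrable_on_mult_right[OF ir(1), of B]] ir(2) by simp
      also have "\<dots> < e / 4 * 2 + B * (e / (4 * B))"
        using elim e B(1) by (intro add_strict_mono mult_strict_left_mono) auto
      also have "\<dots> \<le> e" using B(1) e by simp
      finally show ?case by simp
    qed
    then show "\<exists>K. \<forall>k\<ge>K. norm (integral {\<alpha>..\<beta>} (\<lambda>s. w k s *\<^sub>R (U s - u)) - 0) < e"
      by (simp add: eventually_sequentially)
  qed
  moreover have "(\<lambda>k. integral {\<alpha>..\<beta>} (w k) *\<^sub>R u) \<longlonglongrightarrow> 1 *\<^sub>R u"
    by (intro tendsto_scaleR mass tendsto_const)
  ultimately have "(\<lambda>k. integral {\<alpha>..\<beta>} (\<lambda>s. w k s *\<^sub>R (U s - u)) + integral {\<alpha>..\<beta>} (w k) *\<^sub>R u) \<longlonglongrightarrow> 0 + 1 *\<^sub>R u"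
    by (rule tendsto_add)
  moreover have "integral {\<alpha>..\<beta>} (\<lambda>s. w k s *\<^sub>R (U s - u)) + integral {\<alpha>..\<beta>} (w k) *\<^sub>R u
      = integral {\<alpha>..\<beta>} (\<lambda>s. w k s *\<^sub>R U s)" for k
  proof -
    have iw: "w k integrable_on {\<alpha>..\<beta>}" by (intro integrable_continuous_interval w)
    have *: "integral {\<alpha>..\<beta>} (w k) *\<^sub>R u = integral {\<alpha>..\<beta>} (\<lambda>s. w k s *\<^sub>R u)"
      by (rule integral_unique[OF has_integral_scaleR_left[OF integrable_integral[OF iw]], symmetric])
    have "integral {\<alpha>..\<beta>} (\<lambda>s. w k s *\<^sub>R (U s - u)) + integral {\<alpha>..\<beta>} (\<lambda>s. w k s *\<^sub>R u)
        = integral {\<alpha>..\<beta>} (\<lambda>s. w k s *\<^sub>R (U s - u) + w k s *\<^sub>R u)"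
      by (intro Henstock_Kurzweil_Integration.integral_add[symmetric] integrable_continuous_interval continuous_intros w U)
    then show ?thesis using * by (simp add: scaleR_diff_right)
  qed
  ultimately show ?thesis by simp
qed

text \<open>
  Testing with the bumps on \<open>[a, b]\<close> thus produces the values at the end points.
\<close>

lemma bump1_deriv_integral_tendsto:
  fixes U :: "real \<Rightarrow> 'b::euclidean_space"
  assumes ab: "a < b" and U: "continuous_on {a..b} U"
  shows "(\<lambda>k. integral {a..b} (\<lambda>s. bump1_deriv k a b s *\<^sub>R U s)) \<longlonglongrightarrow> U a - U b"
proof -
  define m where "m = (a + b) / 2"
  have m: "a < m" "m < b" using ab by (auto simp: m_def field_simps)
  have one: "(\<lambda>k. bump1 k a b s) \<longlonglongrightarrow> 1" if "a < s" "s < b" for s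
    using bump1_tendsto[of a b s] that by simp
  have zero: "bump1 k a b a = 0" "bump1 k a b b = 0" for k by (simp_all add: bump1_eq_0)
  have left: "(\<lambda>k. integral {a..m} (\<lambda>s. bump1_deriv k a b s *\<^sub>R U s)) \<longlonglongrightarrow> U a"
  proof (rule concentrating_weights_tendsto)
    show "continuous_on {a..m} (bump1_deriv k a b)" for k by (rule continuous_bump1_deriv)
    show "0 \<le> bump1_deriv k a b s" if "s \<in> {a..m}" for k s
      using that by (intro bump1_deriv_sign) (auto simp: m_def)
    show "(\<lambda>k. integral {a..m} (bump1_deriv k a b)) \<longlonglongrightarrow> 1"
      using one[of m] m by (simp add: integral_bump1_deriv zero)
    show cU: "continuous_on {a..m} U" using U m by (auto intro: continuous_on_subset)
    fix \<epsilon> :: real assume "0 < \<epsilon>"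
    then obtain d where d: "d > 0" "\<And>s. s \<in> {a..m} \<Longrightarrow> dist s a < d \<Longrightarrow> dist (U s) (U a) < \<epsilon>"
      using cU m unfolding continuous_on_iff by (metis atLeastAtMost_iff less_eq_real_def)
    define \<gamma> where "\<gamma> = min m (a + d / 2)"
    have g: "a < \<gamma>" "\<gamma> \<le> m" "\<gamma> < a + d" using d(1) m by (auto simp: \<gamma>_def)
    have "(\<lambda>k. bump1 k a b m - bump1 k a b \<gamma>) \<longlonglongrightarrow> 1 - 1"
      using g m by (intro tendsto_diff one) auto
    then have "(\<lambda>k. integral {\<gamma>..m} (bump1_deriv k a b)) \<longlonglongrightarrow> 0"
      using g by (simp add: integral_bump1_deriv)
    moreover have "norm (U s - U a) \<le> \<epsilon>" if "s \<in> {a..m} - {\<gamma>..m}" for s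
      using d(2)[of s] that g by (auto simp: dist_norm)
    ultimately show "\<exists>\<gamma> \<delta>. {\<gamma>..\<delta>} \<subseteq> {a..m} \<and> (\<forall>s\<in>{a..m} - {\<gamma>..\<delta>}. norm (U s - U a) \<le> \<epsilon>)
      \<and> (\<lambda>k. integral {\<gamma>..\<delta>} (bump1_deriv k a b)) \<longlonglongrightarrow> 0"
      using g by (intro exI[of _ \<gamma>] exI[of _ m]) auto
  qed
  have right: "(\<lambda>k. integral {m..b} (\<lambda>s. - bump1_deriv k a b s *\<^sub>R U s)) \<longlonglongrightarrow> U b"
  proof (rule concentrating_weights_tendsto)
    show "continuous_on {m..b} (\<lambda>s. - bump1_deriv k a b s)" for k by (intro continuous_on_minus continuous_bump1_deriv)
    show "0 \<le> - bump1_deriv k a b s" if "s \<in> {m..b}" for k s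
      using bump1_deriv_sign(2)[of a b s k] that by (auto simp: m_def)
    show "(\<lambda>k. integral {m..b} (\<lambda>s. - bump1_deriv k a b s)) \<longlonglongrightarrow> 1"
      using one[of m] m by (simp add: integral_bump1_deriv zero)
    show cU: "continuous_on {m..b} U" using U m by (auto intro: continuous_on_subset)
    fix \<epsilon> :: real assume "0 < \<epsilon>"
    then obtain d where d: "d > 0" "\<And>s. s \<in> {m..b} \<Longrightarrow> dist s b < d \<Longrightarrow> dist (U s) (U b) < \<epsilon>"
      using cU m unfolding continuous_on_iff by (metis atLeastAtMost_iff less_eq_real_def)
    define \<gamma> where "\<gamma> = max m (b - d / 2)"
    have g: "\<gamma> < b" "m \<le> \<gamma>" "b - d < \<gamma>" using d(1) m by (auto simp: \<gamma>_def)
    have "(\<lambda>k. - (bump1 k a b \<gamma> - bump1 k a b m)) \<longlonglongrightarrow> - (1 - 1)"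
      using g m by (intro tendsto_minus tendsto_diff one) auto
    then have "(\<lambda>k. integral {m..\<gamma>} (\<lambda>s. - bump1_deriv k a b s)) \<longlonglongrightarrow> 0"
      using g by (simp add: integral_bump1_deriv)
    moreover have "norm (U s - U b) \<le> \<epsilon>" if "s \<in> {m..b} - {m..\<gamma>}" for s
      using d(2)[of s] that g by (auto simp: dist_norm)
    ultimately show "\<exists>\<gamma> \<delta>. {\<gamma>..\<delta>} \<subseteq> {m..b} \<and> (\<forall>s\<in>{m..b} - {\<gamma>..\<delta>}. norm (U s - U b) \<le> \<epsilon>)
      \<and> (\<lambda>k. integral {\<gamma>..\<delta>} (\<lambda>s. - bump1_deriv k a b s)) \<longlonglongrightarrow> 0"
      using g by (intro exI[of _ m] exI[of _ \<gamma>]) auto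
  qed
  have "integral {a..m} (\<lambda>s. bump1_deriv k a b s *\<^sub>R U s) - integral {m..b} (\<lambda>s. - bump1_deriv k a b s *\<^sub>R U s)
      = integral {a..b} (\<lambda>s. bump1_deriv k a b s *\<^sub>R U s)" for k
  proof -
    have "(\<lambda>s. bump1_deriv k a b s *\<^sub>R U s) integrable_on {a..b}"
      by (intro integrable_continuous_interval continuous_on_scaleR continuous_bump1_deriv U)
    then show ?thesis
      using Henstock_Kurzweil_Integration.integral_combine[of a m b] m by simp
  qed
  then show ?thesis using tendsto_diff[OF left right] by simp
qed

lemma borel_representative:
  fixes u :: "'a::euclidean_space \<Rightarrow> 'b::euclidean_space"
  assumes K: "K \<in> sets borel" and u: "u \<in> borel_measurable (lebesgue_on K)"
  obtains w where "w \<in> borel_measurable borel" "\<And>z. z \<notin> K \<Longrightarrow> w z = 0"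
    "AE z in lebesgue. z \<in> K \<longrightarrow> w z = u z"
proof -
  have "(\<lambda>z. indicator K z *\<^sub>R u z) \<in> borel_measurable lebesgue"
    using K u by (subst borel_measurable_restrict_space_iff[symmetric]) auto
  then have "\<exists>g\<in>borel_measurable lborel. AE z in lborel. (indicator K z *\<^sub>R u z) \<bullet> b = g z" for b
    by (intro completion_ex_borel_measurable_real borel_measurable_inner) auto
  then obtain g where g: "\<And>b. g b \<in> borel_measurable lborel"
    "\<And>b. AE z in lborel. (indicator K z *\<^sub>R u z) \<bullet> b = g b z" by metis
  define w where "w z = indicator K z *\<^sub>R (\<Sum>b\<in>Basis. g b z *\<^sub>R b)" for z
  have [measurable]: "g b \<in> borel_measurable borel" for b using g(1)[of b] by simp
  have "w \<in> borel_measurable borel" unfolding w_def[abs_def] using K by measurable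
  moreover have "w z = 0" if "z \<notin> K" for z using that by (simp add: w_def)
  moreover have "AE z in lebesgue. z \<in> K \<longrightarrow> w z = u z"
  proof -
    have "AE z in lborel. \<forall>b\<in>Basis. (indicator K z *\<^sub>R u z) \<bullet> b = g b z"
      using g(2) by (intro AE_finite_allI) auto
    then have "AE z in lborel. z \<in> K \<longrightarrow> w z = u z"
    proof eventually_elim
      case (elim z)
      show ?case
      proof
        assume z: "z \<in> K"
        then have "(\<Sum>b\<in>Basis. g b z *\<^sub>R b) = (\<Sum>b\<in>Basis. (u z \<bullet> b) *\<^sub>R b)"
          using elim by (intro sum.cong) auto
        then show "w z = u z" using z by (simp add: w_def euclidean_representation)
      qed
    qed
    then show ?thesis by (rule AE_completion)
  qed
  ultimately show thesis by (rule that)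
qed

lemma integral_lebesgue_on_eq_lborel:
  fixes u w :: "'a::euclidean_space \<Rightarrow> 'b::euclidean_space"
  assumes W: "W \<in> sets lebesgue" and w: "w \<in> borel_measurable borel"
    and ae: "AE z in lebesgue. indicator W z *\<^sub>R u z = w z"
  shows "(\<integral>z. u z \<partial>lebesgue_on W) = (\<integral>z. w z \<partial>lborel)"
    and "integrable (lebesgue_on W) u \<longleftrightarrow> integrable lborel w"
proof -
  have wl: "w \<in> borel_measurable lebesgue" using w by (simp add: measurable_completion)
  have ul: "(\<lambda>z. indicator W z *\<^sub>R u z) \<in> borel_measurable lebesgue"
    by (rule borel_measurable_AE[OF wl]) (use ae in eventually_elim, simp)
  have "(\<integral>z. u z \<partial>lebesgue_on W) = (\<integral>z. indicator W z *\<^sub>R u z \<partial>lebesgue)"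
    using W by (simp add: integral_restrict_space)
  also have "\<dots> = (\<integral>z. w z \<partial>lebesgue)" by (rule integral_cong_AE[OF ul wl ae])
  also have "\<dots> = (\<integral>z. w z \<partial>lborel)" using w by (intro integral_completion) simp
  finally show "(\<integral>z. u z \<partial>lebesgue_on W) = (\<integral>z. w z \<partial>lborel)" .
  have "integrable (lebesgue_on W) u \<longleftrightarrow> integrable lebesgue (\<lambda>z. indicator W z *\<^sub>R u z)"
    using W by (simp add: integrable_restrict_space)
  also have "\<dots> \<longleftrightarrow> integrable lebesgue w" by (rule integrable_cong_AE[OF ul wl ae])
  also have "\<dots> \<longleftrightarrow> integrable lborel w" using w by (intro integrable_completion) simp
  finally show "integrable (lebesgue_on W) u \<longleftrightarrow> integrable lborel w" .
qed

lemma AE_lebesgue_sections: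
  fixes P :: "'a::euclidean_space \<times> real \<Rightarrow> bool"
  assumes "AE z in lebesgue. P z"
  shows "AE t in lborel. AE x in lborel. P (x, t)"
proof -
  have "AE z in lborel. P z" using assms by (simp add: AE_completion_iff)
  then obtain N where N: "N \<in> sets lborel" "{z. \<not> P z} \<subseteq> N" "emeasure lborel N = 0"
    by (auto elim!: AE_E)
  then have "AE z in lborel. z \<notin> N" by (intro AE_not_in) (auto intro: null_setsI)
  then have "AE z in lborel \<Otimes>\<^sub>M lborel. z \<notin> N" unfolding lborel_prod .
  then have "AE x in lborel. AE t in lborel. (x, t) \<notin> N" by (rule lborel_pair.AE_pair)
  then have "AE t in lborel. AE x in lborel. (x, t) \<notin> N"
  proof (rule lborel_pair.AE_commute[THEN iffD1, rotated])
    have "- N \<in> sets lborel" using N(1) by auto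
    then show "{x \<in> space (lborel \<Otimes>\<^sub>M lborel). (fst x, snd x) \<notin> N} \<in> sets (lborel \<Otimes>\<^sub>M lborel)"
      unfolding lborel_prod by (simp add: Collect_neg_eq)
  qed
  then show ?thesis by eventually_elim (use N(2) in \<open>auto elim!: eventually_mono\<close>)
qed

text \<open>
  The derivative in direction \<open>(0, 1)\<close> is the derivative along a line, on which the space factor is
  constant.
\<close>

lemma frechet_derivative_time_bump:
  fixes \<beta> :: "'a::euclidean_space \<Rightarrow> real"
  assumes "C_infty (\<lambda>z :: 'a \<times> real. \<beta> (fst z) * bump1 k a b (snd z))"
  shows "frechet_derivative (\<lambda>z :: 'a \<times> real. \<beta> (fst z) * bump1 k a b (snd z)) (at z) (0, 1)
    = \<beta> (fst z) * bump1_deriv k a b (snd z)"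
proof -
  let ?\<phi> = "\<lambda>z :: 'a \<times> real. \<beta> (fst z) * bump1 k a b (snd z)"
  have C: "C_k (Suc 0) ?\<phi>" using assms by (simp add: C_infty_def)
  let ?F = "frechet_derivative ?\<phi> (at z)"
  have F: "(?\<phi> has_derivative ?F) (at z)" by (rule C_k_Suc_has_derivative[OF C])
  have "((\<lambda>\<tau>. z + \<tau> *\<^sub>R (0, 1)) has_derivative (\<lambda>\<tau>. \<tau> *\<^sub>R (0, 1))) (at (0::real))"
    by (auto intro!: derivative_eq_intros)
  moreover have "(?\<phi> has_derivative ?F) (at (z + 0 *\<^sub>R (0, 1)))" using F by (simp flip: zero_prod_def)
  ultimately have "((\<lambda>\<tau>. ?\<phi> (z + \<tau> *\<^sub>R (0, 1))) has_derivative (\<lambda>\<tau>. ?F (\<tau> *\<^sub>R (0, 1)))) (at 0)"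
    by (rule has_derivative_compose)
  moreover have "(\<lambda>\<tau>. ?F (\<tau> *\<^sub>R (0, 1))) = (*) (?F (0, 1))"
    using linear_scale[OF has_derivative_linear[OF F], of _ "(0, 1)"]
    by (simp only: real_scaleR_def mult.commute[of "?F (0, 1)"] fun_eq_iff simp_thms)
  moreover have "(\<lambda>\<tau>. ?\<phi> (z + \<tau> *\<^sub>R (0, 1))) = (\<lambda>\<tau>. \<beta> (fst z) * bump1 k a b (snd z + \<tau>))" by simp
  ultimately have 1: "((\<lambda>\<tau>. \<beta> (fst z) * bump1 k a b (snd z + \<tau>)) has_real_derivative ?F (0, 1)) (at 0)"
    by (simp only: has_field_derivative_def)
  have "((\<lambda>\<tau>. bump1 k a b (snd z + \<tau>)) has_real_derivative bump1_deriv k a b (snd z)) (at 0)"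
    using bump1_has_deriv[of k a b "snd z"] DERIV_shift[of "bump1 k a b" _ 0 "snd z"] by (simp add: add.commute)
  then have "((\<lambda>\<tau>. \<beta> (fst z) * bump1 k a b (snd z + \<tau>)) has_real_derivative \<beta> (fst z) * bump1_deriv k a b (snd z)) (at 0)"
    by (rule DERIV_cmult)
  from DERIV_unique[OF 1 this] show ?thesis .
qed

lemma test_function_time_bump:
  fixes c d :: "'a::euclidean_space"
  assumes "cbox c d \<times> {a..b} \<subseteq> W"
  shows "test_function W (\<lambda>z :: 'a \<times> real. bump j c d (fst z) * bump1 k a b (snd z))"
  unfolding test_function_def
proof (intro conjI exI[of _ "cbox c d \<times> {a..b}"])
  show "C_infty (\<lambda>z :: 'a \<times> real. bump j c d (fst z) * bump1 k a b (snd z))"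
    by (intro C_infty_mult C_infty_bump C_infty_bump1 bounded_linear_fst bounded_linear_snd)
  show "\<forall>z. z \<notin> cbox c d \<times> {a..b} \<longrightarrow> bump j c d (fst z) * bump1 k a b (snd z) = 0"
  proof (intro allI impI)
    fix z :: "'a \<times> real" assume "z \<notin> cbox c d \<times> {a..b}"
    then have "fst z \<notin> box c d \<or> snd z \<notin> {a<..<b}"
      using box_subset_cbox[of c d] by (cases z) auto
    then show "bump j c d (fst z) * bump1 k a b (snd z) = 0" using bump_eq_0 bump1_eq_0 by fastforce
  qed
qed (use assms in \<open>auto intro: compact_Times\<close>)

lemma bump_measurable [measurable]: "bump k c d \<in> borel_measurable borel"
proof -
  have "C_k 0 (bump k c d)" using C_infty_bump[OF bounded_linear_ident, of k c d] unfolding C_infty_def by blast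
  then show ?thesis by (simp add: borel_measurable_continuous_onI)
qed

lemma bump1_measurable [measurable]: "bump1 k a b \<in> borel_measurable borel"
  by (intro borel_measurable_continuous_onI)
     (auto simp: continuous_on_eq_continuous_at intro: DERIV_isCont[OF bump1_has_deriv])

lemma bump1_deriv_measurable [measurable]: "bump1_deriv k a b \<in> borel_measurable borel"
  by (intro borel_measurable_continuous_onI continuous_bump1_deriv)

lemma bump1_deriv_eq_0: "s \<notin> {a..b} \<Longrightarrow> bump1_deriv k a b s = 0"
  by (auto simp: bump1_deriv_def exp_recip_def)

lemma bump1_deriv_bounded:
  obtains B where "0 \<le> B" "\<And>s. \<bar>bump1_deriv k a b s\<bar> \<le> B"
proof -
  have "bounded (bump1_deriv k a b ` {a..b})"
    by (intro compact_imp_bounded compact_continuous_image continuous_bump1_deriv) simp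
  then obtain B where B: "B > 0" "\<And>s. s \<in> {a..b} \<Longrightarrow> \<bar>bump1_deriv k a b s\<bar> \<le> B"
    unfolding bounded_pos by auto
  have "\<bar>bump1_deriv k a b s\<bar> \<le> B" for s
    using B bump1_deriv_eq_0[of s a b k] by (cases "s \<in> {a..b}") auto
  then show thesis using that[of B] B(1) by simp
qed

text \<open>
  Test with a product of bumps in space and time. First the space bump is sent to the indicator of the
  box; the resulting identity concerns only the space integrals \<open>U(t)\<close>, and sending the time bump to the
  indicator of \<open>[a, b]\<close> then gives the difference of \<open>U\<close> at the end points.
\<close>

lemma weak_time_derivative_box:
  fixes v vt f :: "'a::euclidean_space \<times> real \<Rightarrow> 'b::euclidean_space"
  assumes \<Omega>: "open \<Omega>" and wd: "has_weak_deriv (\<Omega> \<times> {0<..}) (0, 1) v vt"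
    and cd: "cbox c d \<subseteq> \<Omega>" and ab: "0 < a" "a < b"
    and f: "f \<in> borel_measurable borel" "AE z in lebesgue. z \<in> \<Omega> \<times> {0<..} \<longrightarrow> f z = vt z"
    and U: "continuous_on {a..b} (\<lambda>t. \<integral>x. v (x, t) \<partial>lebesgue_on (box c d))"
  shows "(\<integral>x. v (x, b) \<partial>lebesgue_on (box c d)) - (\<integral>x. v (x, a) \<partial>lebesgue_on (box c d))
      = (\<integral>z. indicator (box c d \<times> {a..b}) z *\<^sub>R f z \<partial>lborel)"
    and "integrable lborel (\<lambda>z. indicator (box c d \<times> {a..b}) z *\<^sub>R f z)"
proof -
  let ?W = "\<Omega> \<times> {0::real<..}" and ?K = "cbox c d \<times> {a..b}" and ?Q = "box c d"
  define U where "U t = (\<integral>x. v (x, t) \<partial>lebesgue_on ?Q)" for t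
  have K: "compact ?K" "?K \<subseteq> ?W" "?K \<in> sets borel" "?K \<in> sets lebesgue"
  proof -
    show c: "compact ?K" by (intro compact_Times) auto
    show "?K \<subseteq> ?W" using cd ab by auto
    show "?K \<in> sets borel" by (rule borel_compact[OF c])
    show "?K \<in> sets lebesgue" by (rule compact_sets_lebesgue[OF c])
  qed
  have W: "open ?W" "?W \<in> sets lebesgue" 
  proof -
    show o: "open ?W" using \<Omega> by (intro open_Times) auto
    show "?W \<in> sets lebesgue" using o by simp
  qed
  have loc: "integrable (lebesgue_on ?K) v" "integrable (lebesgue_on ?K) vt"
    using wd K by (auto simp: has_weak_deriv_def locally_integrable_def)
  obtain w where w: "w \<in> borel_measurable borel" "\<And>z. z \<notin> ?K \<Longrightarrow> w z = 0" "AE z in lebesgue. z \<in> ?K \<longrightarrow> w z = v z"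
    using borel_representative[OF K(3) borel_measurable_integrable[OF loc(1)]] by blast
  define g where "g z = indicator ?K z *\<^sub>R f z" for z
  have proj [measurable]: "(fst :: 'a \<times> real \<Rightarrow> 'a) \<in> borel_measurable borel" "(snd :: 'a \<times> real \<Rightarrow> real) \<in> borel_measurable borel"
    by (intro borel_measurable_continuous_onI continuous_on_fst continuous_on_snd continuous_on_id)+
  note [measurable] = w(1) f(1) K(3)
  have g [measurable]: "g \<in> borel_measurable borel" unfolding g_def[abs_def] by measurable
  have gv: "AE z in lebesgue. z \<in> ?K \<longrightarrow> g z = vt z"
    using f(2) by eventually_elim (use K(2) in \<open>auto simp: g_def indicator_def\<close>)
  have wi: "integrable lborel w"
  proof -
    have "AE z in lebesgue. indicator ?K z *\<^sub>R v z = w z"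
      using w(3)
    proof eventually_elim
      case (elim z)
      then show ?case using w(2)[of z] by (cases "z \<in> ?K") simp_all
    qed
    from integral_lebesgue_on_eq_lborel(2)[OF K(4) w(1) this] loc(1) show ?thesis by simp
  qed
  have gi: "integrable lborel g"
  proof -
    have "AE z in lebesgue. indicator ?K z *\<^sub>R vt z = g z"
      using gv
    proof eventually_elim
      case (elim z)
      then show ?case by (cases "z \<in> ?K") (simp_all add: g_def)
    qed
    from integral_lebesgue_on_eq_lborel(2)[OF K(4) g this] loc(2) show ?thesis by simp
  qed
  have Qg: "indicator (?Q \<times> {a..b}) z *\<^sub>R f z = indicator ?Q (fst z) *\<^sub>R g z" for z
    using box_subset_cbox[of c d] by (cases z) (auto simp: g_def indicator_def)
  have Qi: "integrable lborel (\<lambda>z. indicator ?Q (fst z) *\<^sub>R y z)" if "integrable lborel y" for y :: "'a \<times> real \<Rightarrow> 'b"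
  proof (rule Bochner_Integration.integrable_bound[OF that])
    have [measurable]: "y \<in> borel_measurable borel" using borel_measurable_integrable[OF that] by simp
    have [measurable]: "?Q \<in> sets borel" by simp
    have [measurable]: "(\<lambda>z :: 'a \<times> real. indicator ?Q (fst z) :: real) \<in> borel_measurable borel"
      by (rule measurable_compose[OF proj(1)]) simp
    show "(\<lambda>z. indicator ?Q (fst z) *\<^sub>R y z) \<in> borel_measurable lborel" by measurable
  qed (auto simp: indicator_def)
  show "integrable lborel (\<lambda>z. indicator (?Q \<times> {a..b}) z *\<^sub>R f z)" unfolding Qg by (rule Qi[OF gi])
  have weak: "(\<integral>z. bump j c d (fst z) *\<^sub>R (bump1_deriv k a b (snd z) *\<^sub>R w z) \<partial>lborel)
      = - (\<integral>z. bump j c d (fst z) *\<^sub>R (bump1 k a b (snd z) *\<^sub>R g z) \<partial>lborel)" for j k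
  proof -
    let ?\<phi> = "\<lambda>z :: 'a \<times> real. bump j c d (fst z) * bump1 k a b (snd z)"
    have T: "test_function ?W ?\<phi>" by (rule test_function_time_bump[OF K(2)])
    then have fd: "frechet_derivative ?\<phi> (at z) (0, 1) = bump j c d (fst z) * bump1_deriv k a b (snd z)" for z
      by (intro frechet_derivative_time_bump) (simp add: test_function_def)
    have out: "bump j c d (fst z) * bump1_deriv k a b (snd z) = 0" "?\<phi> z = 0" if "z \<notin> ?K" for z
    proof -
      have "fst z \<notin> ?Q \<or> snd z \<notin> {a..b}" using that box_subset_cbox[of c d] by (cases z) auto
      then show "bump j c d (fst z) * bump1_deriv k a b (snd z) = 0" "?\<phi> z = 0"
        using bump_eq_0[of "fst z" c d j] bump1_deriv_eq_0[of "snd z" a b k] bump1_eq_0[of "snd z" a b k] by auto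
    qed
    have A: "(\<integral>z. frechet_derivative ?\<phi> (at z) (0, 1) *\<^sub>R v z \<partial>lebesgue_on ?W)
        = (\<integral>z. bump j c d (fst z) *\<^sub>R (bump1_deriv k a b (snd z) *\<^sub>R w z) \<partial>lborel)"
    proof (rule integral_lebesgue_on_eq_lborel(1)[OF W(2)])
      show "AE z in lebesgue. indicator ?W z *\<^sub>R frechet_derivative ?\<phi> (at z) (0, 1) *\<^sub>R v z
          = bump j c d (fst z) *\<^sub>R (bump1_deriv k a b (snd z) *\<^sub>R w z)"
        using w(3)
      proof eventually_elim
        case (elim z)
        show ?case
        proof (cases "z \<in> ?K")
          case True
          then have "z \<in> ?W" using K(2) by blast
          then show ?thesis using True elim by (simp add: fd)
        next
          case False
          then show ?thesis using out(1)[OF False] w(2)[OF False] by (simp add: fd)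
        qed
      qed
    qed measurable
    have B: "(\<integral>z. ?\<phi> z *\<^sub>R vt z \<partial>lebesgue_on ?W)
        = (\<integral>z. bump j c d (fst z) *\<^sub>R (bump1 k a b (snd z) *\<^sub>R g z) \<partial>lborel)"
    proof (rule integral_lebesgue_on_eq_lborel(1)[OF W(2)])
      show "AE z in lebesgue. indicator ?W z *\<^sub>R ?\<phi> z *\<^sub>R vt z
          = bump j c d (fst z) *\<^sub>R (bump1 k a b (snd z) *\<^sub>R g z)"
        using gv
      proof eventually_elim
        case (elim z)
        show ?case
        proof (cases "z \<in> ?K")
          case True
          then have "z \<in> ?W" using K(2) by blast
          then show ?thesis using True elim by simp
        next
          case False
          then show ?thesis using out(2)[OF False] by (simp add: g_def)
        qed
      qed
    qed measurable
    show ?thesis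
      using wd[unfolded has_weak_deriv_def, THEN conjunct2, THEN conjunct2, rule_format, OF T] unfolding A B .
  qed
  have space_limit: "(\<lambda>j. \<integral>z. bump j c d (fst z) *\<^sub>R y z \<partial>lborel) \<longlonglongrightarrow> (\<integral>z. indicator ?Q (fst z) *\<^sub>R y z \<partial>lborel)"
    if y: "integrable lborel y" for y :: "'a \<times> real \<Rightarrow> 'b"
  proof (rule integral_dominated_convergence[where w="\<lambda>z. norm (y z)"])
    have [measurable]: "y \<in> borel_measurable borel" using borel_measurable_integrable[OF y] by simp
    show "(\<lambda>z. bump j c d (fst z) *\<^sub>R y z) \<in> borel_measurable lborel" for j by measurable
    show "(\<lambda>z. indicator ?Q (fst z) *\<^sub>R y z) \<in> borel_measurable lborel"
      by (rule borel_measurable_integrable[OF Qi[OF y]])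
    show "AE z in lborel. (\<lambda>j. bump j c d (fst z) *\<^sub>R y z) \<longlonglongrightarrow> indicator ?Q (fst z) *\<^sub>R y z"
      by (intro AE_I2 tendsto_scaleR bump_tendsto tendsto_const)
    show "AE z in lborel. norm (bump j c d (fst z) *\<^sub>R y z) \<le> norm (y z)" for j
    proof (rule AE_I2)
      fix z
      show "norm (bump j c d (fst z) *\<^sub>R y z) \<le> norm (y z)"
        using bump_bounds[of j c d "fst z"] by (simp add: mult_left_le_one_le)
    qed
  qed (use y in simp)
  have dwi: "integrable lborel (\<lambda>z. bump1_deriv k a b (snd z) *\<^sub>R w z)" for k
  proof -
    obtain B where B: "0 \<le> B" "\<And>s. \<bar>bump1_deriv k a b s\<bar> \<le> B" by (rule bump1_deriv_bounded[of k a b]) blast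
    show ?thesis
    proof (rule Bochner_Integration.integrable_bound)
      show "integrable lborel (\<lambda>z. B * norm (w z))" using wi by simp
      show "(\<lambda>z. bump1_deriv k a b (snd z) *\<^sub>R w z) \<in> borel_measurable lborel" by measurable
      show "AE z in lborel. norm (bump1_deriv k a b (snd z) *\<^sub>R w z) \<le> norm (B * norm (w z))"
        using B by (intro AE_I2) (auto simp: abs_mult intro: mult_right_mono)
    qed
  qed
  have bgi: "integrable lborel (\<lambda>z. bump1 k a b (snd z) *\<^sub>R g z)" for k
  proof (rule Bochner_Integration.integrable_bound[OF gi])
    show "(\<lambda>z. bump1 k a b (snd z) *\<^sub>R g z) \<in> borel_measurable lborel" by measurable
    show "AE z in lborel. norm (bump1 k a b (snd z) *\<^sub>R g z) \<le> norm (g z)"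
    proof (rule AE_I2)
      fix z
      show "norm (bump1 k a b (snd z) *\<^sub>R g z) \<le> norm (g z)"
        using bump1_bounds[of k a b "snd z"] by (simp add: mult_left_le_one_le)
    qed
  qed
  have weak2: "(\<integral>z. indicator ?Q (fst z) *\<^sub>R (bump1_deriv k a b (snd z) *\<^sub>R w z) \<partial>lborel)
      = - (\<integral>z. indicator ?Q (fst z) *\<^sub>R (bump1 k a b (snd z) *\<^sub>R g z) \<partial>lborel)" for k
    using LIMSEQ_unique[OF space_limit[OF dwi[of k]]] tendsto_minus[OF space_limit[OF bgi[of k]]]
    unfolding weak by blast
  have "AE t in lborel. AE x in lborel. (x, t) \<in> ?K \<longrightarrow> w (x, t) = v (x, t)"
    by (rule AE_lebesgue_sections[OF w(3)])
  then have Uw: "AE t in lborel. t \<in> {a..b} \<longrightarrow> (\<integral>x. indicator ?Q x *\<^sub>R w (x, t) \<partial>lborel) = U t"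
  proof eventually_elim
    case (elim t)
    show ?case
    proof
      assume t: "t \<in> {a..b}"
      have "AE x in lebesgue. indicator ?Q x *\<^sub>R v (x, t) = indicator ?Q x *\<^sub>R w (x, t)"
        by (rule AE_completion, use elim in eventually_elim) (use t box_subset_cbox[of c d] in \<open>auto simp: indicator_def\<close>)
      moreover have "(\<lambda>x. indicator ?Q x *\<^sub>R w (x, t)) \<in> borel_measurable borel" by measurable
      ultimately show "(\<integral>x. indicator ?Q x *\<^sub>R w (x, t) \<partial>lborel) = U t"
        unfolding U_def by (intro integral_lebesgue_on_eq_lborel(1)[symmetric]) auto
    qed
  qed
  have lhs: "(\<integral>z. indicator ?Q (fst z) *\<^sub>R (bump1_deriv k a b (snd z) *\<^sub>R w z) \<partial>lborel)
      = integral {a..b} (\<lambda>t. bump1_deriv k a b t *\<^sub>R U t)" for k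
  proof -
    let ?h = "\<lambda>x t. indicator ?Q x *\<^sub>R (bump1_deriv k a b t *\<^sub>R w (x, t))"
    have i: "integrable (lborel \<Otimes>\<^sub>M lborel) (case_prod ?h)"
      using Qi[OF dwi[of k]] unfolding lborel_prod by (simp add: case_prod_beta')
    have "(\<integral>z. indicator ?Q (fst z) *\<^sub>R (bump1_deriv k a b (snd z) *\<^sub>R w z) \<partial>lborel) = (\<integral>t. (\<integral>x. ?h x t \<partial>lborel) \<partial>lborel)"
      using lborel_pair.integral_snd[OF i] unfolding lborel_prod by (simp add: case_prod_beta')
    also have "\<dots> = (\<integral>t. indicator {a..b} t *\<^sub>R (bump1_deriv k a b t *\<^sub>R U t) \<partial>lborel)"
    proof (rule integral_cong_AE)
      show "(\<lambda>t. \<integral>x. ?h x t \<partial>lborel) \<in> borel_measurable lborel"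
        by (rule borel_measurable_integrable[OF lborel_pair.integrable_snd[OF i]])
      show "(\<lambda>t. indicator {a..b} t *\<^sub>R (bump1_deriv k a b t *\<^sub>R U t)) \<in> borel_measurable lborel"
        using borel_measurable_continuous_on_indicator[of "{a..b}" "\<lambda>t. bump1_deriv k a b t *\<^sub>R U t"] U
        by (simp add: continuous_on_scaleR continuous_bump1_deriv U_def[abs_def])
      show "AE t in lborel. (\<integral>x. ?h x t \<partial>lborel) = indicator {a..b} t *\<^sub>R (bump1_deriv k a b t *\<^sub>R U t)"
        using Uw
      proof eventually_elim
        case (elim t)
        have "(\<integral>x. ?h x t \<partial>lborel) = bump1_deriv k a b t *\<^sub>R (\<integral>x. indicator ?Q x *\<^sub>R w (x, t) \<partial>lborel)"
          unfolding scaleR_left_commute[of "indicator ?Q _"] by (rule integral_scaleR_right)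
        then show ?case using elim bump1_deriv_eq_0[of t a b k] by (cases "t \<in> {a..b}") auto
      qed
    qed
    also have "\<dots> = integral {a..b} (\<lambda>t. bump1_deriv k a b t *\<^sub>R U t)"
    proof (rule lborel_integral_eq_HK(2)[symmetric])
      have "set_integrable lborel {a..b} (\<lambda>t. bump1_deriv k a b t *\<^sub>R U t)"
        unfolding set_integrable_def using U
        by (intro borel_integrable_compact continuous_on_scaleR continuous_bump1_deriv) (auto simp: U_def[abs_def])
      then show "integrable lborel (\<lambda>t. indicator {a..b} t *\<^sub>R (bump1_deriv k a b t *\<^sub>R U t))"
        by (simp add: set_integrable_def)
    qed
    finally show ?thesis .
  qed
  have rhs: "(\<lambda>k. \<integral>z. indicator ?Q (fst z) *\<^sub>R (bump1 k a b (snd z) *\<^sub>R g z) \<partial>lborel)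
      \<longlonglongrightarrow> (\<integral>z. indicator ?Q (fst z) *\<^sub>R g z \<partial>lborel)"
  proof (rule integral_dominated_convergence[where w="\<lambda>z. norm (g z)"])
    show "(\<lambda>z. indicator ?Q (fst z) *\<^sub>R (bump1 k a b (snd z) *\<^sub>R g z)) \<in> borel_measurable lborel" for k
      by (rule borel_measurable_integrable[OF Qi[OF bgi]])
    show "(\<lambda>z. indicator ?Q (fst z) *\<^sub>R g z) \<in> borel_measurable lborel"
      by (rule borel_measurable_integrable[OF Qi[OF gi]])
    show "integrable lborel (\<lambda>z. norm (g z))" using gi by simp
    have "AE z in lborel \<Otimes>\<^sub>M lborel. snd z \<noteq> a \<and> snd z \<noteq> b"
    proof (rule lborel_pair.AE_pair_measure)
      show "{z \<in> space (lborel \<Otimes>\<^sub>M lborel). snd z \<noteq> a \<and> snd z \<noteq> b} \<in> sets (lborel \<Otimes>\<^sub>M lborel)" by measurable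
      have "AE t in lborel. t \<noteq> a \<and> t \<noteq> b" using AE_lborel_singleton[of a] AE_lborel_singleton[of b] by eventually_elim simp
      then show "AE x in lborel. AE t in lborel. snd (x, t) \<noteq> a \<and> snd (x, t) \<noteq> b" by simp
    qed
    then have "AE z :: 'a \<times> real in lborel. snd z \<noteq> a \<and> snd z \<noteq> b" unfolding lborel_prod .
    then show "AE z in lborel. (\<lambda>k. indicator ?Q (fst z) *\<^sub>R (bump1 k a b (snd z) *\<^sub>R g z)) \<longlonglongrightarrow> indicator ?Q (fst z) *\<^sub>R g z"
    proof eventually_elim
      case (elim z)
      have "(\<lambda>k. bump1 k a b (snd z) *\<^sub>R g z) \<longlonglongrightarrow> indicator {a<..<b} (snd z) *\<^sub>R g z"
        by (intro tendsto_scaleR bump1_tendsto tendsto_const)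
      also have "indicator {a<..<b} (snd z) *\<^sub>R g z = g z"
        using elim by (cases z) (auto simp: g_def indicator_def)
      finally show ?case by (intro tendsto_scaleR tendsto_const)
    qed
    show "AE z in lborel. norm (indicator ?Q (fst z) *\<^sub>R (bump1 k a b (snd z) *\<^sub>R g z)) \<le> norm (g z)" for k
    proof (rule AE_I2)
      fix z
      show "norm (indicator ?Q (fst z) *\<^sub>R (bump1 k a b (snd z) *\<^sub>R g z)) \<le> norm (g z)"
        using bump1_bounds[of k a b "snd z"] by (auto simp: mult_left_le_one_le indicator_def)
    qed
  qed
  have "(\<lambda>k. integral {a..b} (\<lambda>t. bump1_deriv k a b t *\<^sub>R U t)) \<longlonglongrightarrow> U a - U b"
    using U by (intro bump1_deriv_integral_tendsto ab) (simp add: U_def[abs_def])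
  from LIMSEQ_unique[OF this tendsto_minus[OF rhs, unfolded weak2[symmetric] lhs]]
  have "U b - U a = (\<integral>z. indicator ?Q (fst z) *\<^sub>R g z \<partial>lborel)" by (simp add: algebra_simps)
  then show "(\<integral>x. v (x, b) \<partial>lebesgue_on ?Q) - (\<integral>x. v (x, a) \<partial>lebesgue_on ?Q)
      = (\<integral>z. indicator (?Q \<times> {a..b}) z *\<^sub>R f z \<partial>lborel)"
    unfolding Qg U_def .
qed

section \<open>From weak solutions to the abstract flow\<close>

lemma borel_measurable_lebesgue_on_pair:
  fixes f :: "'a::euclidean_space \<times> real \<Rightarrow> 'b::euclidean_space"
  assumes "f \<in> borel_measurable borel"
  shows "f \<in> borel_measurable (lebesgue_on \<Omega> \<Otimes>\<^sub>M lborel)"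
proof -
  have "(\<lambda>x. x) \<in> borel_measurable (lebesgue_on \<Omega>)"
    using id_borel_measurable_lebesgue_on[of \<Omega>] by (simp add: id_def)
  then have "fst \<in> borel_measurable (lebesgue_on \<Omega> \<Otimes>\<^sub>M (lborel :: real measure))"
    by (rule measurable_compose[OF measurable_fst])
  moreover have "snd \<in> borel_measurable (lebesgue_on \<Omega> \<Otimes>\<^sub>M (lborel :: real measure))"
    using measurable_snd[of "lebesgue_on \<Omega>" "lborel :: real measure"] by simp
  ultimately have "(\<lambda>z. (fst z, snd z)) \<in> lebesgue_on \<Omega> \<Otimes>\<^sub>M (lborel :: real measure) \<rightarrow>\<^sub>M borel"
    by (rule borel_measurable_Pair)
  from measurable_compose[OF this assms] show ?thesis by simp
qed

lemma Lp_on_time_slab: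
  fixes vt f :: "'a::euclidean_space \<times> real \<Rightarrow> 'b::euclidean_space"
  assumes \<Omega>: "open \<Omega>" and vt: "Lp p (\<Omega> \<times> {0<..<T}) vt"
    and f: "f \<in> borel_measurable borel" "AE z in lebesgue. z \<in> \<Omega> \<times> {0<..} \<longrightarrow> f z = vt z"
  shows "Lp_on p (lebesgue_on \<Omega> \<Otimes>\<^sub>M lborel) (\<lambda>z. indicator {0<..<T} (snd z) *\<^sub>R f z)"
proof -
  let ?W = "\<Omega> \<times> {0<..<T}" and ?F = "\<lambda>z. indicator {0<..<T} (snd z) *\<^sub>R f z"
  have [simp]: "\<Omega> \<in> sets lebesgue" "\<Omega> \<in> sets borel" using \<Omega> by auto
  have oW: "open ?W" using \<Omega> by (intro open_Times) auto
  have W: "?W \<in> sets lebesgue" using oW by simp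
  have snd_m: "(snd :: 'a \<times> real \<Rightarrow> real) \<in> borel_measurable borel"
    by (intro borel_measurable_continuous_onI continuous_on_snd continuous_on_id)
  have fst_m: "(fst :: 'a \<times> real \<Rightarrow> 'a) \<in> borel_measurable borel"
    by (intro borel_measurable_continuous_onI continuous_on_fst continuous_on_id)
  have "(\<lambda>z :: 'a \<times> real. indicator {0<..<T} (snd z) :: real) \<in> borel_measurable borel"
    by (rule measurable_compose[OF snd_m]) simp
  then have F: "?F \<in> borel_measurable borel" using f(1) by (intro borel_measurable_scaleR)
  let ?n = "\<lambda>z. norm (?F z) powr p"
  have n: "?n \<in> borel_measurable borel" using F by measurable
  have "(\<lambda>z :: 'a \<times> real. indicator \<Omega> (fst z) :: real) \<in> borel_measurable borel"
    by (rule measurable_compose[OF fst_m]) (rule borel_measurable_indicator, simp)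
  then have nO: "(\<lambda>z. indicator \<Omega> (fst z) *\<^sub>R ?n z) \<in> borel_measurable borel"
    using n by (intro borel_measurable_scaleR)
  have "AE z in lebesgue. indicator ?W z *\<^sub>R (norm (vt z) powr p) = indicator \<Omega> (fst z) *\<^sub>R ?n z"
    using f(2)
  proof eventually_elim
    case (elim z)
    then show ?case by (cases z) (auto simp: indicator_def)
  qed
  from integral_lebesgue_on_eq_lborel(2)[OF W nO this]
  have fin: "integrable lborel (\<lambda>z. indicator \<Omega> (fst z) *\<^sub>R ?n z)"
    using vt by (simp add: Lp_def)
  have "integrable (lebesgue_on \<Omega> \<Otimes>\<^sub>M lborel) ?n"
  proof (rule integrableI_bounded)
    show "?n \<in> borel_measurable (lebesgue_on \<Omega> \<Otimes>\<^sub>M lborel)" by (rule borel_measurable_lebesgue_on_pair[OF n])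
    have "(\<integral>\<^sup>+z. ennreal (norm (?n z)) \<partial>(lebesgue_on \<Omega> \<Otimes>\<^sub>M lborel))
        = (\<integral>\<^sup>+x. (\<integral>\<^sup>+t. ennreal (norm (?n (x, t))) \<partial>lborel) \<partial>lebesgue_on \<Omega>)"
      by (rule lborel.nn_integral_fst[symmetric, OF measurable_compose[OF
            measurable_compose[OF borel_measurable_lebesgue_on_pair[OF n] borel_measurable_norm] measurable_ennreal]])
    also have "\<dots> = (\<integral>\<^sup>+x. (\<integral>\<^sup>+t. ennreal (norm (?n (x, t))) \<partial>lborel) * indicator \<Omega> x \<partial>lebesgue)"
      by (simp add: nn_integral_restrict_space)
    also have "\<dots> = (\<integral>\<^sup>+x. (\<integral>\<^sup>+t. ennreal (norm (?n (x, t))) \<partial>lborel) * indicator \<Omega> x \<partial>lborel)"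
      by (rule nn_integral_completion)
    also have "\<dots> = (\<integral>\<^sup>+x. (\<integral>\<^sup>+t. ennreal (norm (indicator \<Omega> x *\<^sub>R ?n (x, t))) \<partial>lborel) \<partial>lborel)"
      by (intro nn_integral_cong) (simp add: indicator_def)
    also have "\<dots> = (\<integral>\<^sup>+z. ennreal (norm (indicator \<Omega> (fst z) *\<^sub>R ?n z)) \<partial>(lborel \<Otimes>\<^sub>M lborel))"
    proof -
      have "(\<lambda>z. ennreal (norm (indicator \<Omega> (fst z) *\<^sub>R ?n z))) \<in> borel_measurable (lborel \<Otimes>\<^sub>M lborel)"
        unfolding lborel_prod
        by (intro measurable_compose[OF _ measurable_ennreal] measurable_compose[OF _ borel_measurable_norm])
           (use nO in simp)
      from lborel.nn_integral_fst[OF this] show ?thesis by simp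
    qed
    also have "\<dots> < \<infinity>" unfolding lborel_prod using fin by (simp add: integrable_iff_bounded)
    finally show "(\<integral>\<^sup>+z. ennreal (norm (?n z)) \<partial>(lebesgue_on \<Omega> \<Otimes>\<^sub>M lborel)) < \<infinity>" .
  qed
  then show ?thesis using borel_measurable_lebesgue_on_pair[OF F] by (intro Lp_onI)
qed

text \<open>
  Both sides have the same integral over every box in \<open>\<Omega>\<close>. Continuity in \<open>L\<^sup>p\<close> makes the space integrals
  continuous in time, as the end point values require.
\<close>

lemma increment_eq_integral_weak_derivative:
  fixes v vt f :: "'a::euclidean_space \<times> real \<Rightarrow> 'b::euclidean_space"
  assumes \<Omega>: "open \<Omega>" "bounded \<Omega>" and p: "1 < p"
    and wd: "has_weak_deriv (\<Omega> \<times> {0<..}) (0, 1) v vt"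
    and f: "f \<in> borel_measurable borel" "AE z in lebesgue. z \<in> \<Omega> \<times> {0<..} \<longrightarrow> f z = vt z"
    and fT: "Lp_on p (lebesgue_on \<Omega> \<Otimes>\<^sub>M lborel) (\<lambda>z. indicator {0<..<T} (snd z) *\<^sub>R f z)"
    and v: "\<And>t. 0 \<le> t \<Longrightarrow> Lp_on p (lebesgue_on \<Omega>) (\<lambda>x. v (x, t))"
      "\<And>t. 0 \<le> t \<Longrightarrow> ((\<lambda>s. Lp_int p (lebesgue_on \<Omega>) (\<lambda>x. v (x, s) - v (x, t))) \<longlongrightarrow> 0) (at t within {0..})"
    and ab: "0 < a" "a < b" "b < T"
  shows "AE x in lebesgue_on \<Omega>. v (x, b) - v (x, a)
    = (\<integral>r. indicator {a..b} r *\<^sub>R (indicator {0<..<T} r *\<^sub>R f (x, r)) \<partial>lborel)"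
proof -
  have [simp]: "\<Omega> \<in> sets lebesgue" using \<Omega> by simp
  interpret M: finite_measure "lebesgue_on \<Omega>"
    using \<Omega> by (intro finite_measure_lebesgue_on lmeasurable_open)
  interpret pair: pair_sigma_finite "lebesgue_on \<Omega>" "lborel :: real measure"
    by (rule M.pair_sigma_finite_lborel)
  let ?I = "\<lambda>x. \<integral>r. indicator {a..b} r *\<^sub>R (indicator {0<..<T} r *\<^sub>R f (x, r)) \<partial>lborel"
  have Ieq: "?I x = (\<integral>r. indicator {a..b} r *\<^sub>R f (x, r) \<partial>lborel)" for x
    using ab by (intro Bochner_Integration.integral_cong) (auto simp: indicator_def)
  have slab: "Lp_on p (lebesgue_on \<Omega> \<Otimes>\<^sub>M lborel) (\<lambda>z. indicator {a..b} (snd z) :: real)"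
  proof
    show m: "(\<lambda>z. indicator {a..b} (snd z) :: real) \<in> borel_measurable (lebesgue_on \<Omega> \<Otimes>\<^sub>M lborel)" by measurable
    have "integrable (lebesgue_on \<Omega> \<Otimes>\<^sub>M lborel) (indicator (\<Omega> \<times> {a..b}) :: _ \<Rightarrow> real)"
    proof (rule integrable_real_indicator)
      show s: "\<Omega> \<times> {a..b} \<in> sets (lebesgue_on \<Omega> \<Otimes>\<^sub>M lborel)" by (intro pair_measureI) auto
      have "emeasure (lebesgue_on \<Omega> \<Otimes>\<^sub>M lborel) (\<Omega> \<times> {a..b}) = emeasure (lebesgue_on \<Omega>) \<Omega> * emeasure lborel {a..b}"
        by (intro lborel.emeasure_pair_measure_Times) auto
      also have "\<dots> < \<infinity>" using ab
        by (simp add: less_top[symmetric] ennreal_mult_eq_top_iff)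
      finally show "emeasure (lebesgue_on \<Omega> \<Otimes>\<^sub>M lborel) (\<Omega> \<times> {a..b}) < \<infinity>" .
    qed
    then show "integrable (lebesgue_on \<Omega> \<Otimes>\<^sub>M lborel) (\<lambda>z. norm (indicator {a..b} (snd z) :: real) powr p)"
      by (rule Bochner_Integration.integrable_cong[THEN iffD1, rotated -1])
         (auto simp: indicator_def space_pair_measure)
  qed
  have "integrable (lebesgue_on \<Omega> \<Otimes>\<^sub>M lborel) (\<lambda>z. norm (indicator {a..b} (snd z) *\<^sub>R (indicator {0<..<T} (snd z) *\<^sub>R f z)))"
    by (rule Bochner_Integration.integrable_cong[THEN iffD1, OF refl _ integrable_powr_mult[OF p slab fT]])
       (auto simp: indicator_def)
  moreover have "(\<lambda>z. indicator {a..b} (snd z) *\<^sub>R (indicator {0<..<T} (snd z) *\<^sub>R f z)) \<in> borel_measurable (lebesgue_on \<Omega> \<Otimes>\<^sub>M lborel)"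
    using Lp_on_measurable[OF slab] Lp_on_measurable[OF fT] by (rule borel_measurable_scaleR)
  ultimately have "integrable (lebesgue_on \<Omega> \<Otimes>\<^sub>M lborel) (\<lambda>z. indicator {a..b} (snd z) *\<^sub>R (indicator {0<..<T} (snd z) *\<^sub>R f z))"
    by (simp only: integrable_norm_iff)
  then have "integrable (lebesgue_on \<Omega> \<Otimes>\<^sub>M lborel)
      (case_prod (\<lambda>x r. indicator {a..b} r *\<^sub>R (indicator {0<..<T} r *\<^sub>R f (x, r))))"
    by (simp add: case_prod_beta')
  from pair.integrable_fst[OF this] have I: "integrable (lebesgue_on \<Omega>) ?I" .
  have vi: "integrable (lebesgue_on \<Omega>) (\<lambda>x. v (x, t))" if "0 \<le> t" for t
    using M.Lp_on_L1(1)[OF p v(1)[OF that]] .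
  define h where "h x = v (x, b) - v (x, a) - ?I x" for x
  have hi: "integrable (lebesgue_on \<Omega>) h" unfolding h_def
    using ab by (intro Bochner_Integration.integrable_diff vi I) auto
  have sub_int: "integrable (lebesgue_on Q) y" if "Q \<subseteq> \<Omega>" "Q \<in> sets lebesgue" "integrable (lebesgue_on \<Omega>) y"
    for Q and y :: "'a \<Rightarrow> 'b"
    using integrable_lebesgue_on_subset(1)[OF that(1,2), of y] that
      integrable_mult_indicator[of Q "lebesgue_on \<Omega>" y] by (auto simp: sets_restrict_space_iff)
  have "AE x in lebesgue_on \<Omega>. h x = 0"
  proof (rule AE_eq_0_if_box_integrals_0[OF \<Omega>(1) integrable_imp_locally_integrable[OF hi \<Omega>(1)]])
    fix c d assume cd: "cbox c d \<subseteq> \<Omega>"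
    let ?Q = "box c d"
    have Q: "?Q \<subseteq> \<Omega>" "?Q \<in> sets lebesgue" using cd box_subset_cbox[of c d] by auto
    have "continuous_on {a..b} (\<lambda>t. \<integral>x. v (x, t) \<partial>lebesgue_on ?Q)"
      unfolding continuous_on_def
    proof
      fix t assume t: "t \<in> {a..b}"
      then have t0: "0 \<le> t" using ab by simp
      let ?c = "measure (lebesgue_on \<Omega>) (space (lebesgue_on \<Omega>)) powr (1 - 1 / p)"
      let ?L = "\<lambda>s. Lp_int p (lebesgue_on \<Omega>) (\<lambda>x. v (x, s) - v (x, t))"
      have "(?L \<longlongrightarrow> 0) (at t within {a..b})"
        by (rule tendsto_within_subset[OF v(2)[OF t0]]) (use ab in auto)
      from tendsto_mult[OF tendsto_const Lp_int_tendsto_0_powr[OF p this], of ?c]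
      have lim: "((\<lambda>s. ?c * ?L s powr (1 / p)) \<longlongrightarrow> 0) (at t within {a..b})" by simp
      have "\<forall>\<^sub>F s in at t within {a..b}. norm ((\<integral>x. v (x, s) \<partial>lebesgue_on ?Q) - (\<integral>x. v (x, t) \<partial>lebesgue_on ?Q))
          \<le> ?c * ?L s powr (1 / p)"
        unfolding eventually_at_filter
      proof (intro always_eventually allI impI)
        fix s assume "s \<in> {a..b}"
        then have s0: "0 \<le> s" using ab by simp
        have d: "Lp_on p (lebesgue_on \<Omega>) (\<lambda>x. v (x, s) - v (x, t))" using p by (intro Lp_on_diff v s0 t0) auto
        have di: "integrable (lebesgue_on \<Omega>) (\<lambda>x. v (x, s) - v (x, t))" by (rule M.Lp_on_L1(1)[OF p d])
        have "(\<integral>x. v (x, s) \<partial>lebesgue_on ?Q) - (\<integral>x. v (x, t) \<partial>lebesgue_on ?Q)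
            = (\<integral>x. v (x, s) - v (x, t) \<partial>lebesgue_on ?Q)"
          by (rule Bochner_Integration.integral_diff[symmetric, OF sub_int[OF Q vi[OF s0]] sub_int[OF Q vi[OF t0]]])
        also have "\<dots> = (\<integral>x. indicator ?Q x *\<^sub>R (v (x, s) - v (x, t)) \<partial>lebesgue_on \<Omega>)"
          by (rule integrable_lebesgue_on_subset(2)[OF Q, symmetric]) simp
        also have "norm \<dots> \<le> (\<integral>x. norm (indicator ?Q x *\<^sub>R (v (x, s) - v (x, t))) \<partial>lebesgue_on \<Omega>)"
          by (rule Bochner_Integration.integral_norm_bound)
        also have "\<dots> \<le> (\<integral>x. norm (v (x, s) - v (x, t)) \<partial>lebesgue_on \<Omega>)"
          by (rule Bochner_Integration.integral_mono_AE', rule integrable_norm[OF di])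
             (auto simp: indicator_def)
        also have "\<dots> \<le> ?c * ?L s powr (1 / p)" by (rule M.Lp_on_L1(2)[OF p d])
        finally show "norm ((\<integral>x. v (x, s) \<partial>lebesgue_on ?Q) - (\<integral>x. v (x, t) \<partial>lebesgue_on ?Q))
          \<le> ?c * ?L s powr (1 / p)" .
      qed
      then have "((\<lambda>s. (\<integral>x. v (x, s) \<partial>lebesgue_on ?Q) - (\<integral>x. v (x, t) \<partial>lebesgue_on ?Q)) \<longlongrightarrow> 0) (at t within {a..b})"
        by (rule Lim_null_comparison[OF _ lim])
      then show "((\<lambda>s. \<integral>x. v (x, s) \<partial>lebesgue_on ?Q) \<longlongrightarrow> (\<integral>x. v (x, t) \<partial>lebesgue_on ?Q)) (at t within {a..b})"
        by (rule LIM_zero_cancel)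
    qed
    note wt = weak_time_derivative_box[OF \<Omega>(1) wd cd ab(1,2) f this]
    have i: "integrable (lborel \<Otimes>\<^sub>M lborel) (case_prod (\<lambda>x r. indicator ?Q x *\<^sub>R (indicator {a..b} r *\<^sub>R f (x, r))))"
    proof -
      have "indicator (?Q \<times> {a..b}) z = (indicator ?Q (fst z) * indicator {a..b} (snd z) :: real)" for z
        by (cases z) (simp add: indicator_def)
      then show ?thesis using wt(2) unfolding lborel_prod by (simp add: case_prod_beta')
    qed
    have "(\<integral>x. ?I x \<partial>lebesgue_on ?Q) = (\<integral>x. indicator ?Q x *\<^sub>R (\<integral>r. indicator {a..b} r *\<^sub>R f (x, r) \<partial>lborel) \<partial>lborel)"
    proof (rule integral_lebesgue_on_eq_lborel(1)[OF Q(2)])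
      have "(\<lambda>x. \<integral>r. indicator ?Q x *\<^sub>R (indicator {a..b} r *\<^sub>R f (x, r)) \<partial>lborel) \<in> borel_measurable lborel"
        by (rule borel_measurable_integrable[OF lborel_pair.integrable_fst[OF i]])
      then show "(\<lambda>x. indicator ?Q x *\<^sub>R (\<integral>r. indicator {a..b} r *\<^sub>R f (x, r) \<partial>lborel)) \<in> borel_measurable borel"
        by (simp only: integral_scaleR_right measurable_lborel1 measurable_lborel2)
    qed (unfold Ieq, simp)
    also have "\<dots> = (\<integral>x. (\<integral>r. indicator ?Q x *\<^sub>R (indicator {a..b} r *\<^sub>R f (x, r)) \<partial>lborel) \<partial>lborel)"
      by (simp only: integral_scaleR_right)
    also have "\<dots> = (\<integral>z. indicator (?Q \<times> {a..b}) z *\<^sub>R f z \<partial>lborel)"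
      unfolding lborel_pair.integral_fst[OF i] lborel_prod
      by (intro Bochner_Integration.integral_cong) (auto simp: indicator_def)
    finally have IQ: "(\<integral>x. ?I x \<partial>lebesgue_on ?Q) = (\<integral>z. indicator (?Q \<times> {a..b}) z *\<^sub>R f z \<partial>lborel)" .
    have "(\<integral>x. h x \<partial>lebesgue_on (cbox c d)) = (\<integral>x. h x \<partial>lebesgue_on ?Q)"
      using sub_int[OF cd _ hi] sub_int[OF Q hi] by (simp add: lebesgue_integral_eq_integral integral_open_interval)
    also have "\<dots> = (\<integral>x. v (x, b) \<partial>lebesgue_on ?Q) - (\<integral>x. v (x, a) \<partial>lebesgue_on ?Q) - (\<integral>x. ?I x \<partial>lebesgue_on ?Q)"
    proof -
      have i: "integrable (lebesgue_on ?Q) (\<lambda>x. v (x, b))" "integrable (lebesgue_on ?Q) (\<lambda>x. v (x, a))"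
        "integrable (lebesgue_on ?Q) ?I"
        using ab by (simp_all only: sub_int[OF Q vi] sub_int[OF Q I] less_imp_le order.strict_trans)
      show ?thesis unfolding h_def
        Bochner_Integration.integral_diff[OF Bochner_Integration.integrable_diff[OF i(1,2)] i(3)]
        Bochner_Integration.integral_diff[OF i(1,2)] ..
    qed
    also have "\<dots> = 0" using wt(1) IQ by simp
    finally show "(\<integral>x. h x \<partial>lebesgue_on (cbox c d)) = 0" .
  qed
  then show ?thesis by eventually_elim (simp add: h_def)
qed

lemma AE_lborel_avoid_borel_null:
  assumes "AE t in lborel. P t"
  obtains N where "N \<in> sets borel" "AE t in lborel. t \<notin> N" "\<And>t. t \<notin> N \<Longrightarrow> P t"
proof -
  obtain N where N: "{t \<in> space lborel. \<not> P t} \<subseteq> N" "N \<in> null_sets lborel"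
    using assms unfolding eventually_ae_filter by blast
  show thesis
  proof (rule that)
    show "N \<in> sets borel" using null_setsD2[OF N(2)] by simp
    show "AE t in lborel. t \<notin> N" by (rule AE_not_in[OF N(2)])
    show "P t" if "t \<notin> N" for t using N(1) that by auto
  qed
qed

lemma AE_lebesgue_on_interval_imp_lborel:
  fixes T :: real
  assumes "AE t in lebesgue_on {0..T}. P t"
  shows "AE t in lborel. 0 < t \<and> t < T \<longrightarrow> P t"
proof -
  have "(AE t in lebesgue_on {0..T}. P t) \<longleftrightarrow> (AE t in lebesgue. t \<in> {0..T} \<longrightarrow> P t)"
    by (rule AE_restrict_space_iff) (simp add: compact_sets_lebesgue)
  then have "AE t in lebesgue. t \<in> {0..T} \<longrightarrow> P t" using assms by blast
  then have "AE t in lborel. t \<in> {0..T} \<longrightarrow> P t" by (simp only: AE_completion_iff)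
  then show ?thesis by eventually_elim auto
qed

lemma simple_borel_measurable_lebesgue:
  fixes s :: "real \<Rightarrow> 'u" and \<phi> :: "'u \<Rightarrow> real"
  assumes fin: "finite (s ` {0..T})" and lev: "\<And>u. u \<in> s ` {0..T} \<Longrightarrow> {t \<in> {0..T}. s t = u} \<in> sets lebesgue"
    and S: "S \<in> sets borel" "S \<subseteq> {0..T}"
  shows "(\<lambda>t. indicator S t * \<phi> (s t)) \<in> borel_measurable lebesgue"
proof -
  have "(\<lambda>t. indicator S t * (\<Sum>u\<in>s ` {0..T}. \<phi> u * indicator {t \<in> {0..T}. s t = u} t)) \<in> borel_measurable lebesgue"
    using lev S(1) by (intro borel_measurable_times borel_measurable_sum borel_measurable_const borel_measurable_indicator) auto
  also have "(\<lambda>t. indicator S t * (\<Sum>u\<in>s ` {0..T}. \<phi> u * indicator {t \<in> {0..T}. s t = u} t)) = (\<lambda>t. indicator S t * \<phi> (s t))"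
  proof
    fix t
    show "indicator S t * (\<Sum>u\<in>s ` {0..T}. \<phi> u * indicator {t \<in> {0..T}. s t = u} t) = indicator S t * \<phi> (s t)"
    proof (cases "t \<in> S")
      case True
      then have t: "t \<in> {0..T}" using S(2) by blast
      have "(\<Sum>u\<in>s ` {0..T}. \<phi> u * indicator {t \<in> {0..T}. s t = u} t) = (\<Sum>u\<in>s ` {0..T}. if u = s t then \<phi> u else 0)"
        using t by (intro sum.cong) (auto simp: indicator_def)
      also have "\<dots> = \<phi> (s t)" using t fin by simp
      finally show ?thesis by simp
    qed simp
  qed
  finally show ?thesis .
qed

lemma continuous_LpD:
  assumes "continuous_Lp p \<Omega> v" "0 \<le> t"
  shows "Lp_on p (lebesgue_on \<Omega>) (\<lambda>x. v (x, t))"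
    and "((\<lambda>s. Lp_int p (lebesgue_on \<Omega>) (\<lambda>x. v (x, s) - v (x, t))) \<longlongrightarrow> 0) (at t within {0..})"
  using assms by (auto simp: continuous_Lp_def Lp_eq_Lp_on Lp_int_def)

lemma W1p0D: "W1p0 p U u \<Longrightarrow> W1p p U u" by (simp add: W1p0_def)

text \<open>
  A good time is one at which the solution is in the Sobolev space with its bound, the approximating
  simple functions converge, and the equation holds for each of their countably many values. At good
  times \<open>r\<close> and \<open>t\<close>, the equation at \<open>r\<close> then holds with the test function \<open>v(t)\<close>, the limit of such values.
  Removing a further null set makes the energy Borel measurable and not just Lebesgue measurable.
\<close>

lemma weak_solution_Lp_flow:
  fixes \<Omega> :: "(real^'n) set" and v :: "(real^'n) \<times> real \<Rightarrow> real^'m"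
  assumes \<Omega>: "open \<Omega>" "bounded \<Omega>" and p: "1 < p" and T: "0 < T"
    and sol: "weak_solution p \<Omega> g v"
  obtains f S C where "Lp_flow (lebesgue_on \<Omega>) p T f (\<lambda>t x. v (x, t)) (\<lambda>t. weak_grad \<Omega> (\<lambda>x. v (x, t))) S C"
    "\<And>t. t \<in> S \<Longrightarrow> has_weak_grad \<Omega> (\<lambda>x. v (x, t)) (weak_grad \<Omega> (\<lambda>x. v (x, t)))"
proof -
  let ?M = "lebesgue_on \<Omega>" and ?G = "\<lambda>t. weak_grad \<Omega> (\<lambda>x. v (x, t))"
  have O [simp]: "\<Omega> \<in> sets lebesgue" using \<Omega> by simp
  interpret M: finite_measure ?M using \<Omega> by (intro finite_measure_lebesgue_on lmeasurable_open)
  obtain vt where cont: "continuous_Lp p \<Omega> v"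
    and wd: "has_weak_deriv (\<Omega> \<times> {0<..}) (0, 1) v vt"
    and vtLp: "\<And>T. 0 < T \<Longrightarrow> Lp p (\<Omega> \<times> {0<..<T}) vt" and lin: "Linf_W1p0 p \<Omega> T v"
    and eq: "\<And>w. W1p0 p \<Omega> w \<Longrightarrow> AE t in lebesgue_on {0..T}.
             (\<integral>x. flux p (vt (x, t)) \<bullet> w x \<partial>?M) + (\<integral>x. flux p (?G t x) \<bullet> weak_grad \<Omega> w x \<partial>?M) = 0"
    using sol T unfolding weak_solution_def flux_def by blast
  obtain C where C: "AE t in lebesgue_on {0..T}. W1p0 p \<Omega> (\<lambda>x. v (x, t)) \<and> W1p_norm p \<Omega> (\<lambda>x. v (x, t)) \<le> C"
    using lin unfolding Linf_W1p0_def by blast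
  obtain s :: "nat \<Rightarrow> real \<Rightarrow> real^'n \<Rightarrow> real^'m" where
    s: "\<And>k. finite (s k ` {0..T})" "\<And>k u. u \<in> s k ` {0..T} \<Longrightarrow> W1p0 p \<Omega> u"
      "\<And>k u. u \<in> s k ` {0..T} \<Longrightarrow> {t \<in> {0..T}. s k t = u} \<in> sets lebesgue"
    and sconv: "AE t in lebesgue_on {0..T}. (\<lambda>k. W1p_norm p \<Omega> (\<lambda>x. s k t x - v (x, t))) \<longlonglongrightarrow> 0"
    using lin unfolding Linf_W1p0_def by blast
  have oW: "open (\<Omega> \<times> {0::real<..})" using \<Omega> by (intro open_Times) auto
  obtain f where f: "f \<in> borel_measurable borel" "AE z in lebesgue. z \<in> \<Omega> \<times> {0<..} \<longrightarrow> f z = vt z"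
  proof -
    have "(\<lambda>z. indicator (\<Omega> \<times> {0<..}) z *\<^sub>R vt z) \<in> borel_measurable lebesgue"
    proof (rule borel_measurable_LIMSEQ_metric)
      fix k
      have "open (\<Omega> \<times> {0<..<real (Suc k)})" using \<Omega> by (intro open_Times) auto
      then show "(\<lambda>z. indicator (\<Omega> \<times> {0<..<real (Suc k)}) z *\<^sub>R vt z) \<in> borel_measurable lebesgue"
        using vtLp[of "real (Suc k)"] by (subst borel_measurable_restrict_space_iff[symmetric]) (auto simp: Lp_def)
    next
      fix z :: "(real^'n) \<times> real"
      obtain K where K: "snd z < real K" using reals_Archimedean2 by blast
      have "indicator (\<Omega> \<times> {0<..}) z *\<^sub>R vt z = indicator (\<Omega> \<times> {0<..<real (Suc k)}) z *\<^sub>R vt z" if "k \<ge> K" for k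
      proof -
        have "snd z < real (Suc k)" using K that by linarith
        then show ?thesis by (cases z) (simp add: indicator_def)
      qed
      then have "\<forall>\<^sub>F k in sequentially. indicator (\<Omega> \<times> {0<..}) z *\<^sub>R vt z = indicator (\<Omega> \<times> {0<..<real (Suc k)}) z *\<^sub>R vt z"
        unfolding eventually_sequentially by blast
      then show "(\<lambda>k. indicator (\<Omega> \<times> {0<..<real (Suc k)}) z *\<^sub>R vt z) \<longlonglongrightarrow> indicator (\<Omega> \<times> {0<..}) z *\<^sub>R vt z"
        by (rule Lim_transform_eventually[OF tendsto_const])
    qed
    moreover have "(\<Omega> \<times> {0::real<..}) \<inter> space lebesgue \<in> sets lebesgue" using oW by simp
    ultimately have "vt \<in> borel_measurable (lebesgue_on (\<Omega> \<times> {0<..}))"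
      by (simp only: borel_measurable_restrict_space_iff)
    from borel_representative[OF borel_open[OF oW] this] obtain w where
      w: "w \<in> borel_measurable borel" "AE z in lebesgue. z \<in> \<Omega> \<times> {0<..} \<longrightarrow> w z = vt z" by blast
    show thesis by (rule that[OF w])
  qed
  let ?F = "\<lambda>z. indicator {0<..<T} (snd z) *\<^sub>R f z"
  have F: "Lp_on p (?M \<Otimes>\<^sub>M lborel) ?F" by (rule Lp_on_time_slab[OF \<Omega>(1) vtLp[OF T] f])
  let ?W = "\<Union>k. s k ` {0..T}"
  have cW: "countable ?W" using s(1) by (intro countable_UN) (auto intro: countable_finite)
  have "AE t in lebesgue_on {0..T}. \<forall>w\<in>?W.
      (\<integral>x. flux p (vt (x, t)) \<bullet> w x \<partial>?M) + (\<integral>x. flux p (?G t x) \<bullet> weak_grad \<Omega> w x \<partial>?M) = 0"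
    unfolding AE_ball_countable[OF cW] using s(2) by (intro ballI eq) auto
  note good = this[THEN AE_lebesgue_on_interval_imp_lborel] C[THEN AE_lebesgue_on_interval_imp_lborel]
    sconv[THEN AE_lebesgue_on_interval_imp_lborel]
  have sec: "AE t in lborel. 0 < t \<longrightarrow> (AE x in ?M. f (x, t) = vt (x, t))"
    using AE_lebesgue_sections[OF f(2)]
  proof eventually_elim
    case (elim t)
    show ?case
    proof
      assume t: "0 < t"
      have "AE x in lebesgue. (x, t) \<in> \<Omega> \<times> {0<..} \<longrightarrow> f (x, t) = vt (x, t)" by (rule AE_completion[OF elim])
      then show "AE x in ?M. f (x, t) = vt (x, t)" using t by (simp add: AE_restrict_space_iff)
    qed
  qed
  define P where "P t \<longleftrightarrow> (\<forall>w\<in>?W. (\<integral>x. flux p (vt (x, t)) \<bullet> w x \<partial>?M) + (\<integral>x. flux p (?G t x) \<bullet> weak_grad \<Omega> w x \<partial>?M) = 0)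
    \<and> W1p0 p \<Omega> (\<lambda>x. v (x, t)) \<and> W1p_norm p \<Omega> (\<lambda>x. v (x, t)) \<le> C
    \<and> (\<lambda>k. W1p_norm p \<Omega> (\<lambda>x. s k t x - v (x, t))) \<longlonglongrightarrow> 0
    \<and> (AE x in ?M. f (x, t) = vt (x, t)) \<and> Lp_on p ?M (\<lambda>x. ?F (x, t))" for t
  have "AE t in lborel. 0 < t \<and> t < T \<longrightarrow> P t"
    using good sec M.AE_Lp_on_snd[OF F] by eventually_elim (auto simp: P_def)
  then obtain N where N: "N \<in> sets borel" "AE t in lborel. t \<notin> N" "\<And>t. t \<notin> N \<Longrightarrow> 0 < t \<and> t < T \<longrightarrow> P t"
    by (rule AE_lborel_avoid_borel_null) blast
  define S0 where "S0 = {0<..<T} - N"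
  have S0: "S0 \<in> sets borel" "S0 \<subseteq> {0..T}" using N(1) by (auto simp: S0_def)
  have PS: "P t" "0 < t" "t < T" if "t \<in> S0" for t using N(3)[of t] that by (auto simp: S0_def)
  have W1: "W1p p \<Omega> (\<lambda>x. v (x, t))" if "t \<in> S0" for t using PS(1)[OF that] by (auto simp: P_def intro: W1p0D)
  have sW: "W1p p \<Omega> (s k t)" if "t \<in> S0" for k t
    using s(2)[of "s k t" k] PS[OF that] by (auto intro: W1p0D)
  have G: "Lp_on p ?M (?G t)" "has_weak_grad \<Omega> (\<lambda>x. v (x, t)) (?G t)" if "t \<in> S0" for t
    using W1pD[OF \<Omega>(1) W1[OF that]] by auto
  have conv: "(\<lambda>k. Lp_int p ?M (\<lambda>x. s k t x - v (x, t))) \<longlonglongrightarrow> 0"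
    "(\<lambda>k. Lp_int p ?M (\<lambda>x. weak_grad \<Omega> (s k t) x - ?G t x)) \<longlonglongrightarrow> 0" if "t \<in> S0" for t
    using W1p_norm_tendsto_0[OF \<Omega>(1) p sW[OF that] W1[OF that]] PS(1)[OF that] by (auto simp: P_def)
  have sLp: "Lp_on p ?M (s k t)" "Lp_on p ?M (weak_grad \<Omega> (s k t))" if "t \<in> S0" for k t
    using W1pD[OF \<Omega>(1) sW[OF that]] by auto
  have "(\<lambda>t. indicator S0 t * Lp_int p ?M (?G t)) \<in> borel_measurable lebesgue"
  proof (rule borel_measurable_LIMSEQ_real)
    show "(\<lambda>t. indicator S0 t * Lp_int p ?M (weak_grad \<Omega> (s k t))) \<in> borel_measurable lebesgue" for k
      by (rule simple_borel_measurable_lebesgue[OF s(1) s(3) S0])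
    show "(\<lambda>k. indicator S0 t * Lp_int p ?M (weak_grad \<Omega> (s k t))) \<longlonglongrightarrow> indicator S0 t * Lp_int p ?M (?G t)" for t
    proof (cases "t \<in> S0")
      case True
      have "(\<lambda>k. Lp_int p ?M (weak_grad \<Omega> (s k t))) \<longlonglongrightarrow> Lp_int p ?M (?G t)"
        using sLp[OF True] G[OF True] conv[OF True] by (intro Lp_int_tendsto[OF p] always_eventually allI)
      then show ?thesis using True by simp
    qed simp
  qed
  from completion_ex_borel_measurable_real[OF this]
  \<comment> \<open>Outside a null set the energy agrees with a Borel function; that set is removed from the good times.\<close>
  obtain E where E: "E \<in> borel_measurable borel" "AE t in lborel. indicator S0 t * Lp_int p ?M (?G t) = E t" by auto
  obtain N' where N': "N' \<in> sets borel" "AE t in lborel. t \<notin> N'" "\<And>t. t \<notin> N' \<Longrightarrow> indicator S0 t * Lp_int p ?M (?G t) = E t"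
    by (rule AE_lborel_avoid_borel_null[OF E(2)]) blast
  define S where "S = S0 - N'"
  have SS0: "S \<subseteq> S0" by (auto simp: S_def)
  have F_eq: "?F (x, t) = f (x, t)" if "t \<in> S" for x t using PS[of t] that SS0 by auto
  have "Lp_flow ?M p T ?F (\<lambda>t x. v (x, t)) ?G S (max C 0 powr p)"
  proof (unfold_locales)
    show "1 < p" by (rule p)
    show "Lp_on p (?M \<Otimes>\<^sub>M lborel) ?F" by (rule F)
    show "Lp_on p ?M (\<lambda>x. v (x, t))" if "0 \<le> t" "t < T" for t by (rule continuous_LpD(1)[OF cont that(1)])
    show "AE x in ?M. v (x, b) - v (x, a) = (\<integral>r. indicator {a..b} r *\<^sub>R ?F (x, r) \<partial>lborel)"
      if "0 < a" "a < b" "b < T" for a b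
      using increment_eq_integral_weak_derivative[OF \<Omega> p wd f F continuous_LpD[OF cont] that] by simp
    show "S \<subseteq> {0<..<T}" using PS SS0 by auto
    show "S \<in> sets borel" using S0 N' by (auto simp: S_def)
    show "AE t in lborel. 0 < t \<and> t < T \<longrightarrow> t \<in> S"
      using N(2) N'(2) by eventually_elim (auto simp: S_def S0_def)
    show "Lp_on p ?M (?G t)" if "t \<in> S" for t using G that SS0 by auto
    show "Lp_int p ?M (?G t) \<le> max C 0 powr p" if "t \<in> S" for t
    proof -
      have t: "t \<in> S0" using that SS0 by auto
      let ?x = "Lp_int p ?M (\<lambda>x. v (x, t))" and ?y = "Lp_int p ?M (?G t)"
      have "?y \<le> ?x + ?y" by simp
      also have "?x + ?y = W1p_norm p \<Omega> (\<lambda>x. v (x, t)) powr p"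
        unfolding W1p_norm_def using p by (simp add: powr_powr Lp_int_def)
      also have "\<dots> \<le> max C 0 powr p"
        using PS(1)[OF t] p by (intro powr_mono2) (auto simp: P_def W1p_norm_def)
      finally show ?thesis .
    qed
    show "Lp_on p ?M (\<lambda>x. ?F (x, t))" if "t \<in> S" for t using PS(1)[of t] that SS0 by (auto simp: P_def)
    show "(\<integral>x. flux p (?F (x, r)) \<bullet> v (x, t) \<partial>?M) + (\<integral>x. flux p (?G r x) \<bullet> ?G t x \<partial>?M) = 0"
      if r: "r \<in> S" and t: "t \<in> S" for r t
    proof -
      have r0: "r \<in> S0" and t0: "t \<in> S0" using r t SS0 by auto
      note Pr = PS(1)[OF r0, unfolded P_def]
      have FLp: "Lp_on p ?M (\<lambda>x. ?F (x, r))" using Pr by blast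
      have ae: "AE x in ?M. ?F (x, r) = vt (x, r)" using Pr F_eq[OF r] by simp
      have vtm: "(\<lambda>x. vt (x, r)) \<in> borel_measurable ?M"
        by (rule borel_measurable_lebesgue_on_AE[OF O Lp_on_measurable[OF FLp] ae])
      have "(\<integral>x. flux p (?F (x, r)) \<bullet> s k t x \<partial>?M) + (\<integral>x. flux p (?G r x) \<bullet> weak_grad \<Omega> (s k t) x \<partial>?M) = 0" for k
      proof -
        have "t \<in> {0..T}" using PS[OF t0] by simp
        then have "s k t \<in> ?W" by blast
        then have "(\<integral>x. flux p (vt (x, r)) \<bullet> s k t x \<partial>?M) + (\<integral>x. flux p (?G r x) \<bullet> weak_grad \<Omega> (s k t) x \<partial>?M) = 0"
          using Pr by blast
        moreover have "(\<integral>x. flux p (?F (x, r)) \<bullet> s k t x \<partial>?M) = (\<integral>x. flux p (vt (x, r)) \<bullet> s k t x \<partial>?M)"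
        proof (rule integral_cong_AE)
          show "AE x in ?M. flux p (?F (x, r)) \<bullet> s k t x = flux p (vt (x, r)) \<bullet> s k t x"
            using ae by eventually_elim simp
        qed (intro borel_measurable_inner flux_measurable Lp_on_measurable[OF FLp] vtm Lp_on_measurable[OF sLp(1)[OF t0]])+
        ultimately show ?thesis by simp
      qed
      moreover have "(\<lambda>k. (\<integral>x. flux p (?F (x, r)) \<bullet> s k t x \<partial>?M) + (\<integral>x. flux p (?G r x) \<bullet> weak_grad \<Omega> (s k t) x \<partial>?M))
          \<longlonglongrightarrow> (\<integral>x. flux p (?F (x, r)) \<bullet> v (x, t) \<partial>?M) + (\<integral>x. flux p (?G r x) \<bullet> ?G t x \<partial>?M)"
      proof (rule tendsto_add)
        show "(\<lambda>k. \<integral>x. flux p (?F (x, r)) \<bullet> s k t x \<partial>?M) \<longlonglongrightarrow> (\<integral>x. flux p (?F (x, r)) \<bullet> v (x, t) \<partial>?M)"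
          using sLp[OF t0] W1pD(1)[OF \<Omega>(1) W1[OF t0]] conv[OF t0]
          by (intro Lp_flux_inner_tendsto[OF p FLp] always_eventually allI)
        show "(\<lambda>k. \<integral>x. flux p (?G r x) \<bullet> weak_grad \<Omega> (s k t) x \<partial>?M) \<longlonglongrightarrow> (\<integral>x. flux p (?G r x) \<bullet> ?G t x \<partial>?M)"
          using sLp[OF t0] G[OF t0] conv[OF t0]
          by (intro Lp_flux_inner_tendsto[OF p G(1)[OF r0]] always_eventually allI)
      qed
      ultimately show ?thesis by (simp only: LIMSEQ_const_iff)
    qed
    show "(\<lambda>t. indicator S t * Lp_int p ?M (?G t)) \<in> borel_measurable borel"
    proof -
      have "indicator S t * Lp_int p ?M (?G t) = indicator (- N') t * E t" for t
        using N'(3)[of t] by (auto simp: S_def indicator_def)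
      moreover have "(\<lambda>t. indicator (- N') t * E t) \<in> borel_measurable borel"
        using N'(1) E(1) by (intro borel_measurable_times borel_measurable_indicator) auto
      ultimately show ?thesis by simp
    qed
  qed
  then show thesis using that G(2) SS0 by blast
qed

section \<open>Monotonicity of the Rayleigh quotient\<close>

theorem proposition5p8:
  fixes \<Omega> :: "(real^'n) set" and p :: real
    and g :: "real^'n \<Rightarrow> real^'m" and v :: "(real^'n) \<times> real \<Rightarrow> real^'m"
  assumes "bounded_smooth_domain \<Omega>"
    and "1 < p"
    and "W1p0 p \<Omega> g"
    and "weak_solution p \<Omega> g v"
    and "\<And>t. t \<ge> 0 \<Longrightarrow> \<not> (AE x in lebesgue_on \<Omega>. v (x, t) = 0)"
  shows "antimono_on {0..} (\<lambda>t. rayleigh_quotient p \<Omega> (\<lambda>x. v (x, t)))"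
proof (rule monotone_onI)
  fix a b :: real
  assume "a \<in> {0..}" "b \<in> {0..}" "a \<le> b"
  then have ab: "0 \<le> a" "a \<le> b" "b < b + 1" by auto
  have \<Omega>: "open \<Omega>" "bounded \<Omega>" using assms(1) by (auto simp: bounded_smooth_domain_def)
  have cont: "continuous_Lp p \<Omega> v" using assms(4) by (simp add: weak_solution_def)
  define T where "T = b + 1"
  have T: "0 < T" using ab by (simp add: T_def)
  obtain f S C where fl: "Lp_flow (lebesgue_on \<Omega>) p T f (\<lambda>t x. v (x, t)) (\<lambda>t. weak_grad \<Omega> (\<lambda>x. v (x, t))) S C"
    and wg: "\<And>t. t \<in> S \<Longrightarrow> has_weak_grad \<Omega> (\<lambda>x. v (x, t)) (weak_grad \<Omega> (\<lambda>x. v (x, t)))"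
    by (rule weak_solution_Lp_flow[OF \<Omega> assms(2) T assms(4)]) blast
  interpret fl: Lp_flow "lebesgue_on \<Omega>" p T f "\<lambda>t x. v (x, t)" "\<lambda>t. weak_grad \<Omega> (\<lambda>x. v (x, t))" S C
    by (rule fl)
  let ?D = fl.energy and ?N = "\<lambda>t. Lp_int p (lebesgue_on \<Omega>) (\<lambda>x. v (x, t))"
  have approx: "\<exists>s. (\<forall>k. s k \<in> S \<and> t < s k) \<and> s \<longlonglongrightarrow> t \<and> (\<lambda>k. ?D (s k)) \<longlonglongrightarrow> ?D t" if t: "0 \<le> t" "t < T" for t
  proof -
    obtain s H where s: "\<And>k. s k \<in> S" "\<And>k. t < s k" "s \<longlonglongrightarrow> t"
      and H: "Lp_on p (lebesgue_on \<Omega>) H"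
        "(\<lambda>k. Lp_int p (lebesgue_on \<Omega>) (\<lambda>x. weak_grad \<Omega> (\<lambda>x. v (x, s k)) x - H x)) \<longlonglongrightarrow> 0"
      by (rule fl.gradient_right_limit[OF t]) blast
    have "s k \<in> {0..} \<and> s k \<noteq> t" for k using s(2)[of k] t by auto
    then have "filterlim s (at t within {0..}) sequentially"
      unfolding filterlim_at using s(3) by simp
    then have "(\<lambda>k. Lp_int p (lebesgue_on \<Omega>) (\<lambda>x. v (x, s k) - v (x, t))) \<longlonglongrightarrow> 0"
      by (rule filterlim_compose[OF continuous_LpD(2)[OF cont t(1)]])
    then have "has_weak_grad \<Omega> (\<lambda>x. v (x, t)) H"
      using fl.vS[OF s(1)] fl.G(1)[OF s(1)] continuous_LpD(1)[OF cont t(1)]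
      by (intro has_weak_grad_limit[OF \<Omega> assms(2) wg[OF s(1)] _ _ _ H(1) _ H(2)])
    then have "?D t = Lp_int p (lebesgue_on \<Omega>) H"
      unfolding fl.energy_def by (rule Lp_on_weak_grad(2)[OF \<Omega>(1) _ H(1)])
    moreover have "(\<lambda>k. ?D (s k)) \<longlonglongrightarrow> Lp_int p (lebesgue_on \<Omega>) H"
      unfolding fl.energy_def using fl.G(1)[OF s(1)] by (intro Lp_int_tendsto[OF assms(2) _ H] always_eventually allI)
    ultimately show ?thesis using s by auto
  qed
  have dissipation: "?D t + p * fl.action r t \<le> ?D r" if rt: "0 \<le> r" "r < t" "t < T" for r t
  proof -
    obtain \<rho> where \<rho>: "\<And>k. \<rho> k \<in> S" "\<And>k. r < \<rho> k" "\<rho> \<longlonglongrightarrow> r" "(\<lambda>k. ?D (\<rho> k)) \<longlonglongrightarrow> ?D r"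
      using approx[of r] rt by auto
    obtain \<tau> where \<tau>: "\<And>k. \<tau> k \<in> S" "\<And>k. t < \<tau> k" "\<tau> \<longlonglongrightarrow> t" "(\<lambda>k. ?D (\<tau> k)) \<longlonglongrightarrow> ?D t"
      using approx[of t] rt by auto
    show ?thesis
    proof (rule tendsto_le[OF sequentially_bot \<rho>(4)])
      show "(\<lambda>k. ?D (\<tau> k) + p * fl.action (\<rho> k) (\<tau> k)) \<longlonglongrightarrow> ?D t + p * fl.action r t"
        by (intro tendsto_add tendsto_mult tendsto_const fl.action_tendsto \<tau> \<rho>)
      show "\<forall>\<^sub>F k in sequentially. ?D (\<tau> k) + p * fl.action (\<rho> k) (\<tau> k) \<le> ?D (\<rho> k)"
        using order_tendstoD(2)[OF \<rho>(3) rt(2)]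
      proof eventually_elim
        case (elim k)
        then show ?case using \<tau>(2)[of k] by (intro fl.energy_dissipation \<rho> \<tau>) simp
      qed
    qed
  qed
  have D_mono: "?D t \<le> ?D r" if "0 \<le> r" "r \<le> t" "t < T" for r t
  proof (cases "r = t")
    case False
    then have "?D t + p * fl.action r t \<le> ?D r" using that by (intro dissipation) auto
    moreover have "0 \<le> p * fl.action r t" using assms(2) by simp
    ultimately show ?thesis by linarith
  qed simp
  have D_right: "(?D \<longlongrightarrow> ?D t) (at_right t)" if t: "0 \<le> t" "t < T" for t
  proof (rule order_tendstoI)
    fix y assume y: "y < ?D t"
    obtain s where s: "\<And>k. s k \<in> S" "\<And>k. t < s k" "(\<lambda>k. ?D (s k)) \<longlonglongrightarrow> ?D t" using approx[OF t] by auto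
    from order_tendstoD(1)[OF s(3) y] obtain k where k: "y < ?D (s k)" by (auto simp: eventually_sequentially)
    have "s k < T" using s(1) fl.S(1) by force
    then show "\<forall>\<^sub>F r in at_right t. y < ?D r"
      unfolding eventually_at_right_field using s(2)[of k] k D_mono t
      by (intro exI[of _ "s k"] conjI allI impI) (auto intro: less_le_trans[OF k])
  next
    fix y assume y: "?D t < y"
    show "\<forall>\<^sub>F r in at_right t. ?D r < y"
      unfolding eventually_at_right_field using t D_mono[of t]
      by (intro exI[of _ T] conjI allI impI) (auto intro: le_less_trans[OF _ y])
  qed
  have N_within: "(?N \<longlongrightarrow> ?N t) (at t within {0..})" if t: "0 \<le> t" for t
  proof (rule Lp_int_tendsto[OF assms(2)])
    show "\<forall>\<^sub>F s in at t within {0..}. Lp_on p (lebesgue_on \<Omega>) (\<lambda>x. v (x, s))"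
      unfolding eventually_at_filter by (intro always_eventually) (auto intro: continuous_LpD(1)[OF cont])
  qed (intro continuous_LpD[OF cont t])+
  have N_right: "(?N \<longlongrightarrow> ?N t) (at_right t)" if "0 \<le> t" "t < T" for t
    by (rule tendsto_within_subset[OF N_within]) (use that in auto)
  have N_left: "(?N \<longlongrightarrow> ?N t) (at_left t)" if "0 < t" "t < T" for t
  proof -
    have "at t within {0..} = at t" using that by (intro at_within_interior) simp
    then have "(?N \<longlongrightarrow> ?N t) (at t)" using N_within[of t] that by simp
    then show ?thesis by (simp add: filterlim_at_split)
  qed
  have N_pos: "0 < ?N t" if t: "0 \<le> t" "t < T" for t
  proof (rule ccontr)
    assume "\<not> 0 < ?N t"
    then have "?N t = 0" using Lp_int_nonneg[of p "lebesgue_on \<Omega>" "\<lambda>x. v (x, t)"] by linarith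
    then have "AE x in lebesgue_on \<Omega>. norm (v (x, t)) powr p = 0"
      using Lp_on_integrable[OF continuous_LpD(1)[OF cont t(1)]]
      by (simp add: Lp_int_def integral_nonneg_eq_0_iff_AE)
    then show False using assms(5)[OF t(1)] by (auto elim: eventually_mono)
  qed
  have rate: "AE t in lborel. 0 < t \<and> t < T \<longrightarrow> ?D t \<le> fl.speed t powr (1 - 1 / p) * ?N t powr (1 / p)"
    using fl.S(3) by eventually_elim (use fl.energy_le_rate in auto)
  have "?D b / ?N b \<le> ?D a / ?N a"
  proof (rule quotient_antimono[where A=fl.speed and T=T and p=p])
    show "?D t + p * (\<integral>r. indicator {s..t} r * fl.speed r \<partial>lborel) \<le> ?D s" if "0 < s" "s < t" "t < T" for s t
      using dissipation[of s t] that by (simp add: fl.action_def)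
    show "?N s - ?N t \<le> p * ?N s powr (1 - 1 / p) * (\<integral>r. indicator {s..t} r * fl.speed r powr (1 / p) \<partial>lborel)"
      if "0 < s" "s < t" "t < T" for s t by (rule fl.Lp_int_v_decrease[OF that])
    show "0 \<le> ?D t" for t by (simp add: fl.energy_def)
  qed (use assms(2) fl.speed_integrable D_right N_right N_left N_pos rate ab in \<open>auto simp: T_def\<close>)
  then show "rayleigh_quotient p \<Omega> (\<lambda>x. v (x, b)) \<le> rayleigh_quotient p \<Omega> (\<lambda>x. v (x, a))"
    unfolding rayleigh_quotient_def fl.energy_def Lp_int_def .
qed

end
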